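(* Let $a:\mathbb{R}\to(0,\infty)$ be continuous and let $b:\mathbb{R}\to\mathbb{R}$ be measurable and locally bounded. Let $X(\cdot)$ be the non-degenerate one-dimensional diffusion process on $\mathbb{R}$ generated by $$L=\frac12 a(x)\frac{d^2}{dx^2}+b(x)\frac{d}{dx},$$ with $P_x$, $E_x$ denoting probabilities and expectations for the process started from $x\in\mathbb{R}$, and let $\tau_y=\inf\{t\ge 0: X(t)=y\}$ for $y\in\mathbb{R}$. Assume that the diffusion is positive recurrent, that is, assume that $$\int_{-\infty}^\infty \frac1{a(x)}\exp\Big(2\int_0^x\frac{b(t)}{a(t)}dt\Big)dx<\infty .$$ Let $$\mu(x)=\frac{c_0}{a(x)}\exp\Big(2\int_0^x\frac{b(t)}{a(t)}dt\Big),\quad x\in\mathbb{R},$$ where $c_0>0$ is the normalizing constant for which $\int_{-\infty}^\infty\mu(x)\,dx=1$, be the invariant probability density of the process, and denote also by $\mu$ the probability measure $\mu(x)\,dx$ on $\mathbb{R}$. Let $\mathcal{X}$ be a random variable independent of $X(\cdot)$ and distributed according to $\mu$, and let $\mathcal{E}^\mu$ denote the expectation with respect to $\mathcal{X}$. (1) If $+\infty$ and $-\infty$ are both entrance boundaries for the diffusion, that is, if both $$\int_0^\infty dx\,\frac1{a(x)}\exp\Big(2\int_0^x\frac{b(s)}{a(s)}ds\Big)\int_0^x dy\,\exp\Big(-2\int_0^y\frac{b(s)}{a(s)}ds\Big)<\infty$$ and $$\int_{-\infty}^0 dx\,\frac1{a(x)}\exp\Big(2\int_0^x\frac{b(s)}{a(s)}ds\Big)\int_x^0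 dy\,\exp\Big(-2\int_0^y\frac{b(s)}{a(s)}ds\Big)<\infty$$ hold, then $$\mathcal{E}^\mu E_x\tau_{\mathcal{X}}=\int_{-\infty}^\infty (E_x\tau_y)\,\mu(y)\,dy$$ is finite and independent of $x\in\mathbb{R}$. Two alternative expressions for the value of this constant are $$2\int_{-\infty}^\infty dy\,\mu(y)\int_y^\infty dz\,\frac{\mu([z,\infty))}{\mu(z)a(z)}\qquad\text{and}\qquad 2\int_{-\infty}^\infty dy\,\mu(y)\int_{-\infty}^y dz\,\frac{\mu((-\infty,z])}{\mu(z)a(z)} .$$ (2) If at least one of $+\infty$, $-\infty$ is not an entrance boundary, that is, if at least one of the two integral conditions displayed in (1) does not hold, then $$\mathcal{E}^\mu E_x\tau_{\mathcal{X}}=\int_{-\infty}^\infty (E_x\tau_y)\,\mu(y)\,dy=\infty\quad\text{for all } x\in\mathbb{R}.$$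
   Context: The following conditions are cited as well known to be equivalent, and the process is called positive recurrent if they hold: (i) $E_x\tau_y<\infty$ for all $x,y\in\mathbb{R}$; (ii) $\int_{-\infty}^\infty \frac1{a(x)}\exp\big(2\int_0^x\frac{b(t)}{a(t)}dt\big)dx<\infty$; (iii) there exists an invariant probability density for the process. The invariant density is then the function $\mu(x)$ given in the claim. The point $+\infty$ is called an entrance boundary if $\lim_{x\to\infty}P_x(\tau_y<t)>0$ for some $y\in\mathbb{R}$ and some $t>0$; $-\infty$ is called an entrance boundary if $\lim_{x\to-\infty}P_x(\tau_y<t)>0$ for some $y\in\mathbb{R}$ and some $t>0$. Given that the process is positive recurrent, the first (respectively second) integral condition displayed in part (1) of the claim is cited as the criterion for $+\infty$ (respectively $-\infty$) to be an entrance boundary. The quantity $\mathcal{E}^\mu E_x\tau_{\mathcal{X}}$ is the expected hitting time, by the diffusion started at $x$, of a point chosen randomly according to the diffusion's invariant distribution. *)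

theory Defs
  imports "HOL-Probability.Probability"
begin

section \<open>Diffusions on the line as solutions of the martingale problem\<close>

definition C2_compact_support :: "(real \<Rightarrow> real) \<Rightarrow> bool" where
  "C2_compact_support f \<longleftrightarrow>
     (\<forall>x. f differentiable at x) \<and> (\<forall>x. deriv f differentiable at x) \<and>
     continuous_on UNIV (deriv (deriv f)) \<and> compact (closure {x. f x \<noteq> 0})"

definition generator :: "(real \<Rightarrow> real) \<Rightarrow> (real \<Rightarrow> real) \<Rightarrow> (real \<Rightarrow> real) \<Rightarrow> real \<Rightarrow> real" where
  "generator a b f x = 1 / 2 * a x * deriv (deriv f) x + b x * deriv f x"

definition natural_filtration :: "'w measure \<Rightarrow> (real \<Rightarrow> 'w \<Rightarrow> real) \<Rightarrow> real \<Rightarrow> 'w measure" where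
  "natural_filtration M X t =
     sigma (space M) {X s -` B \<inter> space M | s B. 0 \<le> s \<and> s \<le> t \<and> B \<in> sets borel}"

text \<open>Time is real-valued, but only times \<open>t \<ge> 0\<close> matter.\<close>

definition martingale :: "'w measure \<Rightarrow> (real \<Rightarrow> 'w measure) \<Rightarrow> (real \<Rightarrow> 'w \<Rightarrow> real) \<Rightarrow> bool" where
  "martingale M F Y \<longleftrightarrow>
     (\<forall>t\<ge>0. subalgebra M (F t) \<and> Y t \<in> borel_measurable (F t) \<and> integrable M (Y t)) \<and>
     (\<forall>s t. 0 \<le> s \<and> s \<le> t \<longrightarrow> (AE \<omega> in M. real_cond_exp M (F s) (Y t) \<omega> = Y s \<omega>))"

text \<open>The process with generator \<open>L = a/2 d\<^sup>2/dx\<^sup>2 + b d/dx\<close> started at \<open>x\<close>: a continuous real-valued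
  (hence non-explosive) process solving the martingale problem for \<open>L\<close> (Stroock and Varadhan).
  With \<open>a > 0\<close> continuous and \<open>b\<close> measurable and locally bounded, this determines its law.\<close>

definition solves_martingale_problem ::
  "(real \<Rightarrow> real) \<Rightarrow> (real \<Rightarrow> real) \<Rightarrow> real \<Rightarrow> 'w measure \<Rightarrow> (real \<Rightarrow> 'w \<Rightarrow> real) \<Rightarrow> bool" where
  "solves_martingale_problem a b x M X \<longleftrightarrow>
     prob_space M \<and>
     (\<forall>t\<ge>0. X t \<in> borel_measurable M) \<and>
     (\<forall>\<omega>\<in>space M. continuous_on {0..} (\<lambda>t. X t \<omega>)) \<and>
     (AE \<omega> in M. X 0 \<omega> = x) \<and>
     (\<forall>f. C2_compact_support f \<longrightarrow>
        martingale M (natural_filtration M X)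
          (\<lambda>t \<omega>. f (X t \<omega>) - (LBINT s:{0..t}. generator a b f (X s \<omega>))))"

definition diffusion ::
  "(real \<Rightarrow> real) \<Rightarrow> (real \<Rightarrow> real) \<Rightarrow> (real \<Rightarrow> 'w measure) \<Rightarrow> (real \<Rightarrow> 'w \<Rightarrow> real) \<Rightarrow> bool" where
  "diffusion a b P X \<longleftrightarrow> (\<forall>x. solves_martingale_problem a b x (P x) X)"

text \<open>The value is \<open>\<infinity>\<close> if the path never visits \<open>y\<close>, since \<open>Inf {} = top\<close>.\<close>

definition hitting_time :: "(real \<Rightarrow> 'w \<Rightarrow> real) \<Rightarrow> real \<Rightarrow> 'w \<Rightarrow> ennreal" where
  "hitting_time X y \<omega> = Inf (ennreal ` {t. 0 \<le> t \<and> X t \<omega> = y})"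

definition expected_hitting_time ::
  "'w measure \<Rightarrow> (real \<Rightarrow> 'w \<Rightarrow> real) \<Rightarrow> real \<Rightarrow> ennreal" where
  "expected_hitting_time M X y = (\<integral>\<^sup>+ \<omega>. hitting_time X y \<omega> \<partial>M)"

text \<open>The expectation over both the process \<open>X\<close> and the random target point \<open>Z\<close>.\<close>

definition expected_random_hitting_time ::
  "'w measure \<Rightarrow> (real \<Rightarrow> 'w \<Rightarrow> real) \<Rightarrow> ('w \<Rightarrow> real) \<Rightarrow> ennreal" where
  "expected_random_hitting_time M X Z = (\<integral>\<^sup>+ \<omega>. hitting_time X (Z \<omega>) \<omega> \<partial>M)"

text \<open>Independence of the generated \<open>\<sigma>\<close>-algebras; \<open>indep_var\<close> does not apply because the
  values of \<open>Z\<close> and the paths have different types.\<close>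

definition independent_of_process ::
  "'w measure \<Rightarrow> ('w \<Rightarrow> real) \<Rightarrow> (real \<Rightarrow> 'w \<Rightarrow> real) \<Rightarrow> bool" where
  "independent_of_process M Z X \<longleftrightarrow>
     prob_space.indep_set M
       (sets (vimage_algebra (space M) Z borel))
       (sets (vimage_algebra (space M) (\<lambda>\<omega>. \<lambda>t\<in>{0..}. X t \<omega>) (\<Pi>\<^sub>M t\<in>{0..}. borel)))"

section \<open>Integral conditions on the coefficients\<close>

text \<open>The interval integral is oriented, so \<open>drift_exponent a b x\<close> is
  \<open>- 2 \<integral>\<^sub>x\<^sup>0 b/a\<close> for negative \<open>x\<close>.\<close>

definition drift_exponent :: "(real \<Rightarrow> real) \<Rightarrow> (real \<Rightarrow> real) \<Rightarrow> real \<Rightarrow> real" where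
  "drift_exponent a b x = 2 * (LBINT t=ereal 0..ereal x. b t / a t)"

text \<open>Positive recurrence and entrance boundaries are taken in the form of the classical integral
  criteria on the coefficients. Those for entrance boundaries are used for positive recurrent
  diffusions only.\<close>

definition positive_recurrent :: "(real \<Rightarrow> real) \<Rightarrow> (real \<Rightarrow> real) \<Rightarrow> bool" where
  "positive_recurrent a b \<longleftrightarrow>
     (\<integral>\<^sup>+ x. ennreal (1 / a x * exp (drift_exponent a b x)) \<partial>lborel) < \<infinity>"

definition entrance_boundary_at_top :: "(real \<Rightarrow> real) \<Rightarrow> (real \<Rightarrow> real) \<Rightarrow> bool" where
  "entrance_boundary_at_top a b \<longleftrightarrow>
     (\<integral>\<^sup>+ x\<in>{0..}. ennreal (1 / a x * exp (drift_exponent a b x)) *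
        (\<integral>\<^sup>+ y\<in>{0..x}. ennreal (exp (- drift_exponent a b y)) \<partial>lborel) \<partial>lborel) < \<infinity>"

definition entrance_boundary_at_bot :: "(real \<Rightarrow> real) \<Rightarrow> (real \<Rightarrow> real) \<Rightarrow> bool" where
  "entrance_boundary_at_bot a b \<longleftrightarrow>
     (\<integral>\<^sup>+ x\<in>{..0}. ennreal (1 / a x * exp (drift_exponent a b x)) *
        (\<integral>\<^sup>+ y\<in>{x..0}. ennreal (exp (- drift_exponent a b y)) \<partial>lborel) \<partial>lborel) < \<infinity>"

end

theory Submission
  imports Defs
begin

text \<open>Write \<open>B\<close> for the drift exponent, \<open>p = e\<^sup>B / a\<close> for the speed density and \<open>s = e\<^sup>-\<^sup>B\<close> for
  the derivative of the scale function. The function \<open>F\<close> with \<open>F' = s h\<close> and \<open>h' = - 2 p q\<close> solves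
  \<open>L F = - q\<close>. With \<open>q\<close> a cutoff increasing to \<open>1\<close> and vanishing near \<open>-\<infinity>\<close>, Dynkin's formula at
  \<open>min t \<tau>\<^sub>y\<close> first bounds \<open>E\<^sub>x \<tau>\<^sub>y\<close> from above, so that \<open>\<tau>\<^sub>y\<close> is almost surely finite, and then,
  \<open>F\<close> being bounded on \<open>(-\<infinity>, y]\<close>, also from below; this gives
  \<open>E\<^sub>x \<tau>\<^sub>y = 2 \<integral>\<^sub>x\<^sup>y s(z) p((-\<infinity>, z]) dz\<close> for \<open>x < y\<close>. Reflecting the line gives the case \<open>x > y\<close>.
  By Tonelli all the expressions in the theorem are equal to
  \<open>2 c\<^sub>0 \<integral> s(z) p((-\<infinity>, z]) p([z, \<infinity>)) dz\<close>, which is finite iff both boundaries are entrance boundaries.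

  As \<open>b\<close> is only measurable, \<open>F\<close> is not twice continuously differentiable. It is approximated by
  replacing \<open>b / a\<close> with continuous functions converging almost everywhere, which suffices because
  the occupation measure of the stopped process is absolutely continuous.\<close>

section \<open>Hitting times of continuous paths\<close>

text \<open>The martingale problem admits only compactly supported C2 functions, whereas
  \<open>F\<close> need not have compact support and \<open>F'\<close> is in general only locally
  Lipschitz. Letting \<open>q\<close> vanish near \<open>-\<infinity>\<close> makes \<open>F\<close>
  vanish there too; as the process stopped at \<open>y\<close> never exceeds \<open>y\<close>, a
  spatial cutoff equal to 1 between that region and \<open>y\<close> changes nothing on the set that
  the process visits. For the lack of smoothness, the absolute continuity of the occupation measure
  comes from an estimate of Krylov type: a test function with second derivative
  \<open>2 g / a\<close> bounds the integral of \<open>g\<close> against the occupation measure by a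
  constant times its Lebesgue integral, and the constant does not depend on \<open>g\<close>. The
  order of the two bounds on the mean hitting time is forced. \<open>F\<close> decreases, so its
  value at the stopped position is at least \<open>F y\<close> whether or not \<open>y\<close> has
  been reached, and an upper bound follows at once. Only when that bound has shown \<open>y\<close>
  to be reached almost surely does the value at the stopped position converge to \<open>F y\<close>,
  which the lower bound requires.\<close>

lemma hitting_time_cases:
  assumes "continuous_on {0..} (\<lambda>t. X t \<omega>)"
  obtains (never) "\<And>s. 0 \<le> s \<Longrightarrow> X s \<omega> \<noteq> y" "hitting_time X y \<omega> = \<infinity>"
  | (hit) m where "0 \<le> m" "X m \<omega> = y" "hitting_time X y \<omega> = ennreal m"
      "\<And>s. 0 \<le> s \<Longrightarrow> s < m \<Longrightarrow> X s \<omega> \<noteq> y"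
proof -
  define S where "S = {t. 0 \<le> t \<and> X t \<omega> = y}"
  have "S = {0..} \<inter> (\<lambda>t. X t \<omega>) -` {y}" by (auto simp: S_def)
  then have cl: "closed S" using continuous_closed_preimage[OF assms, of "{y}"] by simp
  have H: "hitting_time X y \<omega> = Inf (ennreal ` S)" by (simp add: hitting_time_def S_def)
  show ?thesis
  proof (cases "S = {}")
    case True
    then have "hitting_time X y \<omega> = \<infinity>" by (simp add: H infinity_ennreal_def)
    with True show ?thesis using never by (auto simp: S_def)
  next
    case False
    have bdd: "bdd_below S" by (auto simp: S_def intro!: bdd_belowI[of _ 0])
    define m where "m = Inf S"
    \<comment> \<open>A closed set bounded below contains its infimum, so a path that meets
      \<open>y\<close> sits at \<open>y\<close> at its hitting time.\<close>
    have mS: "m \<in> S" unfolding m_def using closed_contains_Inf[OF False bdd cl] .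
    have le: "m \<le> s" if "s \<in> S" for s unfolding m_def using cInf_lower[OF that bdd] .
    have "Inf (ennreal ` S) = ennreal m"
      using mS le by (intro antisym INF_lower INF_greatest) (auto intro: ennreal_leI)
    then show ?thesis using hit[of m] mS le H unfolding S_def by fastforce
  qed
qed

lemma hitting_time_le_iff:
  assumes "continuous_on {0..} (\<lambda>t. X t \<omega>)" "0 \<le> r"
  shows "hitting_time X y \<omega> \<le> ennreal r \<longleftrightarrow> (\<exists>s\<in>{0..r}. X s \<omega> = y)"
  using assms(1)
proof (cases rule: hitting_time_cases[where y = y])
  case never
  then show ?thesis by (auto simp: top_unique)
next
  case (hit m)
  then show ?thesis using assms(2) by (auto simp: not_less intro!: bexI[of _ m]) (meson linorder_not_less order_trans)
qed

text \<open>Near misses at rational times suffice because the minimum of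
  \<open>\<bar>g - y\<bar>\<close> over a compact interval is attained. Clamping to
  \<open>[0, r]\<close> uses no value after time \<open>r\<close>, so the event lies in the
  filtration at \<open>r\<close>; it also lets rational times beyond \<open>r\<close> stand for
  \<open>r\<close> itself.\<close>

lemma hits_iff_rational:
  fixes g :: "real \<Rightarrow> real"
  assumes g: "continuous_on {0..r} g" and r: "0 \<le> r"
  shows "(\<exists>s\<in>{0..r}. g s = y) \<longleftrightarrow> (\<forall>n::nat. \<exists>q\<in>\<rat>. \<bar>g (max 0 (min r q)) - y\<bar> < 1 / Suc n)"
proof
  assume "\<exists>s\<in>{0..r}. g s = y"
  then obtain s where s: "0 \<le> s" "s \<le> r" "g s = y" by auto
  show "\<forall>n::nat. \<exists>q\<in>\<rat>. \<bar>g (max 0 (min r q)) - y\<bar> < 1 / Suc n"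
  proof
    fix n :: nat
    \<comment> \<open>The clamped path is continuous on the whole line, so \<open>?U\<close> is open
      and contains rationals close to \<open>s\<close> even when \<open>s\<close> is an
      endpoint.\<close>
    have c: "continuous_on UNIV (\<lambda>q. g (max 0 (min r q)))"
      using r by (intro continuous_on_compose2[OF g] continuous_intros) auto
    let ?U = "{q. \<bar>g (max 0 (min r q)) - y\<bar> < 1 / Suc n}"
    have "open ?U" by (intro open_Collect_less continuous_intros c)
    moreover have "s \<in> ?U" using s by auto
    ultimately obtain e where e: "e > 0" "ball s e \<subseteq> ?U" by (meson openE)
    obtain q where "q \<in> \<rat>" "s < q" "q < s + e" using Rats_dense_in_real[of s "s+e"] e by auto
    then have "q \<in> ball s e" by (auto simp: dist_real_def)
    then show "\<exists>q\<in>\<rat>. \<bar>g (max 0 (min r q)) - y\<bar> < 1 / Suc n" using e \<open>q \<in> \<rat>\<close> by blast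
  qed
next
  assume R: "\<forall>n::nat. \<exists>q\<in>\<rat>. \<bar>g (max 0 (min r q)) - y\<bar> < 1 / Suc n"
  have "continuous_on {0..r} (\<lambda>s. \<bar>g s - y\<bar>)" by (intro continuous_intros g)
  from continuous_attains_inf[OF _ _ this] r obtain s0 where
    s0: "s0 \<in> {0..r}" "\<And>s. s \<in> {0..r} \<Longrightarrow> \<bar>g s0 - y\<bar> \<le> \<bar>g s - y\<bar>" by auto
  have "g s0 = y"
  proof (rule ccontr)
    assume "g s0 \<noteq> y"
    then obtain n where n: "inverse (real (Suc n)) < \<bar>g s0 - y\<bar>"
      using reals_Archimedean[of "\<bar>g s0 - y\<bar>"] by auto
    from R obtain q where "\<bar>g (max 0 (min r q)) - y\<bar> < 1 / Suc n" by blast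
    moreover have "max 0 (min r q) \<in> {0..r}" using r by auto
    ultimately show False using s0(2)[of "max 0 (min r q)"] n by (simp add: inverse_eq_divide)
  qed
  then show "\<exists>s\<in>{0..r}. g s = y" using s0 by blast
qed

text \<open>\<open>N\<close> and the target \<open>Y\<close> are general for two purposes: a fixed
  level in the natural filtration, where the event makes \<open>\<sigma>\<close> a stopping time,
  and a random target on a product space.\<close>

lemma hit_event_measurable:
  fixes X :: "real \<Rightarrow> 'w \<Rightarrow> real" and Y :: "'w \<Rightarrow> real"
  assumes X: "\<And>s. 0 \<le> s \<Longrightarrow> s \<le> r \<Longrightarrow> X s \<in> borel_measurable N"
    and Y: "Y \<in> borel_measurable N" and r: "0 \<le> r"
    and cont: "\<And>\<omega>. \<omega> \<in> space N \<Longrightarrow> continuous_on {0..} (\<lambda>t. X t \<omega>)"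
  shows "{\<omega> \<in> space N. \<exists>s\<in>{0..r}. X s \<omega> = Y \<omega>} \<in> sets N"
proof -
  have c: "continuous_on {0..r} (\<lambda>t. X t \<omega>)" if "\<omega> \<in> space N" for \<omega>
    using continuous_on_subset[OF cont[OF that]] by auto
  have "{\<omega> \<in> space N. \<exists>s\<in>{0..r}. X s \<omega> = Y \<omega>}
    = {\<omega> \<in> space N. \<forall>n::nat. \<exists>q\<in>\<rat>. \<bar>X (max 0 (min r q)) \<omega> - Y \<omega>\<bar> < 1 / Suc n}"
    using hits_iff_rational[OF c r] by blast
  also have "\<dots> \<in> sets N"
  proof -
    have [measurable]: "X (max 0 (min r q)) \<in> borel_measurable N" for q using r by (intro X) auto
    note Y[measurable]
    have "countable \<rat>" by (rule countable_rat)
    then show ?thesis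
      by (intro sets.sets_Collect_countable_All sets.sets_Collect_countable_Ex') measurable
  qed
  finally show ?thesis .
qed

lemma hitting_time_measurable:
  fixes X :: "real \<Rightarrow> 'w \<Rightarrow> real" and Y :: "'w \<Rightarrow> real"
  assumes X: "\<And>s. 0 \<le> s \<Longrightarrow> X s \<in> borel_measurable N"
    and Y: "Y \<in> borel_measurable N"
    and cont: "\<And>\<omega>. \<omega> \<in> space N \<Longrightarrow> continuous_on {0..} (\<lambda>t. X t \<omega>)"
  shows "(\<lambda>\<omega>. hitting_time X (Y \<omega>) \<omega>) \<in> borel_measurable N"
proof (rule borel_measurableI_le)
  fix c :: ennreal
  show "{\<omega> \<in> space N. hitting_time X (Y \<omega>) \<omega> \<le> c} \<in> sets N"
  proof (cases c)
    case (real r)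
    have "{\<omega> \<in> space N. hitting_time X (Y \<omega>) \<omega> \<le> c} = {\<omega> \<in> space N. \<exists>s\<in>{0..r}. X s \<omega> = Y \<omega>}"
      using hitting_time_le_iff[where X = X, OF cont, where r = r] real by blast
    then show ?thesis using hit_event_measurable[OF X Y _ cont, of r] real by simp
  qed auto
qed

section \<open>Optional stopping and the occupation measure\<close>

lemma martingale_restricted_integral:
  assumes M: "prob_space M" and mart: "martingale M F Y" and st: "0 \<le> s" "s \<le> t"
    and A: "A \<in> sets (F s)"
  shows "(\<integral>\<omega>. indicator A \<omega> * Y s \<omega> \<partial>M) = (\<integral>\<omega>. indicator A \<omega> * Y t \<omega> \<partial>M)"
proof -
  interpret prob_space M by fact
  have sub: "subalgebra M (F s)" and int: "integrable M (Y t)" "integrable M (Y s)"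
    and AE: "AE \<omega> in M. real_cond_exp M (F s) (Y t) \<omega> = Y s \<omega>"
    using mart st unfolding martingale_def by auto
  interpret finite_measure_subalgebra M "F s" by unfold_locales (rule sub)
  have AM[measurable]: "A \<in> sets M" using A sub by (auto simp: subalgebra_def)
  have [measurable]: "Y s \<in> borel_measurable M" using int by auto
  have "(LINT \<omega>:A|M. Y t \<omega>) = (LINT \<omega>:A|M. real_cond_exp M (F s) (Y t) \<omega>)"
    by (rule real_cond_exp_intA[OF int(1) A])
  also have "\<dots> = (LINT \<omega>:A|M. Y s \<omega>)"
    unfolding set_lebesgue_integral_def by (intro integral_cong_AE) (use AE in auto)
  finally show ?thesis by (simp add: set_lebesgue_integral_def)
qed

text \<open>The stopping time is rounded up to a grid. On each cell the martingale property replaces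
  \<open>Y\<close> at the grid point by \<open>Y t\<close>, and summing over the cells gives the
  claim for the rounded time. Continuity of the paths and the uniform bound \<open>C\<close> then
  let the mesh tend to 0.\<close>

lemma optional_stopping:
  fixes \<sigma> :: "'w \<Rightarrow> real"
  assumes M: "prob_space M" and mart: "martingale M F Y"
    and mono: "\<And>r s. r \<le> s \<Longrightarrow> sets (F r) \<subseteq> sets (F s)" and t: "0 < t"
    and \<sigma>: "\<And>\<omega>. \<omega> \<in> space M \<Longrightarrow> 0 \<le> \<sigma> \<omega> \<and> \<sigma> \<omega> \<le> t"
    and meas: "\<And>r. 0 \<le> r \<Longrightarrow> r < t \<Longrightarrow> {\<omega> \<in> space M. \<sigma> \<omega> \<le> r} \<in> sets (F r)"
    and bnd: "\<And>\<omega> s. \<omega> \<in> space M \<Longrightarrow> 0 \<le> s \<Longrightarrow> s \<le> t \<Longrightarrow> \<bar>Y s \<omega>\<bar> \<le> C"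
    and cont: "\<And>\<omega>. \<omega> \<in> space M \<Longrightarrow> continuous_on {0..t} (\<lambda>s. Y s \<omega>)"
  shows "(\<integral>\<omega>. Y (\<sigma> \<omega>) \<omega> \<partial>M) = (\<integral>\<omega>. Y 0 \<omega> \<partial>M)"
    and "(\<lambda>\<omega>. Y (\<sigma> \<omega>) \<omega>) \<in> borel_measurable M"
proof -
  interpret prob_space M by fact
  \<comment> \<open>\<open>g n (k n \<omega>)\<close> is the least point of the grid of mesh \<open>t / (n + 1)\<close> above \<open>\<sigma> \<omega>\<close>\<close>
  define k where "k n \<omega> = nat \<lceil>real (Suc n) * \<sigma> \<omega> / t\<rceil>" for n \<omega>
  define g where "g n j = t * real j / real (Suc n)" for n j :: nat
  \<comment> \<open>Rounding up rather than down turns \<open>k n \<omega> \<le> j\<close> into an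
    event about \<open>\<sigma>\<close> that is already decided at time
    \<open>g n j\<close>.\<close>
  have k_le: "k n \<omega> \<le> j \<longleftrightarrow> \<sigma> \<omega> \<le> g n j" if "\<omega> \<in> space M" for n j \<omega>
    unfolding k_def g_def using t \<sigma>[OF that] by (simp add: nat_le_iff ceiling_le_iff field_simps)
  have kN: "k n \<omega> \<le> Suc n" if "\<omega> \<in> space M" for n \<omega>
    unfolding k_le[OF that] using \<sigma>[OF that] by (simp add: g_def)
  have g0: "0 \<le> g n j" for n j using t by (simp add: g_def)
  have glt: "g n j < t \<longleftrightarrow> j < Suc n" for n j
    using t mult_less_cancel_left_pos[OF t, of "real j" "real (Suc n)"]
    by (simp add: g_def pos_divide_less_eq del: of_nat_Suc)
  have gmono: "j \<le> j' \<Longrightarrow> g n j \<le> g n j'" for n j j'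
    using t unfolding g_def by (intro divide_right_mono mult_left_mono) auto
  have sub: "s \<ge> 0 \<Longrightarrow> subalgebra M (F s)" for s using mart by (auto simp: martingale_def)
  have Ym: "s \<ge> 0 \<Longrightarrow> integrable M (Y s)" for s using mart by (auto simp: martingale_def)
  define A where "A n j = {\<omega> \<in> space M. k n \<omega> = j}" for n j
  have A_F: "A n j \<in> sets (F (g n j))" if j: "j < Suc n" for n j
  proof -
    have *: "{\<omega> \<in> space M. k n \<omega> \<le> i} \<in> sets (F (g n j))" if "i \<le> j" for i
    proof -
      have "{\<omega> \<in> space M. k n \<omega> \<le> i} = {\<omega> \<in> space M. \<sigma> \<omega> \<le> g n i}" using k_le by auto
      also have "\<dots> \<in> sets (F (g n i))" by (rule meas) (use g0 glt j that in auto)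
      finally show ?thesis using mono[OF gmono[OF that]] by blast
    qed
    show ?thesis
    proof (cases j)
      case 0 then show ?thesis using *[of 0] by (simp add: A_def)
    next
      case (Suc i)
      have "A n j = {\<omega> \<in> space M. k n \<omega> \<le> j} - {\<omega> \<in> space M. k n \<omega> \<le> i}"
        by (auto simp: A_def Suc)
      then show ?thesis using *[of j] *[of i] Suc by auto
    qed
  qed
  have A_M: "A n j \<in> sets M" for n j
  proof -
    consider "j < Suc n" | "j = Suc n" | "j > Suc n" by linarith
    then show ?thesis
    proof cases
      case 1 then show ?thesis using A_F[OF 1] sub[OF g0] by (auto simp: subalgebra_def)
    next
      case 2
      \<comment> \<open>\<open>meas\<close> speaks only of times before \<open>t\<close>, so the
        cell of the last grid point is obtained as the complement of the earlier ones. On it the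
        grid point is \<open>t\<close> itself.\<close>
      have "A n j = space M - (\<Union>i<Suc n. A n i)" using kN by (auto simp: A_def 2 le_less)
      moreover have "A n i \<in> sets M" if "i < Suc n" for i
        using A_F[OF that] sub[OF g0] by (auto simp: subalgebra_def)
      ultimately show ?thesis by auto
    next
      case 3
      then have "A n j = {}" unfolding A_def using leD[OF kN[of _ n]] by auto
      then show ?thesis by simp
    qed
  qed
  have split: "Z (k n \<omega>) \<omega> = (\<Sum>j\<le>Suc n. indicator (A n j) \<omega> * Z j \<omega>)"
    if "\<omega> \<in> space M" for n \<omega> and Z :: "nat \<Rightarrow> 'w \<Rightarrow> real"
  proof -
    have "(\<Sum>j\<le>Suc n. indicator (A n j) \<omega> * Z j \<omega>) = (\<Sum>j\<le>Suc n. if j = k n \<omega> then Z j \<omega> else 0)"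
      by (intro sum.cong) (auto simp: A_def indicator_def that)
    also have "\<dots> = Z (k n \<omega>) \<omega>" using kN[OF that, of n] by simp
    finally show ?thesis by simp
  qed
  have intA: "integrable M (\<lambda>\<omega>. indicator (A n j) \<omega> * Y s \<omega>)" if "s \<ge> 0" for n j s
    using integrable_mult_indicator[OF A_M Ym[OF that]] by simp
  have meas_n: "(\<lambda>\<omega>. Y (g n (k n \<omega>)) \<omega>) \<in> borel_measurable M" for n
  proof -
    have "(\<lambda>\<omega>. \<Sum>j\<le>Suc n. indicator (A n j) \<omega> * Y (g n j) \<omega>) \<in> borel_measurable M"
      using intA[OF g0] by (intro borel_measurable_sum) auto
    then show ?thesis using split[of _ "\<lambda>j \<omega>. Y (g n j) \<omega>"] by (subst measurable_cong) auto
  qed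
  have int_n: "(\<integral>\<omega>. Y (g n (k n \<omega>)) \<omega> \<partial>M) = (\<integral>\<omega>. Y t \<omega> \<partial>M)" for n
  proof -
    have "(\<integral>\<omega>. Y (g n (k n \<omega>)) \<omega> \<partial>M) = (\<integral>\<omega>. (\<Sum>j\<le>Suc n. indicator (A n j) \<omega> * Y (g n j) \<omega>) \<partial>M)"
      by (intro Bochner_Integration.integral_cong refl) (use split[of _ "\<lambda>j \<omega>. Y (g n j) \<omega>"] in auto)
    also have "\<dots> = (\<Sum>j\<le>Suc n. \<integral>\<omega>. indicator (A n j) \<omega> * Y (g n j) \<omega> \<partial>M)"
      by (intro Bochner_Integration.integral_sum intA g0)
    also have "\<dots> = (\<Sum>j\<le>Suc n. \<integral>\<omega>. indicator (A n j) \<omega> * Y t \<omega> \<partial>M)"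
    proof (intro sum.cong refl)
      fix j assume "j \<in> {..Suc n}"
      then consider "j < Suc n" | "j = Suc n" by fastforce
      then show "(\<integral>\<omega>. indicator (A n j) \<omega> * Y (g n j) \<omega> \<partial>M) = (\<integral>\<omega>. indicator (A n j) \<omega> * Y t \<omega> \<partial>M)"
      proof cases
        case 1
        then show ?thesis using glt[of n j] by (intro martingale_restricted_integral[OF M mart g0 _ A_F]) auto
      next
        case 2
        then have "g n j = t" by (simp add: g_def)
        then show ?thesis by simp
      qed
    qed
    also have "\<dots> = (\<integral>\<omega>. (\<Sum>j\<le>Suc n. indicator (A n j) \<omega> * Y t \<omega>) \<partial>M)"
      using t by (intro Bochner_Integration.integral_sum[symmetric] intA) auto
    also have "\<dots> = (\<integral>\<omega>. Y t \<omega> \<partial>M)"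
      by (intro Bochner_Integration.integral_cong refl) (use split[of _ "\<lambda>j \<omega>. Y t \<omega>"] in auto)
    finally show ?thesis .
  qed
  have lim: "(\<lambda>n. Y (g n (k n \<omega>)) \<omega>) \<longlonglongrightarrow> Y (\<sigma> \<omega>) \<omega>" if w: "\<omega> \<in> space M" for \<omega>
  proof -
    have lower: "\<sigma> \<omega> \<le> g n (k n \<omega>)" for n using k_le[OF w, of n "k n \<omega>"] by simp
    have upper: "g n (k n \<omega>) \<le> \<sigma> \<omega> + t / real (Suc n)" for n
    proof -
      have "0 \<le> real (Suc n) * \<sigma> \<omega> / t" using \<sigma>[OF w] t by simp
      then have "real (k n \<omega>) \<le> real (Suc n) * \<sigma> \<omega> / t + 1" unfolding k_def by linarith
      then have "t * real (k n \<omega>) \<le> t * (real (Suc n) * \<sigma> \<omega> / t + 1)" using t by (intro mult_left_mono) auto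
      also have "\<dots> = (\<sigma> \<omega> + t / real (Suc n)) * real (Suc n)" using t by (simp add: field_simps)
      finally show ?thesis unfolding g_def by (simp add: divide_le_eq)
    qed
    have "(\<lambda>n. \<sigma> \<omega> + t / real (Suc n)) \<longlonglongrightarrow> \<sigma> \<omega> + 0"
      by (intro tendsto_add tendsto_const LIMSEQ_Suc[OF lim_const_over_n[of t]])
    then have L: "(\<lambda>n. \<sigma> \<omega> + t / real (Suc n)) \<longlonglongrightarrow> \<sigma> \<omega>" by (simp only: add_0_right)
    have g_lim: "(\<lambda>n. g n (k n \<omega>)) \<longlonglongrightarrow> \<sigma> \<omega>"
      by (rule tendsto_sandwich[OF always_eventually always_eventually tendsto_const L])
        (intro allI lower upper)+
    have g_in: "g n (k n \<omega>) \<in> {0..t}" for n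
      using gmono[OF kN[OF w], of n n] g0[of n] t by (simp add: g_def del: of_nat_Suc)
    show ?thesis
      by (rule continuous_on_tendsto_compose[OF cont[OF w] g_lim]) (use \<sigma>[OF w] g_in in auto)
  qed
  show ms: "(\<lambda>\<omega>. Y (\<sigma> \<omega>) \<omega>) \<in> borel_measurable M"
    by (rule borel_measurable_LIMSEQ_real[OF lim meas_n])
  have "(\<lambda>n. \<integral>\<omega>. Y (g n (k n \<omega>)) \<omega> \<partial>M) \<longlonglongrightarrow> (\<integral>\<omega>. Y (\<sigma> \<omega>) \<omega> \<partial>M)"
  proof (rule integral_dominated_convergence[where w = "\<lambda>_. C"])
    show "AE \<omega> in M. norm (Y (g n (k n \<omega>)) \<omega>) \<le> C" for n
    proof (rule AE_I2)
      fix \<omega> assume w: "\<omega> \<in> space M"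
      show "norm (Y (g n (k n \<omega>)) \<omega>) \<le> C"
        using gmono[OF kN[OF w], of n n] g0[of n] t bnd[OF w, of "g n (k n \<omega>)"]
        by (simp add: g_def del: of_nat_Suc)
    qed
  qed (use lim ms meas_n in auto)
  then have "(\<integral>\<omega>. Y (\<sigma> \<omega>) \<omega> \<partial>M) = (\<integral>\<omega>. Y t \<omega> \<partial>M)"
    unfolding int_n by (metis LIMSEQ_const_iff)
  also have "\<dots> = (\<integral>\<omega>. Y 0 \<omega> \<partial>M)"
  proof -
    have "space M \<in> sets (F 0)" using sub[of 0] sets.top[of "F 0"] by (simp add: subalgebra_def)
    from martingale_restricted_integral[OF M mart _ _ this, of t] t
    have "(\<integral>\<omega>. indicator (space M) \<omega> * Y 0 \<omega> \<partial>M) = (\<integral>\<omega>. indicator (space M) \<omega> * Y t \<omega> \<partial>M)" by simp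
    moreover have "(\<integral>\<omega>. indicator (space M) \<omega> * Y s \<omega> \<partial>M) = (\<integral>\<omega>. Y s \<omega> \<partial>M)" for s
      by (intro Bochner_Integration.integral_cong) auto
    ultimately show ?thesis by simp
  qed
  finally show "(\<integral>\<omega>. Y (\<sigma> \<omega>) \<omega> \<partial>M) = (\<integral>\<omega>. Y 0 \<omega> \<partial>M)" .
qed

text \<open>Rounding time up to a grid leaves countably many measurable functions of
  \<open>\<omega>\<close>, and path continuity gives the limit. The clamp \<open>max 0 s\<close>
  extends the path to all real times without consulting negative ones.\<close>

lemma joint_measurable_paths:
  fixes X :: "real \<Rightarrow> 'w \<Rightarrow> real"
  assumes X: "\<And>s. 0 \<le> s \<Longrightarrow> X s \<in> borel_measurable N"
    and cont: "\<And>\<omega>. \<omega> \<in> space N \<Longrightarrow> continuous_on {0..} (\<lambda>t. X t \<omega>)"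
  shows "(\<lambda>(\<omega>, s). X (max 0 s) \<omega>) \<in> borel_measurable (N \<Otimes>\<^sub>M borel)"
proof -
  define G where "G n s = of_int \<lceil>real (Suc n) * max 0 s\<rceil> / real (Suc n)" for n and s :: real
  have G0: "0 \<le> G n s" for n s
    unfolding G_def by (intro divide_nonneg_nonneg) (auto intro: order_less_le_trans[of _ 0])
  have lim: "(\<lambda>n. X (G n s) \<omega>) \<longlonglongrightarrow> X (max 0 s) \<omega>" if w: "\<omega> \<in> space N" for \<omega> s
  proof -
    have lo: "max 0 s \<le> G n s" for n
      unfolding G_def by (subst pos_le_divide_eq) (auto simp: mult.commute simp del: of_nat_Suc)
    have up: "G n s \<le> max 0 s + 1 / real (Suc n)" for n
    proof -
      have "real_of_int \<lceil>real (Suc n) * max 0 s\<rceil> \<le> real (Suc n) * max 0 s + 1" by linarith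
      also have "\<dots> = (max 0 s + 1 / real (Suc n)) * real (Suc n)" by (simp add: field_simps)
      finally show ?thesis unfolding G_def by (simp add: divide_le_eq del: of_nat_Suc)
    qed
    have "(\<lambda>n. max 0 s + 1 / real (Suc n)) \<longlonglongrightarrow> max 0 s + 0"
      by (intro tendsto_add tendsto_const LIMSEQ_Suc[OF lim_const_over_n])
    then have L: "(\<lambda>n. max 0 s + 1 / real (Suc n)) \<longlonglongrightarrow> max 0 s" by (simp only: add_0_right)
    have "(\<lambda>n. G n s) \<longlonglongrightarrow> max 0 s"
      by (rule tendsto_sandwich[OF always_eventually always_eventually tendsto_const L])
        (intro allI lo up)+
    from continuous_on_tendsto_compose[OF cont[OF w] this] show ?thesis using G0 by auto
  qed
  show ?thesis
  proof (rule borel_measurable_LIMSEQ_real)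
    fix z assume "z \<in> space (N \<Otimes>\<^sub>M (borel :: real measure))"
    then show "(\<lambda>n. X (G n (snd z)) (fst z)) \<longlonglongrightarrow> (case z of (\<omega>, s) \<Rightarrow> X (max 0 s) \<omega>)"
      using lim[of "fst z"] by (auto simp: space_pair_measure split_beta)
  next
    fix n
    have "(\<lambda>z. X (max 0 (of_int i / real (Suc n))) (fst z)) \<in> borel_measurable (N \<Otimes>\<^sub>M (borel :: real measure))" for i :: int
      by (rule measurable_compose[OF measurable_fst X]) simp
    moreover have "(\<lambda>z. \<lceil>real (Suc n) * max 0 (snd z)\<rceil>) \<in> N \<Otimes>\<^sub>M (borel :: real measure) \<rightarrow>\<^sub>M count_space UNIV"
      by measurable
    ultimately have "(\<lambda>z. X (max 0 (of_int \<lceil>real (Suc n) * max 0 (snd z)\<rceil> / real (Suc n))) (fst z))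
      \<in> borel_measurable (N \<Otimes>\<^sub>M (borel :: real measure))"
      by (rule measurable_compose_countable)
    then show "(\<lambda>z. X (G n (snd z)) (fst z)) \<in> borel_measurable (N \<Otimes>\<^sub>M (borel :: real measure))"
      using G0[of n] by (simp add: G_def max_absorb2)
  qed
qed

section \<open>Test functions of compact support and their images under the generator\<close>

lemma C2_compact_supportE:
  assumes "C2_compact_support f"
  obtains R where "\<And>x. R < \<bar>x\<bar> \<Longrightarrow> f x = 0 \<and> deriv f x = 0 \<and> deriv (deriv f) x = 0"
    "\<And>x. (f has_real_derivative deriv f x) (at x)"
    "\<And>x. (deriv f has_real_derivative deriv (deriv f) x) (at x)"
    "continuous_on UNIV f" "continuous_on UNIV (deriv f)" "continuous_on UNIV (deriv (deriv f))"
proof -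
  have d: "\<And>x. (f has_real_derivative deriv f x) (at x)"
    "\<And>x. (deriv f has_real_derivative deriv (deriv f) x) (at x)"
    using assms unfolding C2_compact_support_def
    by (auto simp: field_differentiable_derivI real_differentiableE DERIV_imp_deriv
        intro!: DERIV_deriv_iff_real_differentiable[THEN iffD2])
  from assms have "bounded (closure {x. f x \<noteq> 0})"
    by (simp add: C2_compact_support_def compact_imp_bounded)
  then obtain R where R: "\<And>x. x \<in> closure {x. f x \<noteq> 0} \<Longrightarrow> \<bar>x\<bar> \<le> R"
    unfolding bounded_iff real_norm_def by auto
  have f0: "f x = 0" if "R < \<bar>x\<bar>" for x using R[of x] that closure_subset[of "{x. f x \<noteq> 0}"] by auto
  have op: "open {x::real. R < \<bar>x\<bar>}" by (intro open_Collect_less continuous_intros)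
  have zero: "deriv g x = 0" if "\<And>x. R < \<bar>x\<bar> \<Longrightarrow> g x = 0" "R < \<bar>x\<bar>" for g :: "real \<Rightarrow> real" and x
    by (intro DERIV_imp_deriv has_field_derivative_transform_within_open[OF DERIV_const[of 0] op])
      (use that in auto)
  have f1: "deriv f x = 0" if "R < \<bar>x\<bar>" for x by (rule zero[OF f0 that])
  have f2: "deriv (deriv f) x = 0" if "R < \<bar>x\<bar>" for x by (rule zero[OF f1 that])
  show ?thesis
  proof (rule that[of R])
    show "continuous_on UNIV f" "continuous_on UNIV (deriv f)"
      using d by (auto intro!: continuous_at_imp_continuous_on DERIV_isCont)
    show "continuous_on UNIV (deriv (deriv f))" using assms by (simp add: C2_compact_support_def)
  qed (use d f0 f1 f2 in auto)
qed

lemma continuous_bounded_Icc: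
  fixes f :: "real \<Rightarrow> real"
  assumes "continuous_on UNIV f"
  obtains C where "0 \<le> C" "\<And>x. c \<le> x \<Longrightarrow> x \<le> d \<Longrightarrow> \<bar>f x\<bar> \<le> C"
proof -
  have "compact (f ` {c..d})" by (intro compact_continuous_image continuous_on_subset[OF assms]) auto
  from compact_imp_bounded[OF this] obtain C where "\<forall>z\<in>f ` {c..d}. norm z \<le> C"
    unfolding bounded_iff by blast
  then show ?thesis by (intro that[of "max 0 C"]) (auto simp: le_max_iff_disj)
qed

locale diffusion_coefficients =
  fixes a b :: "real \<Rightarrow> real"
  assumes a_cont: "continuous_on UNIV a"
    and a_pos: "\<And>x. 0 < a x"
    and b_meas[measurable]: "b \<in> borel_measurable borel"
    and b_locally_bounded: "\<And>K. compact K \<Longrightarrow> bounded (b ` K)"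
begin

lemma a_meas[measurable]: "a \<in> borel_measurable borel"
  by (rule borel_measurable_continuous_onI[OF a_cont])

lemma b_bounded_Icc:
  obtains C where "0 \<le> C" "\<And>x. c \<le> x \<Longrightarrow> x \<le> d \<Longrightarrow> \<bar>b x\<bar> \<le> C"
proof -
  obtain C where "\<forall>z\<in>b ` {c..d}. norm z \<le> C"
    using b_locally_bounded[of "{c..d}"] unfolding bounded_iff by auto
  then show ?thesis by (intro that[of "max 0 C"]) (auto simp: le_max_iff_disj)
qed

lemma generator_measurable:
  assumes "C2_compact_support f"
  shows "generator a b f \<in> borel_measurable borel"
proof -
  from C2_compact_supportE[OF assms] have [measurable]: "deriv f \<in> borel_measurable borel"
    "deriv (deriv f) \<in> borel_measurable borel"
    by (metis borel_measurable_continuous_onI)+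
  show ?thesis unfolding generator_def by measurable
qed

lemma generator_bounded:
  assumes "C2_compact_support f"
  obtains C where "\<And>x. \<bar>generator a b f x\<bar> \<le> C"
proof -
  obtain R where R: "\<And>x. R < \<bar>x\<bar> \<Longrightarrow> f x = 0 \<and> deriv f x = 0 \<and> deriv (deriv f) x = 0"
    "continuous_on UNIV (deriv f)" "continuous_on UNIV (deriv (deriv f))"
    using C2_compact_supportE[OF assms] by metis
  obtain A where A: "0 \<le> A" "\<And>x. -R \<le> x \<Longrightarrow> x \<le> R \<Longrightarrow> \<bar>a x\<bar> \<le> A" using continuous_bounded_Icc[OF a_cont, of "-R" R] by blast
  obtain B where B: "0 \<le> B" "\<And>x. -R \<le> x \<Longrightarrow> x \<le> R \<Longrightarrow> \<bar>b x\<bar> \<le> B" using b_bounded_Icc[of "-R" R] by blast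
  obtain D where D: "0 \<le> D" "\<And>x. -R \<le> x \<Longrightarrow> x \<le> R \<Longrightarrow> \<bar>deriv f x\<bar> \<le> D" using continuous_bounded_Icc[OF R(2), of "-R" R] by blast
  obtain E where E: "0 \<le> E" "\<And>x. -R \<le> x \<Longrightarrow> x \<le> R \<Longrightarrow> \<bar>deriv (deriv f) x\<bar> \<le> E" using continuous_bounded_Icc[OF R(3), of "-R" R] by blast
  show ?thesis
  proof (rule that)
    fix x
    show "\<bar>generator a b f x\<bar> \<le> 1/2 * A * E + B * D"
    proof (cases "R < \<bar>x\<bar>")
      case True
      then show ?thesis using R(1) A(1) B(1) D(1) E(1) by (simp add: generator_def)
    next
      case False
      then have x: "-R \<le> x" "x \<le> R" by auto
      have "\<bar>generator a b f x\<bar> \<le> 1/2 * \<bar>a x\<bar> * \<bar>deriv (deriv f) x\<bar> + \<bar>b x\<bar> * \<bar>deriv f x\<bar>"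
        unfolding generator_def using abs_triangle_ineq[of "1/2 * a x * deriv (deriv f) x" "b x * deriv f x"]
        by (simp add: abs_mult)
      also have "\<dots> \<le> 1/2 * A * E + B * D"
        using A(2)[OF x] B(2)[OF x] D(2)[OF x] E(2)[OF x] A(1) B(1)
        by (intro add_mono mult_mono) auto
      finally show ?thesis .
    qed
  qed
qed

end

lemma natural_filtration_measurable:
  assumes "0 \<le> s" "s \<le> t"
  shows "X s \<in> borel_measurable (natural_filtration M X t)"
proof (rule measurableI)
  fix A :: "real set" assume "A \<in> sets borel"
  then have "X s -` A \<inter> space M \<in> {X s -` B \<inter> space M | s B. 0 \<le> s \<and> s \<le> t \<and> B \<in> sets borel}"
    using assms by blast
  then show "X s -` A \<inter> space (natural_filtration M X t) \<in> sets (natural_filtration M X t)"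
    unfolding natural_filtration_def by (subst sets_measure_of) (auto simp: space_measure_of_conv)
qed auto

lemma natural_filtration_mono:
  "r \<le> t \<Longrightarrow> sets (natural_filtration M X r) \<subseteq> sets (natural_filtration M X t)"
  unfolding natural_filtration_def
  by (subst (1 2) sets_measure_of) (auto intro!: sigma_sets_mono' order_trans)

lemma space_natural_filtration[simp]: "space (natural_filtration M X t) = space M"
  unfolding natural_filtration_def by (simp add: space_measure_of_conv)

context diffusion_coefficients
begin

text \<open>\<open>Oc S\<close> is the expected time that the process spends in \<open>S\<close> before \<open>\<sigma> = min t \<tau>\<^sub>y\<close>.\<close>

lemma occupation_measure:
  assumes sol: "solves_martingale_problem a b x M X" and xy: "x < y" and t: "0 < t"
  defines "\<sigma> \<equiv> \<lambda>\<omega>. enn2real (min (ennreal t) (hitting_time X y \<omega>))"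
  obtains Oc :: "real measure" where
    "sets Oc = sets borel"
    "emeasure Oc (space Oc) = (\<integral>\<^sup>+ \<omega>. min (ennreal t) (hitting_time X y \<omega>) \<partial>M)"
    "AE z in Oc. z \<le> y"
    "(\<lambda>\<omega>. X (\<sigma> \<omega>) \<omega>) \<in> borel_measurable M"
    "AE \<omega> in M. X (\<sigma> \<omega>) \<omega> \<le> y"
    "\<And>f. C2_compact_support f \<Longrightarrow>
      (\<integral>\<omega>. f (X (\<sigma> \<omega>) \<omega>) \<partial>M) = f x + (\<integral>z. generator a b f z \<partial>Oc)"
proof -
  interpret prob_space M using sol by (simp add: solves_martingale_problem_def)
  have Xm: "X s \<in> borel_measurable M" if "0 \<le> s" for s
    using sol that by (simp add: solves_martingale_problem_def)
  have cont: "continuous_on {0..} (\<lambda>t. X t \<omega>)" if "\<omega> \<in> space M" for \<omega>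
    using sol that by (simp add: solves_martingale_problem_def)
  have X0: "AE \<omega> in M. X 0 \<omega> = x"
    using sol by (simp add: solves_martingale_problem_def)
  have mart: "martingale M (natural_filtration M X)
      (\<lambda>t \<omega>. f (X t \<omega>) - (LBINT s:{0..t}. generator a b f (X s \<omega>)))" if "C2_compact_support f" for f
    using sol that by (simp add: solves_martingale_problem_def)
  \<comment> \<open>The cap \<open>t\<close> keeps the value finite, so \<open>enn2real\<close>
    loses nothing.\<close>
  have \<sigma>_eq: "ennreal (\<sigma> \<omega>) = min (ennreal t) (hitting_time X y \<omega>)" for \<omega>
    unfolding \<sigma>_def by (intro ennreal_enn2real) (auto simp: min_less_iff_disj)
  have \<sigma>0: "0 \<le> \<sigma> \<omega>" for \<omega> by (simp add: \<sigma>_def)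
  have \<sigma>_le: "\<sigma> \<omega> \<le> r \<longleftrightarrow> t \<le> r \<or> hitting_time X y \<omega> \<le> ennreal r" if "0 \<le> r" for \<omega> r
  proof -
    have "\<sigma> \<omega> \<le> r \<longleftrightarrow> ennreal (\<sigma> \<omega>) \<le> ennreal r" using that by simp
    also have "\<dots> \<longleftrightarrow> t \<le> r \<or> hitting_time X y \<omega> \<le> ennreal r"
      unfolding \<sigma>_eq min_le_iff_disj using that by simp
    finally show ?thesis .
  qed
  have \<sigma>t: "\<sigma> \<omega> \<le> t" for \<omega> using \<sigma>_le[of t] t by simp
  have [measurable]: "(\<lambda>\<omega>. hitting_time X y \<omega>) \<in> borel_measurable M"
    using hitting_time_measurable[of X M "\<lambda>_. y", OF Xm _ cont] by simp
  have [measurable]: "\<sigma> \<in> borel_measurable M" unfolding \<sigma>_def by measurable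
  \<comment> \<open>By the intermediate value theorem, a path from \<open>x < y\<close> that is
    above \<open>y\<close> at time \<open>s\<close> has met \<open>y\<close> strictly before
    \<open>s\<close>, so \<open>s\<close> would lie beyond \<open>\<sigma>\<close>.\<close>
  have below: "X s \<omega> \<le> y" if w: "\<omega> \<in> space M" "X 0 \<omega> = x" and s: "0 \<le> s" "s \<le> \<sigma> \<omega>" for s \<omega>
  proof (rule ccontr)
    assume "\<not> X s \<omega> \<le> y"
    moreover have "continuous_on {0..s} (\<lambda>t. X t \<omega>)" using continuous_on_subset[OF cont[OF w(1)]] by auto
    ultimately obtain r where r: "0 \<le> r" "r \<le> s" "X r \<omega> = y"
      using IVT'[of "\<lambda>t. X t \<omega>" 0 y s] w xy s by auto
    then have "r < s" using \<open>\<not> X s \<omega> \<le> y\<close> by (cases "r = s") auto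
    have "hitting_time X y \<omega> \<le> ennreal r" unfolding hitting_time_def using r by (intro INF_lower) auto
    then have "\<sigma> \<omega> \<le> r" using \<sigma>_le r by blast
    then show False using s \<open>r < s\<close> by simp
  qed
  define path where "path = (\<lambda>(\<omega>, s). X (max 0 s) \<omega>)"
  have pm_borel: "path \<in> borel_measurable (M \<Otimes>\<^sub>M borel)"
    unfolding path_def by (rule joint_measurable_paths[OF Xm cont])
  have sets_eq: "sets (M \<Otimes>\<^sub>M lborel) = sets (M \<Otimes>\<^sub>M (borel :: real measure))"
    by (intro sets_pair_measure_cong) auto
  have pm[measurable]: "path \<in> borel_measurable (M \<Otimes>\<^sub>M lborel)"
    using pm_borel measurable_cong_sets[OF sets_eq refl] by blast
  \<comment> \<open>\<open>ind\<close> marks the region between time 0 and \<open>\<sigma>\<close>.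
    The product measure restricted to this region is carried by \<open>path\<close> to the
    occupation measure \<open>Oc\<close>.\<close>
  define ind where "ind = (\<lambda>(\<omega>, s). indicator {0..\<sigma> \<omega>} s :: real)"
  have ind_eq: "ind = (\<lambda>z. if 0 \<le> snd z \<and> snd z \<le> \<sigma> (fst z) then 1 else 0)"
    by (auto simp: ind_def fun_eq_iff indicator_def)
  have [measurable]: "ind \<in> borel_measurable (M \<Otimes>\<^sub>M lborel)" unfolding ind_eq by measurable
  define D where "D = density (M \<Otimes>\<^sub>M lborel) (\<lambda>z. ennreal (ind z))"
  define Oc where "Oc = distr D borel path"
  interpret PL: pair_sigma_finite M lborel by unfold_locales
  have pmD[measurable]: "path \<in> borel_measurable D" unfolding D_def by simp
  have sets_Oc: "sets Oc = sets borel" by (simp add: Oc_def)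
  have ind_slice: "(\<integral>\<^sup>+ s. ennreal (ind (\<omega>, s)) \<partial>lborel) = ennreal (\<sigma> \<omega>)" for \<omega>
  proof -
    have "(\<integral>\<^sup>+ s. ennreal (ind (\<omega>, s)) \<partial>lborel) = (\<integral>\<^sup>+ s. indicator {0..\<sigma> \<omega>} s \<partial>lborel)"
      by (intro nn_integral_cong) (auto simp: ind_def indicator_def)
    also have "\<dots> = ennreal (\<sigma> \<omega>)" using \<sigma>0 by simp
    finally show ?thesis .
  qed
  have ind_total: "(\<integral>\<^sup>+ z. ennreal (ind z) \<partial>(M \<Otimes>\<^sub>M lborel)) = (\<integral>\<^sup>+ \<omega>. ennreal (\<sigma> \<omega>) \<partial>M)"
    by (subst lborel.nn_integral_fst[symmetric]) (auto simp: ind_slice)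
  have mass: "emeasure Oc (space Oc) = (\<integral>\<^sup>+ \<omega>. min (ennreal t) (hitting_time X y \<omega>) \<partial>M)"
  proof -
    have "emeasure Oc (space Oc) = emeasure D (space D)"
      unfolding Oc_def by (simp add: emeasure_distr[OF pmD])
    also have "\<dots> = (\<integral>\<^sup>+ z. ennreal (ind z) \<partial>(M \<Otimes>\<^sub>M lborel))"
      unfolding D_def space_density
      by (subst emeasure_density[OF _ sets.top]) (auto intro!: nn_integral_cong)
    finally show ?thesis unfolding ind_total \<sigma>_eq .
  qed
  have mass_finite: "(\<integral>\<^sup>+ \<omega>. ennreal (\<sigma> \<omega>) \<partial>M) < \<infinity>"
  proof -
    have "(\<integral>\<^sup>+ \<omega>. ennreal (\<sigma> \<omega>) \<partial>M) \<le> (\<integral>\<^sup>+ \<omega>. ennreal t \<partial>M)"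
      by (intro nn_integral_mono ennreal_leI \<sigma>t)
    also have "\<dots> < \<infinity>" by (simp add: emeasure_space_1 ennreal_mult_less_top)
    finally show ?thesis .
  qed
  have supp: "AE z in Oc. z \<le> y"
  proof -
    have "AE z in M \<Otimes>\<^sub>M lborel. 0 < ennreal (ind z) \<longrightarrow> path z \<le> y"
    proof (rule PL.AE_pair_measure)
      show "{z \<in> space (M \<Otimes>\<^sub>M lborel). 0 < ennreal (ind z) \<longrightarrow> path z \<le> y} \<in> sets (M \<Otimes>\<^sub>M lborel)"
        by measurable
      show "AE \<omega> in M. AE s in lborel. 0 < ennreal (ind (\<omega>, s)) \<longrightarrow> path (\<omega>, s) \<le> y"
        using X0 AE_space
      proof eventually_elim
        case (elim \<omega>)
        then show ?case using below by (intro AE_I2) (auto simp: ind_def path_def indicator_def)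
      qed
    qed
    then have "AE z in D. path z \<le> y" unfolding D_def by (subst AE_density) auto
    then show ?thesis unfolding Oc_def by (subst AE_distr_iff) auto
  qed
  have X\<sigma>[measurable]: "(\<lambda>\<omega>. X (\<sigma> \<omega>) \<omega>) \<in> borel_measurable M"
  proof -
    have "(\<lambda>\<omega>. (\<omega>, \<sigma> \<omega>)) \<in> M \<rightarrow>\<^sub>M M \<Otimes>\<^sub>M borel" by measurable
    from measurable_compose[OF this pm_borel] show ?thesis by (simp add: path_def max_absorb2 \<sigma>0)
  qed
  have X\<sigma>_le: "AE \<omega> in M. X (\<sigma> \<omega>) \<omega> \<le> y"
    using X0 AE_space by eventually_elim (use below \<sigma>0 in auto)
  have dynkin: "(\<integral>\<omega>. f (X (\<sigma> \<omega>) \<omega>) \<partial>M) = f x + (\<integral>z. generator a b f z \<partial>Oc)"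
    if f: "C2_compact_support f" for f
  proof -
    let ?g = "generator a b f"
    obtain R where R: "\<And>x. R < \<bar>x\<bar> \<Longrightarrow> f x = 0" "continuous_on UNIV f"
      using C2_compact_supportE[OF f] by metis
    have [measurable]: "f \<in> borel_measurable borel" by (rule borel_measurable_continuous_onI[OF R(2)])
    obtain Cf where Cf0: "0 \<le> Cf" "\<And>x. -R \<le> x \<Longrightarrow> x \<le> R \<Longrightarrow> \<bar>f x\<bar> \<le> Cf" using continuous_bounded_Icc[OF R(2), of "-R" R] by blast
    then have Cf: "\<bar>f z\<bar> \<le> Cf" for z using R(1)[of z] by (cases "R < \<bar>z\<bar>") auto
    have [measurable]: "?g \<in> borel_measurable borel" by (rule generator_measurable[OF f])
    obtain Cg where Cg: "\<And>x. \<bar>?g x\<bar> \<le> Cg" using generator_bounded[OF f] by blast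
    have Cg0: "0 \<le> Cg" using Cg[of 0] by simp
    let ?I = "\<lambda>r \<omega>. LBINT s:{0..r}. ?g (X s \<omega>)"
    let ?Y = "\<lambda>r \<omega>. f (X r \<omega>) - ?I r \<omega>"
    have gX[measurable]: "(\<lambda>s. ?g (X (max 0 s) \<omega>)) \<in> borel_measurable borel" if "\<omega> \<in> space M" for \<omega>
    proof -
      have "continuous_on UNIV (\<lambda>s. X (max 0 s) \<omega>)"
        by (intro continuous_on_compose2[OF cont[OF that]] continuous_intros) auto
      then have "(\<lambda>s. X (max 0 s) \<omega>) \<in> borel_measurable borel" by (rule borel_measurable_continuous_onI)
      then show ?thesis by measurable
    qed
    have I_eq: "?I r \<omega> = (LBINT s:{0..r}. ?g (X (max 0 s) \<omega>))" for r \<omega>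
      unfolding set_lebesgue_integral_def
      by (intro Bochner_Integration.integral_cong) (auto simp: indicator_def)
    have sint: "set_integrable lborel {0..r} (\<lambda>s. ?g (X (max 0 s) \<omega>))" if "\<omega> \<in> space M" for r \<omega>
      unfolding set_integrable_def
    proof (rule integrableI_bounded_set_indicator[where B = Cg])
      show "(\<lambda>s. ?g (X (max 0 s) \<omega>)) \<in> borel_measurable lborel" using gX[OF that] by simp
      show "emeasure lborel {0..r} < \<infinity>" by (cases "0 \<le> r") auto
    qed (use Cg in auto)
    have contI: "continuous_on {0..t} (\<lambda>r. ?I r \<omega>)" if "\<omega> \<in> space M" for \<omega>
    proof -
      have "continuous_on {0..t} (\<lambda>r. integral {0..r} (\<lambda>s. ?g (X (max 0 s) \<omega>)))"
        by (intro indefinite_integral_continuous_1 set_borel_integral_eq_integral(1) sint that)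
      then show ?thesis unfolding I_eq using set_borel_integral_eq_integral(2)[OF sint[OF that]] by simp
    qed
    have boundI: "\<bar>?I r \<omega>\<bar> \<le> t * Cg" if "\<omega> \<in> space M" "0 \<le> r" "r \<le> t" for r \<omega>
    proof -
      have "\<bar>?I r \<omega>\<bar> \<le> (LBINT s:{0..r}. \<bar>?g (X (max 0 s) \<omega>)\<bar>)"
        unfolding I_eq using set_integral_norm_bound[OF sint[OF that(1), of r]] by simp
      also have "\<dots> \<le> (LBINT s:{0..r}. Cg)"
        by (intro set_integral_mono set_integrable_abs sint that
            borel_integrable_atLeastAtMost' continuous_on_const) (use Cg in auto)
      also have "\<dots> = r * Cg" using that by (simp add: set_lebesgue_integral_def)
      also have "\<dots> \<le> t * Cg" using that Cg0 by (intro mult_right_mono) auto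
      finally show ?thesis .
    qed
    have stop: "(\<integral>\<omega>. ?Y (\<sigma> \<omega>) \<omega> \<partial>M) = (\<integral>\<omega>. ?Y 0 \<omega> \<partial>M)" "(\<lambda>\<omega>. ?Y (\<sigma> \<omega>) \<omega>) \<in> borel_measurable M"
    proof (atomize (full), intro conjI optional_stopping[OF prob_space_axioms mart[OF f] natural_filtration_mono t])
      fix r :: real assume r: "0 \<le> r" "r < t"
      \<comment> \<open>Below the cap, \<open>\<sigma> \<le> r\<close> means exactly that the path
        has visited \<open>y\<close> by time \<open>r\<close>, which is decided by the path up to
        \<open>r\<close>.\<close>
      have "{\<omega> \<in> space M. \<sigma> \<omega> \<le> r} = {\<omega> \<in> space (natural_filtration M X r). \<exists>s\<in>{0..r}. X s \<omega> = y}"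
        using r hitting_time_le_iff[where X = X, OF cont, where r = r] by (auto simp: \<sigma>_le)
      also have "\<dots> \<in> sets (natural_filtration M X r)"
        by (rule hit_event_measurable[where Y = "\<lambda>_. y"]) (use cont r natural_filtration_measurable in auto)
      finally show "{\<omega> \<in> space M. \<sigma> \<omega> \<le> r} \<in> sets (natural_filtration M X r)" .
      then show "{\<omega> \<in> space M. \<sigma> \<omega> \<le> r} \<in> sets (natural_filtration M X r)" .
    next
      fix \<omega> s assume "\<omega> \<in> space M" "0 \<le> s" "s \<le> t"
      then have "\<bar>?Y s \<omega>\<bar> \<le> Cf + t * Cg"
        using Cf[of "X s \<omega>"] boundI[of \<omega> s] by linarith
      then show "\<bar>?Y s \<omega>\<bar> \<le> Cf + t * Cg" "\<bar>?Y s \<omega>\<bar> \<le> Cf + t * Cg" by auto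
    next
      fix \<omega> assume w: "\<omega> \<in> space M"
      have "continuous_on {0..t} (\<lambda>s. f (X s \<omega>))"
        by (rule continuous_on_compose2[OF R(2) continuous_on_subset[OF cont[OF w]]]) auto
      then have "continuous_on {0..t} (\<lambda>s. ?Y s \<omega>)" by (intro continuous_on_diff contI w)
      then show "continuous_on {0..t} (\<lambda>s. ?Y s \<omega>)" "continuous_on {0..t} (\<lambda>s. ?Y s \<omega>)" by auto
    qed (use \<sigma>0 \<sigma>t in auto)
    have Y0: "(\<integral>\<omega>. ?Y 0 \<omega> \<partial>M) = f x"
    proof -
      have "(\<integral>\<omega>. ?Y 0 \<omega> \<partial>M) = (\<integral>\<omega>. f x \<partial>M)"
      proof (rule integral_cong_AE)
        show "?Y 0 \<in> borel_measurable M"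
          using mart[OF f] unfolding martingale_def by auto
        have I0: "?I 0 \<omega> = 0" if "\<omega> \<in> space M" for \<omega>
          unfolding I_eq using set_borel_integral_eq_integral(2)[OF sint[OF that, of 0]] by simp
        show "AE \<omega> in M. ?Y 0 \<omega> = f x" using X0 AE_space by eventually_elim (simp only: I0 diff_zero)
      qed simp
      then show ?thesis by (simp add: prob_space)
    qed
    have fX_int: "integrable M (\<lambda>\<omega>. f (X (\<sigma> \<omega>) \<omega>))"
      by (rule integrable_const_bound[where B = Cf]) (use Cf in auto)
    have I_int: "integrable M (\<lambda>\<omega>. ?I (\<sigma> \<omega>) \<omega>)"
    proof (rule integrable_const_bound[where B = "t * Cg"])
      show "AE \<omega> in M. norm (?I (\<sigma> \<omega>) \<omega>) \<le> t * Cg" using boundI \<sigma>0 \<sigma>t by auto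
      have "(\<lambda>\<omega>. f (X (\<sigma> \<omega>) \<omega>) - ?Y (\<sigma> \<omega>) \<omega>) \<in> borel_measurable M"
        by (intro borel_measurable_diff stop(2)) measurable
      then show "(\<lambda>\<omega>. ?I (\<sigma> \<omega>) \<omega>) \<in> borel_measurable M" by simp
    qed
    have "(\<integral>\<omega>. f (X (\<sigma> \<omega>) \<omega>) \<partial>M) = f x + (\<integral>\<omega>. ?I (\<sigma> \<omega>) \<omega> \<partial>M)"
      using stop(1) Y0 Bochner_Integration.integral_diff[OF fX_int I_int] by simp
    \<comment> \<open>Fubini turns the mean of the time integral into one integral over the region
      marked by \<open>ind\<close>; the change of variables along \<open>path\<close> makes it an
      integral against \<open>Oc\<close>.\<close>
    also have "(\<integral>\<omega>. ?I (\<sigma> \<omega>) \<omega> \<partial>M) = (\<integral>\<omega>. (\<integral>s. ind (\<omega>, s) * ?g (path (\<omega>, s)) \<partial>lborel) \<partial>M)"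
      unfolding I_eq by (simp add: set_lebesgue_integral_def ind_def path_def)
    also have "\<dots> = (\<integral>z. ind z * ?g (path z) \<partial>(M \<Otimes>\<^sub>M lborel))"
    proof (rule PL.integral_fst')
      show "integrable (M \<Otimes>\<^sub>M lborel) (\<lambda>z. ind z * ?g (path z))"
      proof (rule Bochner_Integration.integrable_bound[where f = "\<lambda>z. Cg * ind z"])
        have "integrable (M \<Otimes>\<^sub>M lborel) ind"
          unfolding integrable_iff_bounded using ind_total mass_finite by (auto simp: ind_eq cong: if_cong)
        then show "integrable (M \<Otimes>\<^sub>M lborel) (\<lambda>z. Cg * ind z)" by simp
        show "AE z in M \<Otimes>\<^sub>M lborel. norm (ind z * ?g (path z)) \<le> norm (Cg * ind z)"
          using Cg Cg0 by (intro AE_I2) (auto simp: ind_eq)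
      qed measurable
    qed
    also have "\<dots> = (\<integral>z. ?g (path z) \<partial>D)"
      unfolding D_def by (subst integral_density) (auto simp: ind_eq)
    also have "\<dots> = (\<integral>z. ?g z \<partial>Oc)" unfolding Oc_def by (subst integral_distr) auto
    finally show ?thesis .
  qed
  show ?thesis by (rule that[OF sets_Oc mass supp X\<sigma> X\<sigma>_le dynkin])
qed

end

section \<open>Cutoff functions and primitives\<close>

text \<open>The cube of the positive part is C2, which makes it the building block of the cutoff
  below.\<close>

lemma DERIV_pos_part_power:
  assumes n: "2 \<le> n"
  shows "((\<lambda>u::real. max 0 u ^ n) has_real_derivative real n * max 0 u ^ (n - 1)) (at u)"
proof -
  consider "u < 0" | "u = 0" | "u > 0" by linarith
  then show ?thesis
  proof cases
    case 1
    have "((\<lambda>u::real. 0) has_real_derivative real n * max 0 u ^ (n - 1)) (at u)"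
      using 1 n by (auto simp: max_def power_0_left)
    then show ?thesis
      by (rule has_field_derivative_transform_within_open[of _ _ _ "{..<0}"]) (use 1 n in \<open>auto simp: max_def power_0_left\<close>)
  next
    case 2
    have "((\<lambda>h::real. (max 0 (0 + h) ^ n - max 0 0 ^ n) / h) \<longlongrightarrow> 0) (at 0)"
    proof (rule Lim_null_comparison)
      show "\<forall>\<^sub>F h in at (0::real). norm ((max 0 (0 + h) ^ n - max 0 0 ^ n) / h) \<le> \<bar>h\<bar> ^ (n - 1)"
      proof (rule always_eventually, rule allI)
        fix h :: real
        show "norm ((max 0 (0 + h) ^ n - max 0 0 ^ n) / h) \<le> \<bar>h\<bar> ^ (n - 1)"
          using n by (cases n) (auto simp: max_def abs_mult power_abs)
      qed
      have "((\<lambda>h::real. \<bar>h\<bar> ^ (n - 1)) \<longlongrightarrow> \<bar>0\<bar> ^ (n - 1)) (at 0)" by (intro tendsto_intros)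
      then show "((\<lambda>h::real. \<bar>h\<bar> ^ (n - 1)) \<longlongrightarrow> 0) (at 0)" using n by (simp add: power_0_left)
    qed
    then show ?thesis using 2 n by (simp add: DERIV_def power_0_left)
  next
    case 3
    have "((\<lambda>u::real. u ^ n) has_real_derivative real n * max 0 u ^ (n - 1)) (at u)"
      using 3 n by (auto intro!: derivative_eq_intros simp: max_def)
    then show ?thesis
      by (rule has_field_derivative_transform_within_open[of _ _ _ "{0<..}"]) (use 3 n in \<open>auto simp: max_def\<close>)
  qed
qed

text \<open>The polynomial-like function \<open>v\<close> is 1 on \<open>[-R, R]\<close> and at most
  0 beyond distance \<open>R + 1\<close>, since there one of the subtracted cubes is at least 1. A
  second cube of the positive part removes the negative values and stays C2.\<close>

lemma C2_cutoff:
  fixes R :: real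
  assumes "0 \<le> R"
  obtains \<kappa> \<kappa>1 \<kappa>2 :: "real \<Rightarrow> real" where
    "\<And>z. (\<kappa> has_real_derivative \<kappa>1 z) (at z)" "\<And>z. (\<kappa>1 has_real_derivative \<kappa>2 z) (at z)"
    "continuous_on UNIV \<kappa>2"
    "\<And>z. \<bar>z\<bar> \<le> R \<Longrightarrow> \<kappa> z = 1 \<and> \<kappa>1 z = 0 \<and> \<kappa>2 z = 0"
    "\<And>z. R + 1 < \<bar>z\<bar> \<Longrightarrow> \<kappa> z = 0 \<and> \<kappa>1 z = 0 \<and> \<kappa>2 z = 0" "\<And>z. 0 \<le> \<kappa> z"
proof -
  define c where "c k u = max 0 (u::real) ^ k" for k u
  have c3: "(c 3 has_real_derivative 3 * c 2 u) (at u)" for u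
    unfolding c_def[abs_def] using DERIV_pos_part_power[of 3 u] by simp
  have c2: "(c 2 has_real_derivative 2 * c 1 u) (at u)" for u
    unfolding c_def[abs_def] using DERIV_pos_part_power[of 2 u] by simp
  have c1: "continuous_on S (c 1)" for S unfolding c_def[abs_def] by (intro continuous_intros)
  have cc: "continuous_on S (c k)" for k S unfolding c_def[abs_def] by (intro continuous_intros)
  define v where "v z = 1 - c 3 (z - R) - c 3 (- z - R)" for z
  define v1 where "v1 z = 3 * c 2 (- z - R) - 3 * c 2 (z - R)" for z
  define v2 where "v2 z = - 6 * c 1 (- z - R) - 6 * c 1 (z - R)" for z
  note [derivative_intros] = DERIV_chain2[OF c3] DERIV_chain2[OF c2]
  have dv: "(v has_real_derivative v1 z) (at z)" for z
    unfolding v_def[abs_def] v1_def by (auto intro!: derivative_eq_intros)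
  have dv1: "(v1 has_real_derivative v2 z) (at z)" for z
    unfolding v1_def[abs_def] v2_def by (auto intro!: derivative_eq_intros)
  note [derivative_intros] = DERIV_chain2[OF dv] DERIV_chain2[OF dv1]
  show ?thesis
  proof (rule that[of "\<lambda>z. c 3 (v z)" "\<lambda>z. 3 * c 2 (v z) * v1 z"
      "\<lambda>z. 6 * c 1 (v z) * v1 z * v1 z + 3 * c 2 (v z) * v2 z"])
    show "((\<lambda>z. c 3 (v z)) has_real_derivative 3 * c 2 (v z) * v1 z) (at z)" for z
      by (auto intro!: derivative_eq_intros dv)
    show "((\<lambda>z. 3 * c 2 (v z) * v1 z) has_real_derivative
      6 * c 1 (v z) * v1 z * v1 z + 3 * c 2 (v z) * v2 z) (at z)" for z
      by (auto intro!: derivative_eq_intros dv dv1)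
    have "continuous_on UNIV v" "continuous_on UNIV v1"
      using DERIV_isCont[OF dv] DERIV_isCont[OF dv1] by (auto intro: continuous_at_imp_continuous_on)
    moreover have "continuous_on UNIV v2"
      unfolding v2_def[abs_def] by (intro continuous_intros continuous_on_compose2[OF c1[of UNIV]]) auto
    ultimately show "continuous_on UNIV (\<lambda>z. 6 * c 1 (v z) * v1 z * v1 z + 3 * c 2 (v z) * v2 z)"
      by (auto intro!: continuous_intros continuous_on_compose2[OF cc[of UNIV]])
    fix z :: real
    {
      assume "\<bar>z\<bar> \<le> R"
      then have "max 0 (z - R) = 0" "max 0 (- z - R) = 0" by auto
      then show "c 3 (v z) = 1 \<and> 3 * c 2 (v z) * v1 z = 0 \<and>
        6 * c 1 (v z) * v1 z * v1 z + 3 * c 2 (v z) * v2 z = 0"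
        by (simp add: c_def v_def v1_def v2_def)
    }
    {
      assume z: "R + 1 < \<bar>z\<bar>"
      then have "1 \<le> c 3 (z - R) + c 3 (- z - R)"
      proof (cases "z > 0")
        case True
        then have "max 0 (z - R) = z - R" "max 0 (- z - R) = 0" using z assms by auto
          then show ?thesis using z True one_le_power[of "z - R" 3] by (simp add: c_def)
      next
        case False
        then have "max 0 (- z - R) = - z - R" "max 0 (z - R) = 0" using z assms by auto
          then show ?thesis using z False one_le_power[of "- z - R" 3] by (simp add: c_def)
      qed
      then have "max 0 (v z) = 0" by (simp add: v_def)
      then show "c 3 (v z) = 0 \<and> 3 * c 2 (v z) * v1 z = 0 \<and>
        6 * c 1 (v z) * v1 z * v1 z + 3 * c 2 (v z) * v2 z = 0" by (simp add: c_def)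
    }
    show "0 \<le> c 3 (v z)" by (simp add: c_def)
  qed
qed

lemma C2_compact_supportI:
  fixes f f1 f2 :: "real \<Rightarrow> real"
  assumes f: "\<And>z. (f has_real_derivative f1 z) (at z)" "\<And>z. (f1 has_real_derivative f2 z) (at z)"
    and c: "continuous_on UNIV f2" and 0: "\<And>z. R < \<bar>z\<bar> \<Longrightarrow> f z = 0"
  shows "C2_compact_support f" and "generator a b f z = 1 / 2 * a z * f2 z + b z * f1 z"
proof -
  have d1: "deriv f = f1" using f(1) by (auto intro!: DERIV_imp_deriv)
  have d2: "deriv f1 = f2" using f(2) by (auto intro!: DERIV_imp_deriv)
  have "{z. f z \<noteq> 0} \<subseteq> {-R..R}" using 0 by (force simp: not_less[symmetric])
  then have "bounded (closure {z. f z \<noteq> 0})"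
    by (intro bounded_closure bounded_subset[OF bounded_closed_interval])
  then show "C2_compact_support f" using f c
    unfolding C2_compact_support_def d1 d2 by (auto simp: compact_eq_bounded_closed real_differentiable_def)
  show "generator a b f z = 1 / 2 * a z * f2 z + b z * f1 z" by (simp add: generator_def d1 d2)
qed

section \<open>Oriented primitives: differentiation, bounds and limits\<close>

definition primitive :: "real \<Rightarrow> (real \<Rightarrow> real) \<Rightarrow> real \<Rightarrow> real" where
  "primitive c g u = (LBINT t=ereal c..ereal u. g t)"

lemma primitive_self[simp]: "primitive c g c = 0"
  by (simp add: primitive_def)

lemma DERIV_primitive:
  assumes "continuous_on UNIV g"
  shows "(primitive c g has_real_derivative g z) (at z)"
proof -
  \<comment> \<open>The margin of 1 puts \<open>z\<close> in the interior, so that the derivative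
    within the interval is a derivative on the line.\<close>
  let ?l = "min c z - 1" and ?r = "max c z + 1"
  have "((\<lambda>u. LBINT t=ereal c..ereal u. g t) has_vector_derivative g z) (at z within {?l..?r})"
    by (rule interval_integral_FTC2) (auto intro: continuous_on_subset[OF assms])
  moreover have "z \<in> interior {?l..?r}" by (simp add: interior_atLeastAtMost_real min_def max_def)
  ultimately have "((\<lambda>u. LBINT t=ereal c..ereal u. g t) has_vector_derivative g z) (at z)"
    by (simp only: at_within_interior)
  then show ?thesis
    unfolding primitive_def[abs_def] has_real_derivative_iff_has_vector_derivative .
qed

lemma primitive_unique:
  assumes "continuous_on UNIV g" "\<And>z. (G has_real_derivative g z) (at z)"
  shows "primitive c g u = G u - G c"
proof -
  have "\<exists>k. \<forall>z. primitive c g z - G z = k"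
    using has_field_derivative_zero_constant[of UNIV "\<lambda>z. primitive c g z - G z"]
      DERIV_diff[OF DERIV_primitive[OF assms(1)] assms(2)] by auto
  then obtain k where "\<And>z. primitive c g z - G z = k" by blast
  from this[of u] this[of c] show ?thesis by simp
qed

lemma set_integrable_bounded_Icc:
  fixes g :: "real \<Rightarrow> real"
  assumes "g \<in> borel_measurable borel" "\<And>t. c \<le> t \<Longrightarrow> t \<le> d \<Longrightarrow> \<bar>g t\<bar> \<le> C"
  shows "set_integrable lborel {c..d} g"
  unfolding set_integrable_def
proof (rule Bochner_Integration.integrable_bound[where f = "\<lambda>t. indicator {c..d} t * C"])
  show "integrable lborel (\<lambda>t. indicator {c..d} t * C)"
    using borel_integrable_atLeastAtMost'[OF continuous_on_const, of c d C] by (simp add: set_integrable_def)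
  show "AE t in lborel. norm (indicator {c..d} t *\<^sub>R g t) \<le> norm (indicator {c..d} t * C)"
    using assms(2) by (intro AE_I2) (force simp: indicator_def)
qed (use assms(1) in simp)

lemma primitive_eq_set_integral:
  assumes "c \<le> u"
  shows "primitive c g u = (LBINT t:{c..u}. g t)"
  unfolding primitive_def using assms by (simp add: interval_integral_Icc)

lemma primitive_diff:
  assumes g: "g \<in> borel_measurable borel" "\<And>t. l \<le> t \<Longrightarrow> t \<le> r \<Longrightarrow> \<bar>g t\<bar> \<le> C"
    and "l \<le> c" "c \<le> r" "l \<le> u" "u \<le> r" "l \<le> w" "w \<le> r"
  shows "primitive c g w - primitive c g u = primitive u g w"
proof -
  have "(LBINT t=ereal c..ereal u. g t) + (LBINT t=ereal u..ereal w. g t) = (LBINT t=ereal c..ereal w. g t)"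
  proof (rule interval_integral_sum)
    have "set_integrable lborel {min c (min u w)..max c (max u w)} g"
      using assms(3-) by (intro set_integrable_bounded_Icc[OF g(1), of _ _ C] g(2)) auto
    then show "interval_lebesgue_integrable lborel (min (ereal c) (min (ereal u) (ereal w)))
      (max (ereal c) (max (ereal u) (ereal w))) g"
      by (simp add: interval_lebesgue_integrable_def ereal_min[symmetric] ereal_max[symmetric] del: ereal_min ereal_max)
        (auto intro: set_integrable_subset)
  qed
  then show ?thesis by (simp add: primitive_def)
qed

lemma primitive_bound_right:
  assumes g: "g \<in> borel_measurable borel" "\<And>t. c \<le> t \<Longrightarrow> t \<le> u \<Longrightarrow> \<bar>g t\<bar> \<le> C" and "c \<le> u"
  shows "\<bar>primitive c g u\<bar> \<le> C * (u - c)"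
proof -
  have i: "set_integrable lborel {c..u} g" by (rule set_integrable_bounded_Icc[OF g])
  have "\<bar>primitive c g u\<bar> \<le> (LBINT t:{c..u}. \<bar>g t\<bar>)"
    unfolding primitive_eq_set_integral[OF \<open>c \<le> u\<close>] using set_integral_norm_bound[OF i] by simp
  also have "\<dots> \<le> (LBINT t:{c..u}. C)"
    by (intro set_integral_mono set_integrable_abs i borel_integrable_atLeastAtMost' continuous_on_const)
      (use g in auto)
  also have "\<dots> = C * (u - c)" using \<open>c \<le> u\<close> by (simp add: set_lebesgue_integral_def)
  finally show ?thesis .
qed

lemma primitive_swap: "primitive c g u = - primitive u g c"
  unfolding primitive_def by (rule interval_integral_endpoints_reverse)

lemma primitive_bound:
  assumes g: "g \<in> borel_measurable borel" "\<And>t. min c u \<le> t \<Longrightarrow> t \<le> max c u \<Longrightarrow> \<bar>g t\<bar> \<le> C"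
  shows "\<bar>primitive c g u\<bar> \<le> C * \<bar>u - c\<bar>"
proof (cases "c \<le> u")
  case True
  then show ?thesis using primitive_bound_right[OF g(1), of c u C] g(2) by auto
next
  case False
  then show ?thesis using primitive_bound_right[OF g(1), of u c C] g(2) primitive_swap[of c g u] by auto
qed

lemma primitive_tendsto:
  fixes g :: "nat \<Rightarrow> real \<Rightarrow> real"
  assumes g: "\<And>n. g n \<in> borel_measurable borel" "f \<in> borel_measurable borel"
    and bound: "\<And>n t. min c u \<le> t \<Longrightarrow> t \<le> max c u \<Longrightarrow> \<bar>g n t\<bar> \<le> C"
    and lim: "AE t in lborel. min c u \<le> t \<longrightarrow> t \<le> max c u \<longrightarrow> (\<lambda>n. g n t) \<longlonglongrightarrow> f t"
  shows "(\<lambda>n. primitive c (g n) u) \<longlonglongrightarrow> primitive c f u"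
proof -
  have *: "(\<lambda>n. LBINT t:{l..r}. g n t) \<longlonglongrightarrow> (LBINT t:{l..r}. f t)"
    if "l = min c u" "r = max c u" for l r
    unfolding set_lebesgue_integral_def
  proof (rule integral_dominated_convergence[where w = "\<lambda>t. indicator {l..r} t * C"])
    show "integrable lborel (\<lambda>t. indicator {l..r} t * C)"
      using borel_integrable_atLeastAtMost'[OF continuous_on_const, of l r C] by (simp add: set_integrable_def)
    show "AE t in lborel. (\<lambda>n. indicator {l..r} t *\<^sub>R g n t) \<longlonglongrightarrow> indicator {l..r} t *\<^sub>R f t"
      using lim by eventually_elim (auto simp: that indicator_def)
    show "AE t in lborel. norm (indicator {l..r} t *\<^sub>R g n t) \<le> indicator {l..r} t * C" for n
      using bound by (auto simp: that indicator_def)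
  qed (use g in auto)
  show ?thesis
  proof (cases "c \<le> u")
    case True
    then show ?thesis using *[of c u] by (simp add: primitive_eq_set_integral)
  next
    case False
    then have "u \<le> c" by simp
    then show ?thesis using tendsto_minus[OF *[of u c]]
      unfolding primitive_swap[of c _ u] by (simp add: primitive_eq_set_integral)
  qed
qed

section \<open>Continuity and positivity of the speed density and the scale derivative\<close>

context diffusion_coefficients
begin

abbreviation "B \<equiv> drift_exponent a b"
definition "speed z = exp (B z) / a z"
definition "scale_deriv z = exp (- B z)"

lemma ratio_bounded_Icc:
  obtains C where "0 \<le> C" "\<And>x. c \<le> x \<Longrightarrow> x \<le> d \<Longrightarrow> \<bar>b x / a x\<bar> \<le> C"
proof -
  obtain Cb where Cb: "0 \<le> Cb" "\<And>x. c \<le> x \<Longrightarrow> x \<le> d \<Longrightarrow> \<bar>b x\<bar> \<le> Cb" using b_bounded_Icc[of c d] by blast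
  have "continuous_on UNIV (\<lambda>x. 1 / a x)"
    by (intro continuous_intros a_cont) (use a_pos in \<open>auto simp: less_imp_neq[symmetric]\<close>)
  then obtain Ca where Ca: "0 \<le> Ca" "\<And>x. c \<le> x \<Longrightarrow> x \<le> d \<Longrightarrow> \<bar>1 / a x\<bar> \<le> Ca"
    using continuous_bounded_Icc[of "\<lambda>x. 1 / a x" c d] by blast
  show ?thesis
  proof (rule that[of "Cb * Ca"])
    fix x assume "c \<le> x" "x \<le> d"
    then have "\<bar>b x\<bar> * \<bar>1 / a x\<bar> \<le> Cb * Ca" using Cb Ca by (intro mult_mono) auto
    then show "\<bar>b x / a x\<bar> \<le> Cb * Ca" by (simp add: abs_mult[symmetric])
  qed (use Cb Ca in auto)
qed

lemma ratio_measurable: "(\<lambda>t. b t / a t) \<in> borel_measurable borel" by measurable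

lemma drift_exponent_eq: "B z = 2 * primitive 0 (\<lambda>t. b t / a t) z"
  by (simp add: drift_exponent_def primitive_def zero_ereal_def)

text \<open>\<open>b / a\<close> is merely measurable, so differentiability cannot be invoked; but
  it is bounded on compact intervals, and its primitive is therefore locally Lipschitz.\<close>

lemma continuous_drift_exponent: "continuous_on UNIV B"
proof -
  have "continuous_on {-K<..<K} B" for K
  proof -
    obtain C where C: "0 \<le> C" "\<And>x. -K \<le> x \<Longrightarrow> x \<le> K \<Longrightarrow> \<bar>b x / a x\<bar> \<le> C" using ratio_bounded_Icc[of "-K" K] by blast
    have "(2 * C)-lipschitz_on {-K<..<K} B"
    proof (rule lipschitz_onI)
      fix u w assume uw: "u \<in> {-K<..<K}" "w \<in> {-K<..<K}"
      have "B w - B u = 2 * (primitive 0 (\<lambda>t. b t / a t) w - primitive 0 (\<lambda>t. b t / a t) u)"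
        by (simp add: drift_exponent_eq)
      also have "\<dots> = 2 * primitive u (\<lambda>t. b t / a t) w"
        using uw by (subst primitive_diff[OF ratio_measurable C(2), of "-K" K]) auto
      finally have "\<bar>B w - B u\<bar> = 2 * \<bar>primitive u (\<lambda>t. b t / a t) w\<bar>" by (simp add: abs_mult)
      also have "\<dots> \<le> 2 * (C * \<bar>w - u\<bar>)"
        using uw by (intro mult_left_mono primitive_bound ratio_measurable C) (auto simp: min_def max_def split: if_splits)
      finally show "dist (B u) (B w) \<le> 2 * C * dist u w" by (simp add: dist_real_def abs_minus_commute)
    qed (use C in auto)
    then show ?thesis by (rule lipschitz_on_continuous_on)
  qed
  then have "isCont B z" for z
    by (rule continuous_on_interior[of "{- (\<bar>z\<bar> + 1)<..<\<bar>z\<bar> + 1}"]) (auto simp: interior_open)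
  then show ?thesis by (intro continuous_at_imp_continuous_on) auto
qed

lemma continuous_scale_deriv: "continuous_on UNIV scale_deriv"
  unfolding scale_deriv_def[abs_def] by (intro continuous_intros continuous_drift_exponent)

lemma continuous_speed: "continuous_on UNIV speed"
  unfolding speed_def[abs_def]
  by (intro continuous_intros continuous_drift_exponent a_cont) (use a_pos in \<open>auto simp: less_imp_neq[symmetric]\<close>)

lemma speed_pos: "0 < speed z" and scale_deriv_pos: "0 < scale_deriv z"
  using a_pos by (auto simp: speed_def scale_deriv_def)

end

section \<open>Dynkin's formula with measurable drift\<close>

text \<open>\<open>Oc\<close> stands for the occupation measure of a stopped process started at \<open>x\<close>, and \<open>\<rho>\<close> for
  its law at the stopping time.\<close>

locale dynkin_pair = diffusion_coefficients a b for a b +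
  fixes x y :: real and Oc \<rho> :: "real measure"
  assumes finite_Oc: "finite_measure Oc" and sets_Oc[measurable_cong]: "sets Oc = sets borel"
    and prob_\<rho>: "prob_space \<rho>" and sets_\<rho>[measurable_cong]: "sets \<rho> = sets borel"
    and Oc_le: "AE z in Oc. z \<le> y" and \<rho>_le: "AE z in \<rho>. z \<le> y"
    and x_le: "x \<le> y"
    and dynkin: "\<And>f. C2_compact_support f \<Longrightarrow> (\<integral>z. f z \<partial>\<rho>) = f x + (\<integral>z. generator a b f z \<partial>Oc)"
begin

sublocale Oc: finite_measure Oc by (rule finite_Oc)
sublocale \<rho>: prob_space \<rho> by (rule prob_\<rho>)

text \<open>\<open>G\<close> is the generator applied to \<open>\<kappa> F\<close>, expanded by the
  product rule. Multiplying by \<open>\<kappa>\<close> makes any C2 function admissible in Dynkin's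
  formula.\<close>

lemma dynkin_cutoff:
  fixes F F1 F2 \<kappa> \<kappa>1 \<kappa>2 :: "real \<Rightarrow> real"
  assumes \<kappa>: "\<And>z. (\<kappa> has_real_derivative \<kappa>1 z) (at z)" "\<And>z. (\<kappa>1 has_real_derivative \<kappa>2 z) (at z)"
      "continuous_on UNIV \<kappa>2" "\<And>z. R < \<bar>z\<bar> \<Longrightarrow> \<kappa> z = 0"
    and F: "\<And>z. (F has_real_derivative F1 z) (at z)" "\<And>z. (F1 has_real_derivative F2 z) (at z)"
      "continuous_on UNIV F2"
  defines "G \<equiv> \<lambda>z. 1 / 2 * a z * (\<kappa>2 z * F z + 2 * \<kappa>1 z * F1 z + \<kappa> z * F2 z) + b z * (\<kappa>1 z * F z + \<kappa> z * F1 z)"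
  shows "(\<integral>z. \<kappa> z * F z \<partial>\<rho>) = \<kappa> x * F x + (\<integral>z. G z \<partial>Oc)"
    and "G \<in> borel_measurable borel" and "integrable Oc G"
proof -
  have c: "continuous_on UNIV \<kappa>" "continuous_on UNIV \<kappa>1" "continuous_on UNIV F" "continuous_on UNIV F1"
    using DERIV_isCont[OF \<kappa>(1)] DERIV_isCont[OF \<kappa>(2)] DERIV_isCont[OF F(1)] DERIV_isCont[OF F(2)]
    by (auto intro: continuous_at_imp_continuous_on)
  have d1: "((\<lambda>z. \<kappa> z * F z) has_real_derivative \<kappa>1 z * F z + \<kappa> z * F1 z) (at z)" for z
    by (auto intro!: derivative_eq_intros \<kappa> F)
  have d2: "((\<lambda>z. \<kappa>1 z * F z + \<kappa> z * F1 z) has_real_derivative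
      \<kappa>2 z * F z + 2 * \<kappa>1 z * F1 z + \<kappa> z * F2 z) (at z)" for z
    by (auto intro!: derivative_eq_intros \<kappa> F)
  have c2: "continuous_on UNIV (\<lambda>z. \<kappa>2 z * F z + 2 * \<kappa>1 z * F1 z + \<kappa> z * F2 z)"
    by (intro continuous_intros c \<kappa> F)
  have C2: "C2_compact_support (\<lambda>z. \<kappa> z * F z)"
    by (rule C2_compact_supportI[OF d1 d2 c2, of R]) (use \<kappa>(4) in auto)
  have gen: "generator a b (\<lambda>z. \<kappa> z * F z) = G"
    unfolding G_def by (rule ext, rule C2_compact_supportI(2)[OF d1 d2 c2, of R]) (use \<kappa>(4) in auto)
  show "(\<integral>z. \<kappa> z * F z \<partial>\<rho>) = \<kappa> x * F x + (\<integral>z. G z \<partial>Oc)"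
    using dynkin[OF C2] by (simp add: gen)
  show m: "G \<in> borel_measurable borel" using generator_measurable[OF C2] by (simp add: gen)
  obtain C where "\<And>z. \<bar>G z\<bar> \<le> C" using generator_bounded[OF C2] by (auto simp: gen)
  then show "integrable Oc G" using m by (intro Oc.integrable_const_bound[where B = C]) auto
qed

text \<open>The test function is \<open>\<kappa> F\<close> with \<open>F'' = 2 g / a\<close>: the drift only enters through \<open>F\<close> and \<open>F'\<close>,
  which are bounded by a multiple of \<open>\<integral> g\<close>.\<close>

lemma occupation_bound:
  assumes K: "0 \<le> K"
  obtains C and \<kappa> :: "real \<Rightarrow> real" where "0 \<le> C" "continuous_on UNIV \<kappa>" "\<And>z. 0 \<le> \<kappa> z" "\<And>z. \<bar>z\<bar> \<le> K \<Longrightarrow> \<kappa> z = 1"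
    "\<And>z. K + 1 < \<bar>z\<bar> \<Longrightarrow> \<kappa> z = 0"
    "\<And>g. continuous_on UNIV g \<Longrightarrow> (\<And>z. 0 \<le> g z) \<Longrightarrow>
      (\<integral>z. \<kappa> z * g z \<partial>Oc) \<le> C * primitive (- (K + 1)) g (K + 1)"
proof -
  define L where "L = K + 1"
  have L: "0 < L" using K by (simp add: L_def)
  obtain \<kappa> \<kappa>1 \<kappa>2 :: "real \<Rightarrow> real" where \<kappa>: "\<And>z. (\<kappa> has_real_derivative \<kappa>1 z) (at z)"
      "\<And>z. (\<kappa>1 has_real_derivative \<kappa>2 z) (at z)" "continuous_on UNIV \<kappa>2"
    and \<kappa>_one: "\<And>z. \<bar>z\<bar> \<le> K \<Longrightarrow> \<kappa> z = 1 \<and> \<kappa>1 z = 0 \<and> \<kappa>2 z = 0"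
    and \<kappa>_zero: "\<And>z. L < \<bar>z\<bar> \<Longrightarrow> \<kappa> z = 0 \<and> \<kappa>1 z = 0 \<and> \<kappa>2 z = 0"
    and \<kappa>_pos: "\<And>z. 0 \<le> \<kappa> z"
    using C2_cutoff[OF K] unfolding L_def by metis
  have \<kappa>_cont: "continuous_on UNIV \<kappa>" "continuous_on UNIV \<kappa>1"
    using DERIV_isCont[OF \<kappa>(1)] DERIV_isCont[OF \<kappa>(2)] by (auto intro: continuous_at_imp_continuous_on)
  have cont_inv: "continuous_on UNIV (\<lambda>z. 1 / a z)"
    by (intro continuous_intros a_cont) (use a_pos in \<open>auto simp: less_imp_neq[symmetric]\<close>)
  obtain A where A: "0 \<le> A" "\<And>z. -L \<le> z \<Longrightarrow> z \<le> L \<Longrightarrow> \<bar>a z\<bar> \<le> A" using continuous_bounded_Icc[OF a_cont, of "-L" L] by blast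
  obtain \<alpha> where \<alpha>: "0 \<le> \<alpha>" "\<And>z. -L \<le> z \<Longrightarrow> z \<le> L \<Longrightarrow> \<bar>1 / a z\<bar> \<le> \<alpha>" using continuous_bounded_Icc[OF cont_inv, of "-L" L] by blast
  obtain D where D: "0 \<le> D" "\<And>z. -L \<le> z \<Longrightarrow> z \<le> L \<Longrightarrow> \<bar>b z\<bar> \<le> D" using b_bounded_Icc[of "-L" L] by blast
  obtain k0 where k0: "0 \<le> k0" "\<And>z. -L \<le> z \<Longrightarrow> z \<le> L \<Longrightarrow> \<bar>\<kappa> z\<bar> \<le> k0" using continuous_bounded_Icc[OF \<kappa>_cont(1), of "-L" L] by blast
  obtain k1 where k1: "0 \<le> k1" "\<And>z. -L \<le> z \<Longrightarrow> z \<le> L \<Longrightarrow> \<bar>\<kappa>1 z\<bar> \<le> k1" using continuous_bounded_Icc[OF \<kappa>_cont(2), of "-L" L] by blast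
  obtain k2 where k2: "0 \<le> k2" "\<And>z. -L \<le> z \<Longrightarrow> z \<le> L \<Longrightarrow> \<bar>\<kappa>2 z\<bar> \<le> k2" using continuous_bounded_Icc[OF \<kappa>(3), of "-L" L] by blast
  \<comment> \<open>With \<open>\<gamma>\<close> the integral of \<open>g\<close> over
    \<open>[-L, L]\<close>, integrating \<open>2 g / a\<close> once bounds \<open>F1\<close> by
    \<open>e1 * \<gamma>\<close>, and integrating again over a length of at most
    \<open>2 * L\<close> bounds \<open>F\<close> by \<open>e0 * \<gamma>\<close>.\<close>
  define e1 where "e1 = 2 * \<alpha>"
  define e0 where "e0 = e1 * (2 * L)"
  have e: "0 \<le> e1" "0 \<le> e0" using \<alpha> L by (auto simp: e1_def e0_def)
  \<comment> \<open>\<open>Cr * \<gamma>\<close> bounds the remainder \<open>r\<close> below. In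
    \<open>C\<close>, the summand \<open>2 * (k0 * e0)\<close> accounts for the terms
    \<open>\<kappa> F\<close> at the stopped position and at \<open>x\<close>, and the other for
    \<open>r\<close> integrated over the total mass of \<open>Oc\<close>.\<close>
  define Cr where "Cr = 1 / 2 * A * (k2 * e0 + 2 * k1 * e1) + D * (k1 * e0 + k0 * e1)"
  define C where "C = 2 * (k0 * e0) + Cr * measure Oc (space Oc)"
  have Cr: "0 \<le> Cr" unfolding Cr_def using A \<alpha> D k0 k1 k2 e by simp
  show ?thesis
  proof (rule that[of C \<kappa>])
    show "0 \<le> C" unfolding C_def using Cr k0 e by simp
  next
    fix g :: "real \<Rightarrow> real" assume g: "continuous_on UNIV g" "\<And>z. 0 \<le> g z"
    define \<gamma> where "\<gamma> = primitive (-L) g L"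
    define F2 where "F2 = (\<lambda>z. 2 * g z * (1 / a z))"
    define F1 where "F1 = primitive (-L) F2"
    define F where "F = primitive (-L) F1"
    have F2: "continuous_on UNIV F2" unfolding F2_def by (intro continuous_intros g(1) cont_inv)
    have dF1: "(F1 has_real_derivative F2 z) (at z)" for z unfolding F1_def by (rule DERIV_primitive[OF F2])
    then have F1: "continuous_on UNIV F1" by (auto intro: continuous_at_imp_continuous_on DERIV_isCont)
    have dF: "(F has_real_derivative F1 z) (at z)" for z unfolding F_def by (rule DERIV_primitive[OF F1])
    have F2_int: "set_integrable lborel {c..d} F2" for c d
      by (rule borel_integrable_atLeastAtMost'[OF continuous_on_subset[OF F2]]) auto
    have g_int: "set_integrable lborel {c..d} g" for c d
      by (rule borel_integrable_atLeastAtMost'[OF continuous_on_subset[OF g(1)]]) auto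
    have \<gamma>_eq: "\<gamma> = (LBINT t:{-L..L}. g t)" unfolding \<gamma>_def using L by (intro primitive_eq_set_integral) auto
    have \<gamma>0: "0 \<le> \<gamma>" unfolding \<gamma>_eq set_lebesgue_integral_def by (intro integral_nonneg_AE) (use g in auto)
    have F1_bound: "\<bar>F1 z\<bar> \<le> e1 * \<gamma>" if z: "-L \<le> z" "z \<le> L" for z
    proof -
      have eq: "F1 z = (LBINT t:{-L..z}. F2 t)" unfolding F1_def using z by (intro primitive_eq_set_integral)
      have "0 \<le> F2 t" for t using g(2)[of t] a_pos[of t] by (simp add: F2_def)
      then have "0 \<le> F1 z" unfolding eq set_lebesgue_integral_def by (intro integral_nonneg_AE) auto
      moreover have "F1 z \<le> (LBINT t:{-L..L}. e1 * g t)"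
        unfolding eq set_lebesgue_integral_def
      proof (rule integral_mono)
        show "integrable lborel (\<lambda>t. indicator {-L..z} t *\<^sub>R F2 t)" using F2_int by (simp add: set_integrable_def)
        have "set_integrable lborel {-L..L} (\<lambda>t. e1 * g t)" using g_int by (rule set_integrable_mult_right)
        then show "integrable lborel (\<lambda>t. indicator {-L..L} t *\<^sub>R (e1 * g t))" by (simp add: set_integrable_def)
        fix t
        show "indicator {-L..z} t *\<^sub>R F2 t \<le> indicator {-L..L} t *\<^sub>R (e1 * g t)"
        proof (cases "t \<in> {-L..z}")
          case True
          then have "1 / a t \<le> \<alpha>" using \<alpha>(2)[of t] z abs_of_pos[OF a_pos[of t]] by auto
          then have "2 * g t * (1 / a t) \<le> 2 * g t * \<alpha>" by (rule mult_left_mono) (use g in auto)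
          then show ?thesis using True z by (auto simp: F2_def e1_def algebra_simps)
        next
          case False
          then show ?thesis using g e by (auto simp: indicator_def)
        qed
      qed
      ultimately show ?thesis by (simp add: \<gamma>_eq)
    qed
    have F_bound: "\<bar>F z\<bar> \<le> e0 * \<gamma>" if z: "-L \<le> z" "z \<le> L" for z
    proof -
      have "\<bar>F z\<bar> \<le> (e1 * \<gamma>) * (z - - L)" unfolding F_def
        by (rule primitive_bound_right) (use z F1_bound borel_measurable_continuous_onI[OF F1] in auto)
      also have "\<dots> \<le> (e1 * \<gamma>) * (2 * L)" using z e \<gamma>0 by (intro mult_left_mono) auto
      finally show ?thesis by (simp add: e0_def mult_ac)
    qed
    \<comment> \<open>\<open>r\<close> is what remains of the generator of \<open>\<kappa> F\<close>
      after removal of the term with \<open>F2\<close>; that term equals \<open>\<kappa> g\<close>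
      because \<open>a * F2 = 2 * g\<close>.\<close>
    define r where "r = (\<lambda>z. 1 / 2 * a z * (\<kappa>2 z * F z + 2 * \<kappa>1 z * F1 z) + b z * (\<kappa>1 z * F z + \<kappa> z * F1 z))"
    define G where "G = (\<lambda>z. 1 / 2 * a z * (\<kappa>2 z * F z + 2 * \<kappa>1 z * F1 z + \<kappa> z * F2 z) + b z * (\<kappa>1 z * F z + \<kappa> z * F1 z))"
    have r_bound: "\<bar>r z\<bar> \<le> Cr * \<gamma>" for z
    proof (cases "L < \<bar>z\<bar>")
      case True
      then show ?thesis using \<kappa>_zero[OF True] Cr \<gamma>0 by (simp add: r_def)
    next
      case False
      then have z: "-L \<le> z" "z \<le> L" by auto
      have "\<bar>\<kappa>2 z * F z + 2 * \<kappa>1 z * F1 z\<bar> \<le> \<bar>\<kappa>2 z\<bar> * \<bar>F z\<bar> + 2 * (\<bar>\<kappa>1 z\<bar> * \<bar>F1 z\<bar>)"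
        using abs_triangle_ineq[of "\<kappa>2 z * F z" "2 * \<kappa>1 z * F1 z"] by (simp add: abs_mult)
      also have "\<dots> \<le> k2 * (e0 * \<gamma>) + 2 * (k1 * (e1 * \<gamma>))"
        using k2 k1 F_bound[OF z] F1_bound[OF z] z by (intro add_mono mult_mono mult_left_mono) auto
      finally have 1: "\<bar>\<kappa>2 z * F z + 2 * \<kappa>1 z * F1 z\<bar> \<le> k2 * (e0 * \<gamma>) + 2 * (k1 * (e1 * \<gamma>))" .
      have "\<bar>\<kappa>1 z * F z + \<kappa> z * F1 z\<bar> \<le> \<bar>\<kappa>1 z\<bar> * \<bar>F z\<bar> + \<bar>\<kappa> z\<bar> * \<bar>F1 z\<bar>"
        using abs_triangle_ineq[of "\<kappa>1 z * F z" "\<kappa> z * F1 z"] by (simp add: abs_mult)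
      also have "\<dots> \<le> k1 * (e0 * \<gamma>) + k0 * (e1 * \<gamma>)"
        using k0 k1 F_bound[OF z] F1_bound[OF z] z by (intro add_mono mult_mono) auto
      finally have 2: "\<bar>\<kappa>1 z * F z + \<kappa> z * F1 z\<bar> \<le> k1 * (e0 * \<gamma>) + k0 * (e1 * \<gamma>)" .
      have "\<bar>r z\<bar> \<le> 1 / 2 * \<bar>a z\<bar> * \<bar>\<kappa>2 z * F z + 2 * \<kappa>1 z * F1 z\<bar> + \<bar>b z\<bar> * \<bar>\<kappa>1 z * F z + \<kappa> z * F1 z\<bar>"
        unfolding r_def by (rule order_trans[OF abs_triangle_ineq]) (simp add: abs_mult)
      also have "\<dots> \<le> 1 / 2 * A * (k2 * (e0 * \<gamma>) + 2 * (k1 * (e1 * \<gamma>))) + D * (k1 * (e0 * \<gamma>) + k0 * (e1 * \<gamma>))"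
        using 1 2 A D z by (intro add_mono mult_mono) auto
      also have "\<dots> = Cr * \<gamma>" by (simp add: Cr_def algebra_simps)
      finally show ?thesis .
    qed
    note dyn = dynkin_cutoff[OF \<kappa>(1,2,3) _ dF dF1 F2, of L, folded G_def]
    have \<kappa>0: "\<And>z. L < \<bar>z\<bar> \<Longrightarrow> \<kappa> z = 0" using \<kappa>_zero by blast
    have [measurable]: "G \<in> borel_measurable borel" "\<kappa> \<in> borel_measurable borel" "g \<in> borel_measurable borel"
      using dyn(2)[OF \<kappa>0] borel_measurable_continuous_onI[OF \<kappa>_cont(1)] borel_measurable_continuous_onI[OF g(1)] by auto
    have G_eq: "\<kappa> z * g z = G z - r z" for z using a_pos[of z] by (simp add: G_def r_def F2_def algebra_simps)
    have r_eq: "r = (\<lambda>z. G z - \<kappa> z * g z)" using G_eq by (auto simp: fun_eq_iff algebra_simps)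
    have [measurable]: "r \<in> borel_measurable borel" unfolding r_eq by measurable
    have r_int: "integrable Oc r" by (rule Oc.integrable_const_bound[where B = "Cr * \<gamma>"]) (use r_bound in auto)
    have \<kappa>F_bound: "\<bar>\<kappa> z * F z\<bar> \<le> k0 * (e0 * \<gamma>)" for z
    proof (cases "L < \<bar>z\<bar>")
      case True
      then show ?thesis using \<kappa>0 k0 e \<gamma>0 by simp
    next
      case False
      then have z: "-L \<le> z" "z \<le> L" by auto
      show ?thesis unfolding abs_mult using k0 F_bound[OF z] z by (intro mult_mono) auto
    qed
    have "(\<integral>z. \<kappa> z * F z \<partial>\<rho>) \<le> k0 * (e0 * \<gamma>)"
    proof -
      have [measurable]: "F \<in> borel_measurable borel"
        by (intro borel_measurable_continuous_onI continuous_at_imp_continuous_on ballI DERIV_isCont[OF dF])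
      have "(\<integral>z. \<kappa> z * F z \<partial>\<rho>) \<le> (\<integral>z. k0 * (e0 * \<gamma>) \<partial>\<rho>)"
      proof (rule integral_mono)
        show "integrable \<rho> (\<lambda>z. \<kappa> z * F z)"
          by (rule \<rho>.integrable_const_bound[where B = "k0 * (e0 * \<gamma>)"]) (use \<kappa>F_bound in auto)
        show "\<kappa> z * F z \<le> k0 * (e0 * \<gamma>)" for z using \<kappa>F_bound[of z] by linarith
      qed simp
      then show ?thesis by (simp add: \<rho>.prob_space)
    qed
    moreover have "- (\<kappa> x * F x) \<le> k0 * (e0 * \<gamma>)" using \<kappa>F_bound[of x] by linarith
    ultimately have G_le: "(\<integral>z. G z \<partial>Oc) \<le> 2 * (k0 * (e0 * \<gamma>))" using dyn(1)[OF \<kappa>0] by simp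
    have "- (\<integral>z. r z \<partial>Oc) \<le> (\<integral>z. \<bar>r z\<bar> \<partial>Oc)" using integral_abs_bound[of Oc r] by linarith
    also have "\<dots> \<le> (\<integral>z. Cr * \<gamma> \<partial>Oc)" by (intro integral_mono integrable_abs r_int r_bound) auto
    also have "\<dots> = Cr * \<gamma> * measure Oc (space Oc)" by simp
    finally have r_le: "- (\<integral>z. r z \<partial>Oc) \<le> Cr * \<gamma> * measure Oc (space Oc)" .
    have "(\<integral>z. \<kappa> z * g z \<partial>Oc) = (\<integral>z. G z \<partial>Oc) - (\<integral>z. r z \<partial>Oc)"
      unfolding G_eq by (rule Bochner_Integration.integral_diff[OF dyn(3)[OF \<kappa>0] r_int])
    also have "\<dots> \<le> C * \<gamma>" using G_le r_le by (simp add: C_def algebra_simps)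
    finally show "(\<integral>z. \<kappa> z * g z \<partial>Oc) \<le> C * primitive (- (K + 1)) g (K + 1)" by (simp add: \<gamma>_def L_def)
  qed (use \<kappa>_cont \<kappa>_pos \<kappa>_one \<kappa>_zero in \<open>auto simp: L_def\<close>)
qed

text \<open>A null set is covered by an open \<open>U\<close> of Lebesgue measure below
  \<open>e\<close>. Continuous functions converging to the indicator of \<open>U\<close> carry the
  occupation bound over to \<open>U\<close>, so the part of the null set in \<open>[-K, K]\<close>
  has occupation at most \<open>C * e\<close>, where \<open>C\<close> depends on \<open>K\<close>
  but not on \<open>e\<close>.\<close>

lemma Oc_null_sets:
  assumes N: "N \<in> null_sets lborel"
  shows "N \<in> null_sets Oc"
proof -
  have Nb[measurable]: "N \<in> sets borel" using N by auto
  have small: "measure Oc (N \<inter> {-K..K}) = 0" if K: "0 \<le> K" for K :: real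
  proof (rule occupation_bound[OF K])
    fix C and \<kappa> :: "real \<Rightarrow> real"
    assume C: "0 \<le> C" and \<kappa>: "continuous_on UNIV \<kappa>" "\<And>z. 0 \<le> \<kappa> z" "\<And>z. \<bar>z\<bar> \<le> K \<Longrightarrow> \<kappa> z = 1"
      "\<And>z. K + 1 < \<bar>z\<bar> \<Longrightarrow> \<kappa> z = 0"
      and bound: "\<And>g. continuous_on UNIV g \<Longrightarrow> (\<And>z. 0 \<le> g z) \<Longrightarrow>
        (\<integral>z. \<kappa> z * g z \<partial>Oc) \<le> C * primitive (- (K + 1)) g (K + 1)"
    have [measurable]: "\<kappa> \<in> borel_measurable borel" by (rule borel_measurable_continuous_onI[OF \<kappa>(1)])
    obtain k where k: "0 \<le> k" "\<And>z. -(K+1) \<le> z \<Longrightarrow> z \<le> K+1 \<Longrightarrow> \<bar>\<kappa> z\<bar> \<le> k"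
      using continuous_bounded_Icc[OF \<kappa>(1), of "-(K+1)" "K+1"] by blast
    have k': "\<bar>\<kappa> z\<bar> \<le> k" for z
      using k(1) k(2)[of z] \<kappa>(4)[of z] by (cases "K + 1 < \<bar>z\<bar>") auto
    have "measure Oc (N \<inter> {-K..K}) \<le> C * e" if e: "0 < e" for e
    proof -
      obtain U where U: "open U" "N \<subseteq> U" "emeasure lborel (U - N) < ennreal e"
        using outer_regular_lborel[OF Nb, of e] e by auto
      have [measurable]: "U \<in> sets borel" using U(1) by simp
      have "emeasure lborel U = emeasure lborel (U - N)"
        using emeasure_Diff_null_set[OF N, of U] by simp
      then have Ue: "emeasure lborel U < ennreal e" using U(3) by simp
      then have Um: "measure lborel U \<le> e"
        unfolding measure_def using e by (intro enn2real_leI) auto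
      \<comment> \<open>The distance to the empty set is 0 by convention, so \<open>g\<close> below
        would vanish identically if \<open>U\<close> were the whole line.\<close>
      have "U \<noteq> UNIV" using Ue by auto
      then have ne: "- U \<noteq> {}" by auto
      define g where "g m z = min 1 (real m * infdist z (- U))" for m z
      have gc: "continuous_on UNIV (g m)" for m unfolding g_def[abs_def] by (intro continuous_intros)
      have g0: "0 \<le> g m z" for m z by (simp add: g_def infdist_nonneg)
      have [measurable]: "g m \<in> borel_measurable borel" for m by (rule borel_measurable_continuous_onI[OF gc])
      have g_le: "g m z \<le> indicator U z" for m z
        by (cases "z \<in> U") (auto simp: g_def)
      have g_lim: "(\<lambda>m. g m z) \<longlonglongrightarrow> indicator U z" for z
      proof (cases "z \<in> U")
        case True
        then have pos: "infdist z (- U) > 0"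
          using in_closed_iff_infdist_zero[of "- U" z] U(1) ne infdist_nonneg[of z "- U"] by (auto simp: less_le)
        obtain m0 :: nat where m0: "1 / infdist z (- U) < real m0" using reals_Archimedean2 by blast
        have "\<forall>\<^sub>F m in sequentially. g m z = 1"
          using eventually_ge_at_top[of m0]
        proof eventually_elim
          case (elim m)
          then have "1 / infdist z (- U) < real m" using m0 by simp
          then show ?case using pos by (simp add: g_def pos_divide_less_eq)
        qed
        then show ?thesis using True by (simp add: tendsto_eventually)
      next
        case False
        then show ?thesis by (simp add: g_def)
      qed
      have upper: "(\<integral>z. \<kappa> z * g m z \<partial>Oc) \<le> C * e" for m
      proof -
        have "primitive (- (K + 1)) (g m) (K + 1) = (LBINT t:{-(K+1)..K+1}. g m t)"
          using K by (intro primitive_eq_set_integral) auto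
        also have "\<dots> \<le> (LBINT t. indicator U t)"
          unfolding set_lebesgue_integral_def
        proof (rule integral_mono)
          show "integrable lborel (\<lambda>t. indicator {-(K+1)..K+1} t *\<^sub>R g m t)"
            using borel_integrable_atLeastAtMost'[OF continuous_on_subset[OF gc], of "-(K+1)" "K+1"]
            by (simp add: set_integrable_def)
          show "integrable lborel (indicator U :: real \<Rightarrow> real)"
            using Ue by (intro integrable_real_indicator) (auto simp: less_top[symmetric] intro: order_less_trans)
          show "indicator {-(K+1)..K+1} t *\<^sub>R g m t \<le> indicator U t" for t
            using g_le[of m t] by (auto simp: indicator_def)
        qed
        also have "\<dots> \<le> e" using Um by simp
        finally have "primitive (- (K + 1)) (g m) (K + 1) \<le> e" .
        then show ?thesis using bound[OF gc[of m] g0] C by (meson mult_left_mono order_trans)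
      qed
      have "(\<lambda>m. \<integral>z. \<kappa> z * g m z \<partial>Oc) \<longlonglongrightarrow> (\<integral>z. \<kappa> z * indicator U z \<partial>Oc)"
      proof (rule integral_dominated_convergence[where w = "\<lambda>_. k"])
        show "AE z in Oc. (\<lambda>m. \<kappa> z * g m z) \<longlonglongrightarrow> \<kappa> z * indicator U z"
          by (intro AE_I2 tendsto_intros g_lim)
        have "\<bar>g m z\<bar> \<le> 1" for m z using g0[of m z] by (simp add: g_def)
        then show "AE z in Oc. norm (\<kappa> z * g m z) \<le> k" for m
          using mult_mono[OF k' _ k(1), of "\<bar>g m _\<bar>" 1] by (intro AE_I2) (simp add: abs_mult)
      qed (use sets_Oc in auto)
      then have le: "(\<integral>z. \<kappa> z * indicator U z \<partial>Oc) \<le> C * e" using upper by (intro LIMSEQ_le_const2) auto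
      have "measure Oc (N \<inter> {-K..K}) = (\<integral>z. indicator (N \<inter> {-K..K}) z \<partial>Oc)"
        using sets_Oc by (simp add: sets_eq_imp_space_eq[OF sets_Oc])
      also have "\<dots> \<le> (\<integral>z. \<kappa> z * indicator U z \<partial>Oc)"
      proof (rule integral_mono)
        show "integrable Oc (indicator (N \<inter> {-K..K}) :: real \<Rightarrow> real)"
          by (rule Oc.integrable_const_bound[where B = 1]) (auto simp: indicator_def)
        show "integrable Oc (\<lambda>z. \<kappa> z * indicator U z)"
          by (rule Oc.integrable_const_bound[where B = k]) (use k' k(1) in \<open>auto simp: indicator_def\<close>)
        show "indicator (N \<inter> {-K..K}) z \<le> \<kappa> z * indicator U z" for z
          using \<kappa>(2,3)[of z] U(2) by (auto simp: indicator_def abs_le_iff)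
      qed
      also note le
      finally show ?thesis .
    qed
    note le = this
    have "measure Oc (N \<inter> {-K..K}) \<le> 0"
    proof (rule field_le_epsilon)
      fix e :: real assume e: "0 < e"
      \<comment> \<open>Dividing by \<open>C + 1\<close> rather than \<open>C\<close> covers the
        case \<open>C = 0\<close>.\<close>
      have "C * (e / (C + 1)) \<le> e" using C e by (simp add: field_simps)
      then show "measure Oc (N \<inter> {-K..K}) \<le> 0 + e" using le[of "e / (C + 1)"] e C by simp
    qed
    then show "measure Oc (N \<inter> {-K..K}) = 0" using measure_nonneg[of Oc "N \<inter> {-K..K}"] by linarith
  qed
  have "N \<inter> {- real n..real n} \<in> null_sets Oc" for n
    using small[of "real n"] sets_Oc by (auto simp: null_sets_def Oc.emeasure_eq_measure)
  then have "(\<Union>n. N \<inter> {- real n..real n}) \<in> null_sets Oc" by (rule null_sets_UN)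
  moreover have "(\<Union>n. N \<inter> {- real n..real n}) = N"
  proof -
    have "\<exists>n. - real n \<le> z \<and> z \<le> real n" for z :: real
    proof -
      obtain n :: nat where "\<bar>z\<bar> \<le> real n" using real_arch_simple by blast
      then show ?thesis by (intro exI[of _ n]) linarith
    qed
    then show ?thesis by auto
  qed
  ultimately show ?thesis by simp
qed

end

text \<open>A form of Lusin's theorem: Lebesgue measurability implies \<open>measurable_on\<close>,
  which is defined by limits of continuous functions off a negligible set.\<close>

lemma continuous_approximation_AE:
  fixes f :: "real \<Rightarrow> real"
  assumes f: "f \<in> borel_measurable borel"
  obtains g where "\<And>n::nat. continuous_on UNIV (g n)" "AE x in lborel. (\<lambda>n. g n x) \<longlonglongrightarrow> f x"
proof -
  have "f \<in> borel_measurable lebesgue" using f by (simp add: measurable_completion)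
  then have "f measurable_on UNIV" by (rule lebesgue_measurable_imp_measurable_on) simp
  then obtain N g where N: "negligible N" and g: "\<And>n. continuous_on UNIV (g n)"
    "\<And>x. x \<notin> N \<Longrightarrow> (\<lambda>n. g n x) \<longlonglongrightarrow> f x"
    unfolding measurable_on_def by auto
  have "AE x in lebesgue. x \<notin> N" using N by (intro AE_not_in) (simp add: negligible_iff_null_sets)
  then have "AE x in lborel. x \<notin> N" by (simp add: AE_completion_iff)
  then have "AE x in lborel. (\<lambda>n. g n x) \<longlonglongrightarrow> f x" by eventually_elim (rule g)
  with g(1) show ?thesis by (rule that)
qed

context dynkin_pair
begin

lemma AE_Oc_if_AE_lborel:
  assumes "AE z in lborel. P z"
  shows "AE z in Oc. P z"
proof -
  obtain N where "{z. \<not> P z} \<subseteq> N" "N \<in> null_sets lborel"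
    using assms unfolding eventually_ae_filter by auto
  then show ?thesis by (intro AE_I'[OF Oc_null_sets]) auto
qed

text \<open>This is the integrated form of \<open>L F = - q\<close>. With \<open>b / a\<close>
  replaced by a continuous \<open>\<beta> n\<close>, the function \<open>Fn\<close> is C2, and the
  generator produces the extra error \<open>exp (- Bn) * a * h * (b / a - \<beta> n)\<close>, which
  tends to 0 almost everywhere for \<open>Oc\<close>. The cutoff has no effect in the limit: both
  measures live on \<open>(-\<infinity>, y]\<close>, where \<open>F\<close> vanishes left of
  \<open>- R\<close> and \<open>\<kappa>\<close> is 1 elsewhere.\<close>

lemma dynkin_scale:
  fixes F h q :: "real \<Rightarrow> real"
  assumes q: "continuous_on UNIV q"
    and h: "\<And>z. (h has_real_derivative - 2 * speed z * q z) (at z)"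
    and F: "\<And>z. (F has_real_derivative scale_deriv z * h z) (at z)"
    and zero: "\<And>z. z \<le> - R \<Longrightarrow> q z = 0 \<and> h z = 0 \<and> F z = 0"
    and R: "0 \<le> R" "y \<le> R"
  shows "(\<integral>z. F z \<partial>\<rho>) = F x - (\<integral>z. q z \<partial>Oc)"
proof -
  define L where "L = R + 1"
  have L: "0 < L" "R < L" using R by (auto simp: L_def)
  let ?\<beta> = "\<lambda>t. b t / a t"
  obtain \<kappa> \<kappa>1 \<kappa>2 :: "real \<Rightarrow> real" where \<kappa>: "\<And>z. (\<kappa> has_real_derivative \<kappa>1 z) (at z)"
      "\<And>z. (\<kappa>1 has_real_derivative \<kappa>2 z) (at z)" "continuous_on UNIV \<kappa>2"
    and \<kappa>_one: "\<And>z. \<bar>z\<bar> \<le> R \<Longrightarrow> \<kappa> z = 1 \<and> \<kappa>1 z = 0 \<and> \<kappa>2 z = 0"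
    and \<kappa>_zero: "\<And>z. L < \<bar>z\<bar> \<Longrightarrow> \<kappa> z = 0 \<and> \<kappa>1 z = 0 \<and> \<kappa>2 z = 0"
    using C2_cutoff[OF R(1)] unfolding L_def by metis
  have \<kappa>0: "\<And>z. L < \<bar>z\<bar> \<Longrightarrow> \<kappa> z = 0" using \<kappa>_zero by blast
  have \<kappa>_cont: "continuous_on UNIV \<kappa>"
    using DERIV_isCont[OF \<kappa>(1)] by (auto intro: continuous_at_imp_continuous_on)
  have h_cont: "continuous_on UNIV h" using DERIV_isCont[OF h] by (auto intro: continuous_at_imp_continuous_on)
  have F_cont: "continuous_on UNIV F" using DERIV_isCont[OF F] by (auto intro: continuous_at_imp_continuous_on)
  note [measurable] = borel_measurable_continuous_onI[OF \<kappa>_cont] borel_measurable_continuous_onI[OF h_cont]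
    borel_measurable_continuous_onI[OF F_cont] borel_measurable_continuous_onI[OF q]
  obtain C where C: "0 \<le> C" "\<And>z. -L \<le> z \<Longrightarrow> z \<le> L \<Longrightarrow> \<bar>b z / a z\<bar> \<le> C" using ratio_bounded_Icc[of "-L" L] by blast
  obtain A where A: "0 \<le> A" "\<And>z. -L \<le> z \<Longrightarrow> z \<le> L \<Longrightarrow> \<bar>a z\<bar> \<le> A" using continuous_bounded_Icc[OF a_cont, of "-L" L] by blast
  obtain k0 where k0: "0 \<le> k0" "\<And>z. -L \<le> z \<Longrightarrow> z \<le> L \<Longrightarrow> \<bar>\<kappa> z\<bar> \<le> k0" using continuous_bounded_Icc[OF \<kappa>_cont, of "-L" L] by blast
  obtain H where H: "0 \<le> H" "\<And>z. -L \<le> z \<Longrightarrow> z \<le> L \<Longrightarrow> \<bar>h z\<bar> \<le> H" using continuous_bounded_Icc[OF h_cont, of "-L" L] by blast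
  obtain Q where Q: "0 \<le> Q" "\<And>z. -L \<le> z \<Longrightarrow> z \<le> L \<Longrightarrow> \<bar>q z\<bar> \<le> Q" using continuous_bounded_Icc[OF q, of "-L" L] by blast
  obtain E where E: "0 \<le> E" "\<And>z. -L \<le> z \<Longrightarrow> z \<le> L \<Longrightarrow> \<bar>B z\<bar> \<le> E" using continuous_bounded_Icc[OF continuous_drift_exponent, of "-L" L] by blast
  obtain g where g: "\<And>n::nat. continuous_on UNIV (g n)" "AE z in lborel. (\<lambda>n. g n z) \<longlonglongrightarrow> ?\<beta> z"
    using continuous_approximation_AE[OF ratio_measurable] by blast
  \<comment> \<open>Clipping at the bound \<open>C\<close> of \<open>b / a\<close> on
    \<open>[-L, L]\<close> leaves the limit there unchanged and makes the approximations uniformly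
    bounded, as dominated convergence requires.\<close>
  define \<beta> where "\<beta> n z = max (- C) (min C (g n z))" for n z
  have \<beta>_cont: "continuous_on UNIV (\<beta> n)" for n unfolding \<beta>_def[abs_def] by (intro continuous_intros g)
  have \<beta>_bound: "\<bar>\<beta> n z\<bar> \<le> C" for n z using C(1) by (auto simp: \<beta>_def)
  have \<beta>_lim: "AE z in lborel. -L \<le> z \<longrightarrow> z \<le> L \<longrightarrow> (\<lambda>n. \<beta> n z) \<longlonglongrightarrow> ?\<beta> z"
    using g(2)
  proof eventually_elim
    case (elim z)
    show ?case
    proof (intro impI)
      assume "-L \<le> z" "z \<le> L"
      then have "- C \<le> ?\<beta> z" "?\<beta> z \<le> C" using C(2)[of z] by linarith+
      then have "?\<beta> z = max (- C) (min C (?\<beta> z))" by (simp only: max_absorb2 min_absorb2)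
      moreover have "(\<lambda>n. \<beta> n z) \<longlonglongrightarrow> max (- C) (min C (?\<beta> z))"
        unfolding \<beta>_def by (intro tendsto_intros elim)
      ultimately show "(\<lambda>n. \<beta> n z) \<longlonglongrightarrow> ?\<beta> z" by simp
    qed
  qed
  define Bn where "Bn n z = 2 * primitive 0 (\<beta> n) z" for n z
  have dBn: "(Bn n has_real_derivative 2 * \<beta> n z) (at z)" for n z
    unfolding Bn_def[abs_def] by (intro DERIV_cmult DERIV_primitive \<beta>_cont)
  have Bn_cont: "continuous_on UNIV (Bn n)" for n using DERIV_isCont[OF dBn] by (auto intro: continuous_at_imp_continuous_on)
  have Bn_bound: "\<bar>Bn n z\<bar> \<le> 2 * C * L" if "-L \<le> z" "z \<le> L" for n z
  proof -
    have "\<bar>primitive 0 (\<beta> n) z\<bar> \<le> C * \<bar>z - 0\<bar>"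
      by (rule primitive_bound) (use \<beta>_bound borel_measurable_continuous_onI[OF \<beta>_cont] in auto)
    also have "\<dots> \<le> C * L" using that C(1) by (intro mult_left_mono) auto
    finally show ?thesis by (simp add: Bn_def abs_mult)
  qed
  have Bn_lim: "(\<lambda>n. Bn n z) \<longlonglongrightarrow> B z" if "-L \<le> z" "z \<le> L" for z
    unfolding Bn_def drift_exponent_eq
  proof (intro tendsto_mult tendsto_const primitive_tendsto)
    show "\<beta> n \<in> borel_measurable borel" for n by (rule borel_measurable_continuous_onI[OF \<beta>_cont])
    show "?\<beta> \<in> borel_measurable borel" by (rule ratio_measurable)
    show "\<bar>\<beta> n t\<bar> \<le> C" for n t by (rule \<beta>_bound)
    show "AE t in lborel. min 0 z \<le> t \<longrightarrow> t \<le> max 0 z \<longrightarrow> (\<lambda>n. \<beta> n t) \<longlonglongrightarrow> ?\<beta> t"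
      using \<beta>_lim by eventually_elim (use that L in auto)
  qed
  define M where "M = exp (2 * C * L)"
  have eBn: "exp (- Bn n z) \<le> M" if "-L \<le> z" "z \<le> L" for n z
    unfolding M_def using Bn_bound[OF that, of n] by simp
  \<comment> \<open>\<open>Fn\<close> is \<open>F\<close> with \<open>b / a\<close> replaced by \<open>\<beta> n\<close>\<close>
  define F1 where "F1 n z = exp (- Bn n z) * h z" for n z
  define F2 where "F2 n z = exp (- Bn n z) * (- 2 * speed z * q z - 2 * \<beta> n z * h z)" for n z
  define Fn where "Fn n = primitive (- R) (F1 n)" for n
  have dF1: "(F1 n has_real_derivative F2 n z) (at z)" for n z
  proof -
    have "((\<lambda>z. exp (- Bn n z) * h z) has_real_derivative
        exp (- Bn n z) * (- (2 * \<beta> n z)) * h z + (- 2 * speed z * q z) * exp (- Bn n z)) (at z)"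
      by (intro DERIV_mult h DERIV_chain2[OF DERIV_exp] DERIV_minus dBn)
    moreover have "exp (- Bn n z) * (- (2 * \<beta> n z)) * h z + (- 2 * speed z * q z) * exp (- Bn n z) = F2 n z"
      by (simp add: F2_def algebra_simps)
    ultimately show ?thesis unfolding F1_def[abs_def] by (simp only:)
  qed
  have F1_cont: "continuous_on UNIV (F1 n)" for n using DERIV_isCont[OF dF1] by (auto intro: continuous_at_imp_continuous_on)
  have F2_cont: "continuous_on UNIV (F2 n)" for n
    unfolding F2_def[abs_def] by (intro continuous_intros Bn_cont continuous_speed q \<beta>_cont h_cont)
  have dFn: "(Fn n has_real_derivative F1 n z) (at z)" for n z
    unfolding Fn_def by (rule DERIV_primitive[OF F1_cont])
  have Fn_cont: "continuous_on UNIV (Fn n)" for n using DERIV_isCont[OF dFn] by (auto intro: continuous_at_imp_continuous_on)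
  have Fn_zero: "Fn n z = 0" if "z \<le> - R" for n z
  proof -
    have "\<bar>Fn n z\<bar> \<le> 0 * \<bar>z - - R\<bar>" unfolding Fn_def
      by (rule primitive_bound[OF borel_measurable_continuous_onI[OF F1_cont]]) (use that zero in \<open>auto simp: F1_def\<close>)
    then show ?thesis by simp
  qed
  have F1_bound: "\<bar>F1 n z\<bar> \<le> M * H" if "-L \<le> z" "z \<le> L" for n z
    unfolding F1_def abs_mult using eBn[OF that, of n] H that by (intro mult_mono) (auto simp: M_def)
  have Fn_bound: "\<bar>Fn n z\<bar> \<le> M * H * (2 * L)" if "-L \<le> z" "z \<le> L" for n z
  proof -
    have "\<bar>Fn n z\<bar> \<le> (M * H) * \<bar>z - - R\<bar>" unfolding Fn_def
      by (rule primitive_bound[OF borel_measurable_continuous_onI[OF F1_cont]]) (use that L R F1_bound in auto)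
    also have "\<dots> \<le> M * H * (2 * L)" using that H(1) R L by (intro mult_left_mono) (auto simp: M_def)
    finally show ?thesis .
  qed
  \<comment> \<open>\<open>F\<close> and all \<open>Fn\<close> start from 0 at \<open>- R\<close>,
    so their convergence reduces to that of the integrands.\<close>
  have F_eq: "F z = primitive (- R) (\<lambda>t. scale_deriv t * h t) z" for z
  proof -
    have "primitive (- R) (\<lambda>t. scale_deriv t * h t) z = F z - F (- R)"
      by (intro primitive_unique F continuous_intros continuous_scale_deriv h_cont)
    then show ?thesis using zero[of "- R"] by simp
  qed
  have Fn_lim: "(\<lambda>n. Fn n z) \<longlonglongrightarrow> F z" if "-L \<le> z" "z \<le> L" for z
    unfolding Fn_def F_eq
  proof (rule primitive_tendsto[where C = "M * H"])
    show "F1 n \<in> borel_measurable borel" for n by (rule borel_measurable_continuous_onI[OF F1_cont])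
    show "(\<lambda>t. scale_deriv t * h t) \<in> borel_measurable borel"
      by (intro borel_measurable_continuous_onI continuous_intros continuous_scale_deriv h_cont)
    show "\<bar>F1 n t\<bar> \<le> M * H" if "min (- R) z \<le> t" "t \<le> max (- R) z" for n t
      using that \<open>-L \<le> z\<close> \<open>z \<le> L\<close> R L by (intro F1_bound) auto
    show "AE t in lborel. min (- R) z \<le> t \<longrightarrow> t \<le> max (- R) z \<longrightarrow>
        (\<lambda>n. F1 n t) \<longlonglongrightarrow> scale_deriv t * h t"
      unfolding F1_def scale_deriv_def
      using that R L by (intro AE_I2 impI tendsto_intros Bn_lim) auto
  qed
  define G where "G = (\<lambda>n z. 1 / 2 * a z * (\<kappa>2 z * Fn n z + 2 * \<kappa>1 z * F1 n z + \<kappa> z * F2 n z)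
    + b z * (\<kappa>1 z * Fn n z + \<kappa> z * F1 n z))"
  have dyn1: "(\<integral>z. \<kappa> z * Fn n z \<partial>\<rho>) = \<kappa> x * Fn n x + (\<integral>z. G n z \<partial>Oc)" for n
    unfolding G_def by (rule dynkin_cutoff(1)[OF \<kappa>(1,2,3) _ dFn dF1 F2_cont, of L]) (rule \<kappa>0)
  have [measurable]: "G n \<in> borel_measurable borel" for n
    unfolding G_def by (rule dynkin_cutoff(2)[OF \<kappa>(1,2,3) _ dFn dF1 F2_cont, of L]) (rule \<kappa>0)
  have \<kappa>F_lim: "(\<lambda>n. \<kappa> z * Fn n z) \<longlonglongrightarrow> \<kappa> z * F z" for z
    using \<kappa>0[of z] Fn_lim[of z] by (cases "L < \<bar>z\<bar>") (auto intro!: tendsto_mult_left)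
  have \<kappa>F_bound: "\<bar>\<kappa> z * Fn n z\<bar> \<le> k0 * (M * H * (2 * L))" for n z
  proof (cases "L < \<bar>z\<bar>")
    case True
    then show ?thesis using \<kappa>0 k0 H L by (simp add: M_def)
  next
    case False
    then have "-L \<le> z" "z \<le> L" by auto
    then show ?thesis unfolding abs_mult using k0 Fn_bound by (intro mult_mono) auto
  qed
  have lim1: "(\<lambda>n. \<integral>z. \<kappa> z * Fn n z \<partial>\<rho>) \<longlonglongrightarrow> (\<integral>z. \<kappa> z * F z \<partial>\<rho>)"
    by (rule integral_dominated_convergence[where w = "\<lambda>_. k0 * (M * H * (2 * L))"])
      (use \<kappa>F_lim \<kappa>F_bound borel_measurable_continuous_onI[OF Fn_cont] in auto)
  have \<kappa>F: "\<kappa> z * F z = F z" if "z \<le> y" for z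
    using that zero[of z] \<kappa>_one[of z] R by (cases "z \<le> - R") auto
  have \<rho>_eq: "(\<integral>z. \<kappa> z * F z \<partial>\<rho>) = (\<integral>z. F z \<partial>\<rho>)"
    by (rule integral_cong_AE) (use \<rho>_le \<kappa>F in auto)
  \<comment> \<open>Left of \<open>- R\<close> everything vanishes, and from there up to
    \<open>y\<close> the cutoff is locally trivial. The true drift and the term with
    \<open>\<beta> n\<close> coming from \<open>F2\<close> combine into the error, and
    \<open>a * speed = exp B\<close> gives the term with \<open>q\<close>.\<close>
  have G_eq: "G n z = exp (- Bn n z) * (a z * h z * (?\<beta> z - \<beta> n z)) - exp (B z - Bn n z) * q z" if "z \<le> y" for n z
  proof (cases "z \<le> - R")
    case True
    then show ?thesis using zero[OF True] Fn_zero[OF True] by (simp add: G_def F1_def F2_def)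
  next
    case False
    then have "\<kappa> z = 1 \<and> \<kappa>1 z = 0 \<and> \<kappa>2 z = 0" using that R by (intro \<kappa>_one) auto
    moreover have "a z \<noteq> 0" using a_pos[of z] by simp
    ultimately show ?thesis
      by (simp add: G_def F1_def F2_def speed_def exp_diff exp_minus field_simps)
  qed
  have "(\<lambda>n. \<integral>z. G n z \<partial>Oc) \<longlonglongrightarrow> (\<integral>z. - q z \<partial>Oc)"
  \<comment> \<open>The first summand dominates the drift error, where
    \<open>\<bar>b / a - \<beta> n\<bar> \<le> 2 * C\<close>; the second dominates the term with
    \<open>q\<close>, as \<open>E\<close> bounds \<open>B\<close> and \<open>2 * C * L\<close>
    bounds \<open>Bn\<close>.\<close>
  proof (rule integral_dominated_convergence[where w = "\<lambda>_. M * (A * H * (2 * C)) + exp (E + 2 * C * L) * Q"])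
    \<comment> \<open>Here absolute continuity enters: \<open>\<beta> n\<close> converges only
      Lebesgue-almost everywhere, and \<open>Oc\<close> must not charge the exceptional set.\<close>
    show "AE z in Oc. (\<lambda>n. G n z) \<longlonglongrightarrow> - q z"
      using AE_Oc_if_AE_lborel[OF \<beta>_lim] Oc_le
    proof eventually_elim
      case (elim z)
      show ?case
      proof (cases "z \<le> - R")
        case True
        then have "G n z = 0" for n using G_eq[OF elim(2), of n] zero[OF True] by simp
        then show ?thesis using zero[OF True] by simp
      next
        case False
        then have z: "-L \<le> z" "z \<le> L" using elim R L by auto
        have "(\<lambda>n. exp (- Bn n z) * (a z * h z * (?\<beta> z - \<beta> n z)) - exp (B z - Bn n z) * q z)
          \<longlonglongrightarrow> exp (- B z) * (a z * h z * (?\<beta> z - ?\<beta> z)) - exp (B z - B z) * q z"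
          using elim z by (intro tendsto_intros Bn_lim) auto
        then show ?thesis using elim by (simp add: G_eq)
      qed
    qed
    show "AE z in Oc. norm (G n z) \<le> M * (A * H * (2 * C)) + exp (E + 2 * C * L) * Q" for n
      using Oc_le
    proof eventually_elim
      case (elim z)
      show ?case
      proof (cases "z \<le> - R")
        case True
        then show ?thesis using zero[OF True] elim A H C Q by (simp add: G_eq M_def)
      next
        case False
        then have z: "-L \<le> z" "z \<le> L" using elim R L by auto
        have "\<bar>?\<beta> z - \<beta> n z\<bar> \<le> 2 * C" using C(2)[OF z] \<beta>_bound[of n z] by linarith
        then have "\<bar>a z\<bar> * \<bar>h z\<bar> * \<bar>?\<beta> z - \<beta> n z\<bar> \<le> A * H * (2 * C)"
          using A H z by (intro mult_mono) auto
        then have 1: "exp (- Bn n z) * (\<bar>a z\<bar> * \<bar>h z\<bar> * \<bar>?\<beta> z - \<beta> n z\<bar>) \<le> M * (A * H * (2 * C))"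
          by (rule mult_mono[OF eBn[OF z]]) (auto simp: M_def)
        have "exp (B z - Bn n z) \<le> exp (E + 2 * C * L)" using E(2)[OF z] Bn_bound[OF z, of n] by simp
        then have 2: "exp (B z - Bn n z) * \<bar>q z\<bar> \<le> exp (E + 2 * C * L) * Q"
          using Q z by (intro mult_mono) auto
        have "norm (G n z) \<le> exp (- Bn n z) * (\<bar>a z\<bar> * \<bar>h z\<bar> * \<bar>?\<beta> z - \<beta> n z\<bar>) + exp (B z - Bn n z) * \<bar>q z\<bar>"
          unfolding G_eq[OF elim] real_norm_def by (rule order_trans[OF abs_triangle_ineq4]) (simp add: abs_mult)
        with 1 2 show ?thesis by linarith
      qed
    qed
  qed simp_all
  then have "(\<lambda>n. \<kappa> x * Fn n x + (\<integral>z. G n z \<partial>Oc)) \<longlonglongrightarrow> \<kappa> x * F x + (\<integral>z. - q z \<partial>Oc)"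
    by (intro tendsto_add \<kappa>F_lim)
  from LIMSEQ_unique[OF this lim1[unfolded dyn1]] show ?thesis
    using \<kappa>F[OF x_le] by (simp add: \<rho>_eq)
qed

end

section \<open>Expected hitting times\<close>

lemma nn_integral_primitive:
  assumes g: "continuous_on UNIV g" "\<And>t. 0 \<le> g t" and "c \<le> u"
  shows "(\<integral>\<^sup>+ t\<in>{c..u}. ennreal (g t) \<partial>lborel) = ennreal (primitive c g u)"
proof -
  have i: "set_integrable lborel {c..u} g"
    by (rule borel_integrable_atLeastAtMost'[OF continuous_on_subset[OF g(1)]]) auto
  have "(\<integral>\<^sup>+ t\<in>{c..u}. ennreal (g t) \<partial>lborel) = (\<integral>\<^sup>+ t. ennreal (indicator {c..u} t * g t) \<partial>lborel)"
    by (intro nn_integral_cong) (auto simp: indicator_def)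
  also have "\<dots> = ennreal (LBINT t. indicator {c..u} t * g t)"
    using i g(2) by (intro nn_integral_eq_integral) (auto simp: set_integrable_def)
  finally show ?thesis
    by (simp add: primitive_eq_set_integral[OF \<open>c \<le> u\<close>] set_lebesgue_integral_def)
qed

context diffusion_coefficients
begin

text \<open>\<open>Wn\<close> is the claimed value \<open>W\<close> with the speed density weighted
  by \<open>q n\<close>, and it equals \<open>F n x - F n y\<close>. Dynkin's formula compares it
  with the occupation integral of \<open>q n\<close>, which increases to the mean of the capped
  hitting time as \<open>n\<close> grows. The cap \<open>T\<close> is then sent to infinity.\<close>

lemma expected_hitting_time_right:
  assumes sol: "solves_martingale_problem a b x M X" and xy: "x < y"
    and fin: "(\<integral>\<^sup>+ z. ennreal (speed z) \<partial>lborel) < \<infinity>"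
  shows "expected_hitting_time M X y =
    2 * (\<integral>\<^sup>+ z\<in>{x..y}. ennreal (scale_deriv z) * (\<integral>\<^sup>+ w\<in>{..z}. ennreal (speed w) \<partial>lborel) \<partial>lborel)"
proof -
  interpret prob_space M using sol by (simp add: solves_martingale_problem_def)
  have Xm: "X s \<in> borel_measurable M" if "0 \<le> s" for s
    using sol that by (simp add: solves_martingale_problem_def)
  have cont: "continuous_on {0..} (\<lambda>t. X t \<omega>)" if "\<omega> \<in> space M" for \<omega>
    using sol that by (simp add: solves_martingale_problem_def)
  have [measurable]: "(\<lambda>\<omega>. hitting_time X y \<omega>) \<in> borel_measurable M"
    using hitting_time_measurable[of X M "\<lambda>_. y", OF Xm _ cont] by simp
  note [measurable] = borel_measurable_continuous_onI[OF continuous_speed]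
    borel_measurable_continuous_onI[OF continuous_scale_deriv]
  \<comment> \<open>A ramp, 0 up to \<open>- n\<close> and 1 from \<open>1 - n\<close> on:
    continuous in \<open>z\<close> and increasing in \<open>n\<close>.\<close>
  define q where "q n z = min 1 (max 0 (z + real n))" for n :: nat and z
  \<comment> \<open>Starting the primitives for \<open>h\<close> and \<open>F\<close> at
    \<open>- n\<close> makes both vanish further left, as \<open>dynkin_scale\<close> demands. The
    negative sign makes \<open>h\<close> nonpositive and hence \<open>F\<close> decreasing.\<close>
  define h where "h n z = - 2 * primitive (- real n) (\<lambda>w. speed w * q n w) z" for n :: nat and z
  define F where "F n = primitive (- real n) (\<lambda>w. scale_deriv w * h n w)" for n :: nat
  define R where "R n = max (real n) \<bar>y\<bar>" for n :: nat
  define P where "P z = (\<integral>\<^sup>+ w\<in>{..z}. ennreal (speed w) \<partial>lborel)" for z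
  define Pn where "Pn n z = (\<integral>\<^sup>+ w\<in>{..z}. ennreal (speed w * q n w) \<partial>lborel)" for n :: nat and z
  define W where "W = 2 * (\<integral>\<^sup>+ z\<in>{x..y}. ennreal (scale_deriv z) * P z \<partial>lborel)"
  define Wn where "Wn n = 2 * (\<integral>\<^sup>+ z\<in>{x..y}. ennreal (scale_deriv z) * Pn n z \<partial>lborel)" for n :: nat
  define \<sigma> where "\<sigma> T \<omega> = enn2real (min (ennreal T) (hitting_time X y \<omega>))" for T \<omega>
  have R: "0 \<le> R n" "y \<le> R n" for n by (auto simp: R_def)
  have q01: "0 \<le> q n z" "q n z \<le> 1" for n z by (auto simp: q_def)
  have q_cont: "continuous_on UNIV (q n)" for n unfolding q_def[abs_def] by (intro continuous_intros)
  have q_zero: "q n z = 0" if "z \<le> - real n" for n z using that by (simp add: q_def)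
  have q_mono: "q n z \<le> q m z" if "n \<le> m" for n m z using that by (auto simp: q_def)
  have q_one: "\<forall>\<^sub>F n in sequentially. q n z = 1" for z
  proof -
    obtain n0 :: nat where "1 - z \<le> real n0" using real_arch_simple by blast
    then show ?thesis by (intro eventually_sequentiallyI[of n0]) (auto simp: q_def)
  qed
  have [measurable]: "q n \<in> borel_measurable borel" for n by (rule borel_measurable_continuous_onI[OF q_cont])
  have sq_cont: "continuous_on UNIV (\<lambda>w. speed w * q n w)" for n by (intro continuous_intros continuous_speed q_cont)
  have sq_nonneg: "0 \<le> speed w * q n w" for n w using q01(1)[of n w] speed_pos[of w] by simp
  have primitive_zero: "primitive (- real n) g z = 0" if "z \<le> - real n" "\<And>w. w \<le> - real n \<Longrightarrow> g w = 0" "continuous_on UNIV g" for n g z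
  proof -
    have "\<bar>primitive (- real n) g z\<bar> \<le> 0 * \<bar>z - - real n\<bar>"
      by (rule primitive_bound[OF borel_measurable_continuous_onI[OF that(3)]]) (use that in auto)
    then show ?thesis by simp
  qed
  have h_zero: "h n z = 0" if "z \<le> - real n" for n z
    unfolding h_def using primitive_zero[OF that _ sq_cont] q_zero by simp
  have dh: "(h n has_real_derivative - 2 * speed z * q n z) (at z)" for n z
    unfolding h_def[abs_def] by (auto intro!: derivative_eq_intros DERIV_primitive sq_cont)
  have h_cont: "continuous_on UNIV (h n)" for n using DERIV_isCont[OF dh] by (auto intro: continuous_at_imp_continuous_on)
  have Pn_val: "Pn n z = ennreal (- h n z / 2)" for n z
  proof (cases "- real n \<le> z")
    case True
    have "Pn n z = (\<integral>\<^sup>+ w\<in>{- real n..z}. ennreal (speed w * q n w) \<partial>lborel)"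
      unfolding Pn_def by (intro nn_integral_cong) (auto simp: indicator_def q_zero)
    also have "\<dots> = ennreal (primitive (- real n) (\<lambda>w. speed w * q n w) z)"
      by (rule nn_integral_primitive[OF sq_cont sq_nonneg True])
    finally show ?thesis by (simp add: h_def)
  next
    case False
    then have "Pn n z = (\<integral>\<^sup>+ w. 0 \<partial>(lborel :: real measure))"
      unfolding Pn_def by (intro nn_integral_cong) (auto simp: indicator_def q_zero)
    then show ?thesis using False h_zero by simp
  qed
  have [measurable]: "Pn n \<in> borel_measurable borel" for n
    unfolding Pn_val[abs_def] using borel_measurable_continuous_onI[OF h_cont] by measurable
  have h_le: "h n z \<le> 0" for n z
  proof (cases "- real n \<le> z")
    case True
    have "0 \<le> primitive (- real n) (\<lambda>w. speed w * q n w) z"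
      unfolding primitive_eq_set_integral[OF True] set_lebesgue_integral_def
      by (intro integral_nonneg_AE) (use sq_nonneg in auto)
    then show ?thesis by (simp add: h_def)
  qed (simp add: h_zero)
  have sh_cont: "continuous_on UNIV (\<lambda>w. scale_deriv w * h n w)" for n by (intro continuous_intros continuous_scale_deriv h_cont)
  have dF: "(F n has_real_derivative scale_deriv z * h n z) (at z)" for n z
    unfolding F_def by (rule DERIV_primitive[OF sh_cont])
  have F_cont: "continuous_on UNIV (F n)" for n using DERIV_isCont[OF dF] by (auto intro: continuous_at_imp_continuous_on)
  note [measurable] = borel_measurable_continuous_onI[OF F_cont]
  have F_zero: "F n z = 0" if "z \<le> - real n" for n z
    unfolding F_def by (rule primitive_zero[OF that _ sh_cont]) (simp add: h_zero)
  have F_anti: "F n w \<le> F n z" if "z \<le> w" for n z w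
  proof (rule DERIV_nonpos_imp_nonincreasing[OF that], intro exI conjI)
    show "scale_deriv u * h n u \<le> 0" for u
      using scale_deriv_pos[of u] h_le[of n u] by (simp add: mult_nonneg_nonpos)
  qed (rule dF)
  have F_le: "F n z \<le> 0" for n z
    using F_zero[of "min z (- real n)" n] F_anti[of "min z (- real n)" z n] by simp
  have zero: "q n z = 0 \<and> h n z = 0 \<and> F n z = 0" if "z \<le> - R n" for n z
    using that q_zero h_zero F_zero by (simp add: R_def)
  have Pn_eq: "2 * Pn n z = ennreal (- h n z)" for n z
  proof -
    have "2 * Pn n z = ennreal (2 * (- h n z / 2))"
      unfolding Pn_val using h_le[of n z] by (subst ennreal_mult) auto
    then show ?thesis by simp
  qed
  \<comment> \<open>Since \<open>2 * Pn\<close> is \<open>- h\<close>, the integrand of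
    \<open>Wn\<close> is the derivative of \<open>- F n\<close>.\<close>
  have Wn_eq: "Wn n = ennreal (F n x - F n y)" for n
  proof -
    have "Wn n = (\<integral>\<^sup>+ z. 2 * (ennreal (scale_deriv z) * Pn n z * indicator {x..y} z) \<partial>lborel)"
      unfolding Wn_def
    proof (rule nn_integral_cmult[symmetric])
      show "(\<lambda>z. ennreal (scale_deriv z) * Pn n z * indicator {x..y} z) \<in> borel_measurable lborel"
        by measurable
    qed
    also have "\<dots> = (\<integral>\<^sup>+ z\<in>{x..y}. ennreal (scale_deriv z * - h n z) \<partial>lborel)"
    proof (intro nn_integral_cong)
      fix z
      have "2 * (ennreal (scale_deriv z) * Pn n z * indicator {x..y} z) = ennreal (scale_deriv z) * (2 * Pn n z) * indicator {x..y} z"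
        by (simp add: ac_simps)
      also have "\<dots> = ennreal (scale_deriv z * - h n z) * indicator {x..y} z"
        unfolding Pn_eq using scale_deriv_pos[of z] h_le[of n z] by (subst ennreal_mult) auto
      finally show "2 * (ennreal (scale_deriv z) * Pn n z * indicator {x..y} z) = ennreal (scale_deriv z * - h n z) * indicator {x..y} z" .
    qed
    also have "\<dots> = ennreal (primitive x (\<lambda>z. scale_deriv z * - h n z) y)"
      using scale_deriv_pos h_le xy
      by (intro nn_integral_primitive continuous_intros continuous_scale_deriv h_cont mult_nonneg_nonneg) (auto intro: less_imp_le)
    also have "primitive x (\<lambda>z. scale_deriv z * - h n z) y = - F n y - - F n x"
    proof (rule primitive_unique)
      show "((\<lambda>z. - F n z) has_real_derivative scale_deriv z * - h n z) (at z)" for z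
        by (auto intro!: derivative_eq_intros dF)
    qed (intro continuous_intros continuous_scale_deriv h_cont)
    finally show ?thesis by simp
  qed
  have Pn_lim: "(\<lambda>n. Pn n z) \<longlonglongrightarrow> P z" for z
    unfolding Pn_def P_def
  proof (rule nn_integral_LIMSEQ)
    show "incseq (\<lambda>n w. ennreal (speed w * q n w) * indicator {..z} w)"
      by (intro monoI le_funI mult_right_mono ennreal_leI mult_left_mono q_mono) (auto intro: less_imp_le speed_pos)
    show "(\<lambda>n. ennreal (speed w * q n w) * indicator {..z} w) \<longlonglongrightarrow> ennreal (speed w) * indicator {..z} w" for w
      by (rule tendsto_eventually, use q_one[of w] in eventually_elim) simp
  qed measurable
  have Pn_mono: "Pn n z \<le> Pn m z" if "n \<le> m" for n m z
    unfolding Pn_def using that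
    by (intro nn_integral_mono mult_right_mono ennreal_leI mult_left_mono q_mono) (auto intro: less_imp_le speed_pos)
  have Wn_lim: "Wn \<longlonglongrightarrow> W"
    unfolding Wn_def[abs_def] W_def
  proof (rule ennreal_tendsto_cmult)
    show "(\<lambda>n. \<integral>\<^sup>+ z\<in>{x..y}. ennreal (scale_deriv z) * Pn n z \<partial>lborel) \<longlonglongrightarrow>
      (\<integral>\<^sup>+ z\<in>{x..y}. ennreal (scale_deriv z) * P z \<partial>lborel)"
    proof (rule nn_integral_LIMSEQ)
      show "incseq (\<lambda>n z. ennreal (scale_deriv z) * Pn n z * indicator {x..y} z)"
        by (intro monoI le_funI mult_right_mono mult_left_mono Pn_mono) auto
      show "(\<lambda>n. ennreal (scale_deriv z) * Pn n z * indicator {x..y} z) \<longlonglongrightarrow> ennreal (scale_deriv z) * P z * indicator {x..y} z" for z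
        using ennreal_tendsto_cmult[OF _ Pn_lim[of z], of "ennreal (scale_deriv z)"] by (cases "z \<in> {x..y}") auto
    qed measurable
  qed simp
  have Wn_le: "Wn n \<le> W" for n
    unfolding Wn_def W_def P_def Pn_def using q01(2) speed_pos less_imp_le
    by (intro mult_left_mono nn_integral_mono mult_right_mono ennreal_leI) (auto intro: mult_left_le)
  \<comment> \<open>The inner mass is at most the total speed mass, which is finite by positive
    recurrence; what remains is a continuous function integrated over \<open>[x, y]\<close>.\<close>
  have W_fin: "W < \<infinity>"
  proof -
    have "W \<le> 2 * (\<integral>\<^sup>+ z\<in>{x..y}. ennreal (scale_deriv z) * (\<integral>\<^sup>+ z. ennreal (speed z) \<partial>lborel) \<partial>lborel)"
      unfolding W_def P_def by (intro mult_left_mono nn_integral_mono mult_right_mono) (auto simp: indicator_def)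
    also have "\<dots> = 2 * ((\<integral>\<^sup>+ z\<in>{x..y}. ennreal (scale_deriv z) \<partial>lborel) * (\<integral>\<^sup>+ z. ennreal (speed z) \<partial>lborel))"
      by (subst nn_integral_multc[symmetric]) (auto simp: ac_simps)
    also have "\<dots> = 2 * (ennreal (primitive x scale_deriv y) * (\<integral>\<^sup>+ z. ennreal (speed z) \<partial>lborel))"
      using xy scale_deriv_pos less_imp_le by (subst nn_integral_primitive[OF continuous_scale_deriv]) auto
    also have "\<dots> < \<infinity>" using fin by (auto simp: ennreal_mult_less_top)
    finally show ?thesis .
  qed
  have est: "(\<integral>\<^sup>+ \<omega>. min (ennreal T) (hitting_time X y \<omega>) \<partial>M) \<le> W"
      "\<And>n. ennreal (F n x - (\<integral>\<omega>. F n (X (\<sigma> T \<omega>) \<omega>) \<partial>M)) \<le> (\<integral>\<^sup>+ \<omega>. min (ennreal T) (hitting_time X y \<omega>) \<partial>M)"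
      "(\<lambda>\<omega>. X (\<sigma> T \<omega>) \<omega>) \<in> borel_measurable M" "AE \<omega> in M. X (\<sigma> T \<omega>) \<omega> \<le> y"
    if T: "0 < T" for T
  proof -
    obtain Oc where Oc: "sets Oc = sets borel"
      "emeasure Oc (space Oc) = (\<integral>\<^sup>+ \<omega>. min (ennreal T) (hitting_time X y \<omega>) \<partial>M)"
      "AE z in Oc. z \<le> y"
      and X\<sigma>: "(\<lambda>\<omega>. X (\<sigma> T \<omega>) \<omega>) \<in> borel_measurable M" "AE \<omega> in M. X (\<sigma> T \<omega>) \<omega> \<le> y"
      and dyn: "\<And>f. C2_compact_support f \<Longrightarrow>
        (\<integral>\<omega>. f (X (\<sigma> T \<omega>) \<omega>) \<partial>M) = f x + (\<integral>z. generator a b f z \<partial>Oc)"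
      unfolding \<sigma>_def by (rule occupation_measure[OF sol xy T]) blast
    show "(\<lambda>\<omega>. X (\<sigma> T \<omega>) \<omega>) \<in> borel_measurable M" "AE \<omega> in M. X (\<sigma> T \<omega>) \<omega> \<le> y" by fact+
    have mass: "emeasure Oc (space Oc) < \<infinity>"
    proof -
      have "emeasure Oc (space Oc) \<le> (\<integral>\<^sup>+ \<omega>. ennreal T \<partial>M)" unfolding Oc(2) by (intro nn_integral_mono) simp
      also have "\<dots> < \<infinity>" by (simp add: emeasure_space_1 ennreal_mult_less_top)
      finally show ?thesis .
    qed
    let ?\<rho> = "distr M borel (\<lambda>\<omega>. X (\<sigma> T \<omega>) \<omega>)"
    note X\<sigma>(1)[measurable] Oc(1)[measurable_cong]
    interpret dynkin_pair a b x y Oc ?\<rho>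
    proof (intro dynkin_pair.intro dynkin_pair_axioms.intro)
      show "diffusion_coefficients a b" by (rule diffusion_coefficients_axioms)
      show "finite_measure Oc" using mass by (intro finite_measureI) simp
      show "prob_space ?\<rho>" by (rule prob_space_distr[OF X\<sigma>(1)])
      show "AE z in ?\<rho>. z \<le> y" using X\<sigma>(2) by (subst AE_distr_iff) auto
      show "(\<integral>z. f z \<partial>?\<rho>) = f x + (\<integral>z. generator a b f z \<partial>Oc)" if f: "C2_compact_support f" for f
      proof -
        have [measurable]: "f \<in> borel_measurable borel"
          using C2_compact_supportE[OF f] borel_measurable_continuous_onI by metis
        show ?thesis using dyn[OF f] by (subst integral_distr) auto
      qed
    qed (use Oc xy in auto)
    have key: "(\<integral>\<omega>. F n (X (\<sigma> T \<omega>) \<omega>) \<partial>M) = F n x - (\<integral>z. q n z \<partial>Oc)" for n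
      using dynkin_scale[OF q_cont dh dF zero R] by (subst (asm) integral_distr) auto
    have q_nn: "(\<integral>\<^sup>+ z. ennreal (q n z) \<partial>Oc) = ennreal (\<integral>z. q n z \<partial>Oc)" for n
      by (intro nn_integral_eq_integral Oc.integrable_const_bound[where B = 1]) (use q01 in auto)
    show "ennreal (F n x - (\<integral>\<omega>. F n (X (\<sigma> T \<omega>) \<omega>) \<partial>M)) \<le> (\<integral>\<^sup>+ \<omega>. min (ennreal T) (hitting_time X y \<omega>) \<partial>M)" for n
    proof -
      have "ennreal (F n x - (\<integral>\<omega>. F n (X (\<sigma> T \<omega>) \<omega>) \<partial>M)) = (\<integral>\<^sup>+ z. ennreal (q n z) \<partial>Oc)"
        by (simp add: key q_nn)
      also have "\<dots> \<le> (\<integral>\<^sup>+ z. 1 \<partial>Oc)" using q01 by (intro nn_integral_mono) (simp add: ennreal_le_1)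
      finally show ?thesis by (simp add: Oc(2))
    qed
    have "(\<integral>\<^sup>+ z. ennreal (q n z) \<partial>Oc) \<le> W" for n
    proof -
      have int: "integrable M (\<lambda>\<omega>. F n (X (\<sigma> T \<omega>) \<omega>))"
      proof (rule integrable_const_bound[where B = "- F n y"])
        show "AE \<omega> in M. norm (F n (X (\<sigma> T \<omega>) \<omega>)) \<le> - F n y"
          using X\<sigma>(2) by eventually_elim (use F_anti F_le in auto)
      qed measurable
      \<comment> \<open>The stopped position is at most \<open>y\<close> and \<open>F n\<close>
        decreases, so \<open>F n y\<close> is a lower bound even on paths that have not reached
        \<open>y\<close> by time \<open>T\<close>.\<close>
      have "F n y = (\<integral>\<omega>. F n y \<partial>M)" by (simp add: prob_space)
      also have "\<dots> \<le> (\<integral>\<omega>. F n (X (\<sigma> T \<omega>) \<omega>) \<partial>M)"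
        by (rule integral_mono_AE[OF _ int]) (use X\<sigma>(2) F_anti in auto)
      finally have "(\<integral>z. q n z \<partial>Oc) \<le> F n x - F n y" using key[of n] by simp
      then have "ennreal (\<integral>z. q n z \<partial>Oc) \<le> Wn n" unfolding Wn_eq by (rule ennreal_leI)
      also have "\<dots> \<le> W" by (rule Wn_le)
      finally show ?thesis by (simp add: q_nn)
    qed
    moreover have "(\<lambda>n. \<integral>\<^sup>+ z. ennreal (q n z) \<partial>Oc) \<longlonglongrightarrow> (\<integral>\<^sup>+ z. 1 \<partial>Oc)"
    proof (rule nn_integral_LIMSEQ)
      show "incseq (\<lambda>n z. ennreal (q n z))" by (intro monoI le_funI ennreal_leI q_mono)
      show "(\<lambda>n. ennreal (q n z)) \<longlonglongrightarrow> 1" for z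
        by (rule tendsto_eventually, use q_one[of z] in eventually_elim) simp
    qed simp
    ultimately have "(\<integral>\<^sup>+ z. 1 \<partial>Oc) \<le> W" by (intro LIMSEQ_le_const2) auto
    then show "(\<integral>\<^sup>+ \<omega>. min (ennreal T) (hitting_time X y \<omega>) \<partial>M) \<le> W" by (simp add: Oc(2))
  qed
  \<comment> \<open>The caps run through \<open>Suc m\<close> because \<open>est\<close> is stated
    for positive times.\<close>
  have Tpos: "0 < real (Suc m)" for m by simp
  have upper: "(\<integral>\<^sup>+ \<omega>. hitting_time X y \<omega> \<partial>M) \<le> W"
  proof -
    have "(\<lambda>m. \<integral>\<^sup>+ \<omega>. min (ennreal (real (Suc m))) (hitting_time X y \<omega>) \<partial>M) \<longlonglongrightarrow> (\<integral>\<^sup>+ \<omega>. hitting_time X y \<omega> \<partial>M)"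
    proof (rule nn_integral_LIMSEQ)
      show "incseq (\<lambda>m \<omega>. min (ennreal (real (Suc m))) (hitting_time X y \<omega>))"
        by (intro monoI le_funI min.mono ennreal_leI) auto
      fix \<omega>
      have "(\<lambda>m. ennreal (real (Suc m))) \<longlonglongrightarrow> \<infinity>"
        by (intro LIMSEQ_Suc[where f = "\<lambda>m. ennreal (real m)"]) (simp add: ennreal_of_nat_eq_real_of_nat[symmetric] of_nat_tendsto_top_ennreal)
      then have "(\<lambda>m. min (ennreal (real (Suc m))) (hitting_time X y \<omega>)) \<longlonglongrightarrow> min \<infinity> (hitting_time X y \<omega>)"
        by (intro tendsto_min tendsto_const)
      then show "(\<lambda>m. min (ennreal (real (Suc m))) (hitting_time X y \<omega>)) \<longlonglongrightarrow> hitting_time X y \<omega>"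
        by (simp only: min_absorb2 top_greatest infinity_ennreal_def)
    qed measurable
    then show ?thesis by (rule LIMSEQ_le_const2) (intro exI[of _ 0] allI impI est(1) Tpos)
  qed
  \<comment> \<open>A hitting time with finite mean is almost surely finite, so \<open>y\<close> is
    reached; the lower bound depends on this.\<close>
  have finite_AE: "AE \<omega> in M. hitting_time X y \<omega> \<noteq> \<infinity>"
    using upper W_fin by (intro nn_integral_PInf_AE) (auto simp: less_top[symmetric] top_unique)
  have lower: "Wn n \<le> (\<integral>\<^sup>+ \<omega>. hitting_time X y \<omega> \<partial>M)" for n
  proof -
    \<comment> \<open>On \<open>(-\<infinity>, y]\<close> the function \<open>F n\<close> takes
      values between \<open>F n y\<close> and 0, which supplies the dominating constant. On almost
      every path the stopped position is \<open>y\<close> from some cap on.\<close>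
    have "(\<lambda>m. \<integral>\<omega>. F n (X (\<sigma> (real (Suc m)) \<omega>) \<omega>) \<partial>M) \<longlonglongrightarrow> (\<integral>\<omega>. F n y \<partial>M)"
    proof (rule integral_dominated_convergence[where w = "\<lambda>_. - F n y"])
      show "AE \<omega> in M. norm (F n (X (\<sigma> (real (Suc m)) \<omega>) \<omega>)) \<le> - F n y" for m
        using est(4)[OF Tpos] by eventually_elim (use F_anti F_le in auto)
      show "(\<lambda>\<omega>. F n (X (\<sigma> (real (Suc m)) \<omega>) \<omega>)) \<in> borel_measurable M" for m
        by (rule measurable_compose[OF est(3)[OF Tpos]]) auto
      show "AE \<omega> in M. (\<lambda>m. F n (X (\<sigma> (real (Suc m)) \<omega>) \<omega>)) \<longlonglongrightarrow> F n y"
        using finite_AE AE_space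
      proof eventually_elim
        case (elim \<omega>)
        from cont[OF elim(2)] obtain r where r: "0 \<le> r" "X r \<omega> = y" "hitting_time X y \<omega> = ennreal r"
          by (cases rule: hitting_time_cases[where y = y]) (use elim in auto)
        obtain m0 :: nat where m0: "r \<le> real m0" using real_arch_simple by blast
        have "F n (X (\<sigma> (real (Suc m)) \<omega>) \<omega>) = F n y" if "m0 \<le> m" for m
        proof -
          have "r \<le> real (Suc m)" using m0 that by simp
          then have "\<sigma> (real (Suc m)) \<omega> = r" unfolding \<sigma>_def r(3) using r(1) by (simp add: min_absorb2 ennreal_leI del: of_nat_Suc)
          then show ?thesis using r by simp
        qed
        then show ?case by (intro tendsto_eventually eventually_sequentiallyI[of m0])
      qed
    qed simp_all
    then have "(\<lambda>m. ennreal (F n x - (\<integral>\<omega>. F n (X (\<sigma> (real (Suc m)) \<omega>) \<omega>) \<partial>M))) \<longlonglongrightarrow> ennreal (F n x - F n y)"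
      by (intro tendsto_ennrealI tendsto_diff tendsto_const) (simp add: prob_space)
    moreover have "ennreal (F n x - (\<integral>\<omega>. F n (X (\<sigma> (real (Suc m)) \<omega>) \<omega>) \<partial>M)) \<le> (\<integral>\<^sup>+ \<omega>. hitting_time X y \<omega> \<partial>M)" for m
      by (rule order_trans[OF est(2)[OF Tpos] nn_integral_mono]) auto
    ultimately show ?thesis unfolding Wn_eq by (intro LIMSEQ_le_const2) blast+
  qed
  have "W \<le> (\<integral>\<^sup>+ \<omega>. hitting_time X y \<omega> \<partial>M)" using Wn_lim lower by (intro LIMSEQ_le_const2) auto
  with upper have "(\<integral>\<^sup>+ \<omega>. hitting_time X y \<omega> \<partial>M) = W" by (rule antisym)
  then show ?thesis by (simp add: expected_hitting_time_def W_def P_def)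
qed

end

section \<open>Reflection of the line, and targets to the left of the starting point\<close>

lemma C2_compact_support_reflect:
  assumes "C2_compact_support f"
  shows "C2_compact_support (\<lambda>z. f (- z))"
    and "generator a b (\<lambda>z. f (- z)) z = generator (\<lambda>z. a (- z)) (\<lambda>z. - b (- z)) f (- z)"
proof -
  obtain R where R: "\<And>x. R < \<bar>x\<bar> \<Longrightarrow> f x = 0 \<and> deriv f x = 0 \<and> deriv (deriv f) x = 0"
    and d: "\<And>x. (f has_real_derivative deriv f x) (at x)"
    "\<And>x. (deriv f has_real_derivative deriv (deriv f) x) (at x)"
    and c: "continuous_on UNIV (deriv (deriv f))"
    using C2_compact_supportE[OF assms] by metis
  have d1: "((\<lambda>z. f (- z)) has_real_derivative - deriv f (- z)) (at z)" for z
    using DERIV_chain2[OF d(1) DERIV_minus[OF DERIV_ident]] by simp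
  have d2: "((\<lambda>z. - deriv f (- z)) has_real_derivative deriv (deriv f) (- z)) (at z)" for z
    using DERIV_minus[OF DERIV_chain2[OF d(2) DERIV_minus[OF DERIV_ident]]] by simp
  have c2: "continuous_on UNIV (\<lambda>z. deriv (deriv f) (- z))"
    by (intro continuous_on_compose2[OF c] continuous_intros) auto
  show "C2_compact_support (\<lambda>z. f (- z))"
    by (rule C2_compact_supportI(1)[OF d1 d2 c2, of R]) (use R in auto)
  have "generator a b (\<lambda>z. f (- z)) z = 1 / 2 * a z * deriv (deriv f) (- z) + b z * - deriv f (- z)"
    by (rule C2_compact_supportI(2)[OF d1 d2 c2, of R]) (use R in auto)
  then show "generator a b (\<lambda>z. f (- z)) z = generator (\<lambda>z. a (- z)) (\<lambda>z. - b (- z)) f (- z)"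
    by (simp add: generator_def)
qed

lemma natural_filtration_reflect:
  "natural_filtration M (\<lambda>t \<omega>. - X t \<omega>) = natural_filtration M X"
proof
  fix t :: real
  have "{(\<lambda>\<omega>. - X s \<omega>) -` A \<inter> space M | s A. 0 \<le> s \<and> s \<le> t \<and> A \<in> sets borel}
    = {X s -` A \<inter> space M | s A. 0 \<le> s \<and> s \<le> t \<and> A \<in> sets borel}" (is "?L = ?R")
  proof -
    have refl: "uminus -` A \<in> sets borel" if "A \<in> sets borel" for A :: "real set"
      using measurable_sets[OF borel_measurable_uminus[OF measurable_ident] that] by simp
    have 1: "(\<lambda>\<omega>. - X s \<omega>) -` A \<inter> space M = X s -` (uminus -` A) \<inter> space M" for s A by auto
    have 2: "X s -` A \<inter> space M = (\<lambda>\<omega>. - X s \<omega>) -` (uminus -` A) \<inter> space M" for s A by auto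
    show ?thesis
    proof (intro equalityI subsetI)
      fix S assume "S \<in> ?L"
      then obtain s A where S: "S = (\<lambda>\<omega>. - X s \<omega>) -` A \<inter> space M" "0 \<le> s" "s \<le> t" "A \<in> sets borel" by auto
      show "S \<in> ?R" using S(2-3) refl[OF S(4)] unfolding S(1) 1 by blast
    next
      fix S assume "S \<in> ?R"
      then obtain s A where S: "S = X s -` A \<inter> space M" "0 \<le> s" "s \<le> t" "A \<in> sets borel" by auto
      show "S \<in> ?L" using S(2-3) refl[OF S(4)] unfolding S(1) 2 by blast
    qed
  qed
  then show "natural_filtration M (\<lambda>t \<omega>. - X t \<omega>) t = natural_filtration M X t"
    by (simp add: natural_filtration_def)
qed

text \<open>Reflecting a test function changes the sign of its first derivative only. This is why
  the drift coefficient changes sign and the diffusion coefficient does not.\<close>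

lemma solves_martingale_problem_reflect:
  assumes "solves_martingale_problem a b x M X"
  shows "solves_martingale_problem (\<lambda>z. a (- z)) (\<lambda>z. - b (- z)) (- x) M (\<lambda>t \<omega>. - X t \<omega>)"
  unfolding solves_martingale_problem_def natural_filtration_reflect
proof (intro conjI allI impI ballI)
  note sol = assms[unfolded solves_martingale_problem_def]
  show "prob_space M" using sol by blast
  show "(\<lambda>\<omega>. - X t \<omega>) \<in> borel_measurable M" if "0 \<le> t" for t
    using sol that by (intro borel_measurable_uminus) blast
  show "continuous_on {0..} (\<lambda>t. - X t \<omega>)" if "\<omega> \<in> space M" for \<omega>
    using sol that by (intro continuous_on_minus) blast
  show "AE \<omega> in M. - X 0 \<omega> = - x" using sol by simp
  fix f assume f: "C2_compact_support f"
  show "martingale M (natural_filtration M X) (\<lambda>t \<omega>. f (- X t \<omega>) -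
      (LBINT s:{0..t}. generator (\<lambda>z. a (- z)) (\<lambda>z. - b (- z)) f (- X s \<omega>)))"
    unfolding C2_compact_support_reflect(2)[OF f, of a b, symmetric]
    using sol C2_compact_support_reflect(1)[OF f] by blast
qed

lemma hitting_time_reflect: "hitting_time (\<lambda>t \<omega>. - X t \<omega>) (- y) = hitting_time X y"
  by (simp add: hitting_time_def fun_eq_iff)

text \<open>The sign of the reflected drift cancels against the sign from the substitution, so speed
  density and scale derivative are simply reflected.\<close>

lemma drift_exponent_reflect:
  "drift_exponent (\<lambda>z. a (- z)) (\<lambda>z. - b (- z)) z = drift_exponent a b (- z)"
proof -
  have "(LBINT t=ereal 0..ereal z. - b (- t) / a (- t)) = (LBINT t=ereal (- z)..ereal 0. - (b t / a t))"
    by (subst interval_integral_reflect) simp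
  also have "\<dots> = (LBINT t=ereal 0..ereal (- z). b t / a t)"
    by (subst interval_integral_endpoints_reverse) (simp add: interval_lebesgue_integral_uminus)
  finally show ?thesis by (simp add: drift_exponent_def)
qed

lemma nn_integral_reflect:
  assumes "f \<in> borel_measurable borel"
  shows "(\<integral>\<^sup>+ z. f (- z) \<partial>lborel) = (\<integral>\<^sup>+ z. f (z :: real) \<partial>lborel)"
proof -
  have "(\<integral>\<^sup>+ z. f z \<partial>lborel) = (\<integral>\<^sup>+ z. f z \<partial>distr lborel borel uminus)" by (simp add: lborel_distr_uminus)
  also have "\<dots> = (\<integral>\<^sup>+ z. f (- z) \<partial>lborel)" using assms by (subst nn_integral_distr) auto
  finally show ?thesis by simp
qed

lemma borel_measurable_nn_integral_tail:
  fixes f :: "real \<Rightarrow> ennreal"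
  assumes [measurable]: "f \<in> borel_measurable borel"
  shows "(\<lambda>z. \<integral>\<^sup>+ w\<in>{z..}. f w \<partial>lborel) \<in> borel_measurable borel"
    and "(\<lambda>z. \<integral>\<^sup>+ w\<in>{..z}. f w \<partial>lborel) \<in> borel_measurable borel"
  \<comment> \<open>Written as a comparison of \<open>z\<close> with \<open>w\<close>, the indicator
    is jointly measurable, and so its integral over \<open>w\<close> is measurable in
    \<open>z\<close>.\<close>
  unfolding indicator_def atLeast_iff atMost_iff by measurable

context diffusion_coefficients
begin

lemma expected_hitting_time_left:
  assumes sol: "solves_martingale_problem a b x M X" and xy: "y < x"
    and fin: "(\<integral>\<^sup>+ z. ennreal (speed z) \<partial>lborel) < \<infinity>"
  shows "expected_hitting_time M X y =
    2 * (\<integral>\<^sup>+ z\<in>{y..x}. ennreal (scale_deriv z) * (\<integral>\<^sup>+ w\<in>{z..}. ennreal (speed w) \<partial>lborel) \<partial>lborel)"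
proof -
  let ?a = "\<lambda>z. a (- z)" and ?b = "\<lambda>z. - b (- z)"
  interpret r: diffusion_coefficients ?a ?b
  proof
    show "continuous_on UNIV ?a" by (intro continuous_on_compose2[OF a_cont] continuous_intros) auto
    show "0 < ?a x" for x by (rule a_pos)
    show "?b \<in> borel_measurable borel" by measurable
    show "bounded (?b ` K)" if "compact K" for K
    proof -
      have "?b ` K = uminus ` b ` uminus ` K" by auto
      moreover have "compact (uminus ` K)" using that by (rule compact_negations)
      ultimately show ?thesis using b_locally_bounded[of "uminus ` K"] by (simp add: bounded_uminus del: image_image)
    qed
  qed
  note [measurable] = borel_measurable_continuous_onI[OF continuous_speed]
    borel_measurable_continuous_onI[OF continuous_scale_deriv]
  have [measurable]: "(\<lambda>z. \<integral>\<^sup>+ w\<in>{z..}. ennreal (speed w) \<partial>lborel) \<in> borel_measurable borel"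
    by (rule borel_measurable_nn_integral_tail) measurable
  have sp: "r.speed z = speed (- z)" for z by (simp add: r.speed_def speed_def drift_exponent_reflect)
  have sc: "r.scale_deriv z = scale_deriv (- z)" for z
    by (simp add: r.scale_deriv_def scale_deriv_def drift_exponent_reflect)
  have fin': "(\<integral>\<^sup>+ z. ennreal (r.speed z) \<partial>lborel) < \<infinity>"
    using nn_integral_reflect[of "\<lambda>z. ennreal (speed z)"] fin by (simp add: sp)
  have inner: "(\<integral>\<^sup>+ w\<in>{..z}. ennreal (r.speed w) \<partial>lborel) = (\<integral>\<^sup>+ w\<in>{- z..}. ennreal (speed w) \<partial>lborel)" for z
  proof -
    have "(\<integral>\<^sup>+ w\<in>{..z}. ennreal (r.speed w) \<partial>lborel) = (\<integral>\<^sup>+ w. ennreal (speed (- w)) * indicator {- z..} (- w) \<partial>lborel)"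
      by (intro nn_integral_cong) (auto simp: sp indicator_def)
    then show ?thesis using nn_integral_reflect[of "\<lambda>w. ennreal (speed w) * indicator {- z..} w"] by simp
  qed
  have "expected_hitting_time M X y = expected_hitting_time M (\<lambda>t \<omega>. - X t \<omega>) (- y)"
    by (simp add: expected_hitting_time_def hitting_time_reflect)
  also have "\<dots> = 2 * (\<integral>\<^sup>+ z\<in>{- x..- y}. ennreal (r.scale_deriv z) *
      (\<integral>\<^sup>+ w\<in>{..z}. ennreal (r.speed w) \<partial>lborel) \<partial>lborel)"
    using xy by (intro r.expected_hitting_time_right solves_martingale_problem_reflect[OF sol] fin') auto
  also have "(\<integral>\<^sup>+ z\<in>{- x..- y}. ennreal (r.scale_deriv z) * (\<integral>\<^sup>+ w\<in>{..z}. ennreal (r.speed w) \<partial>lborel) \<partial>lborel)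
    = (\<integral>\<^sup>+ z. ennreal (scale_deriv (- z)) * (\<integral>\<^sup>+ w\<in>{- z..}. ennreal (speed w) \<partial>lborel) * indicator {y..x} (- z) \<partial>lborel)"
    unfolding sc inner by (intro nn_integral_cong) (auto simp: indicator_def)
  also have "\<dots> = (\<integral>\<^sup>+ z\<in>{y..x}. ennreal (scale_deriv z) * (\<integral>\<^sup>+ w\<in>{z..}. ennreal (speed w) \<partial>lborel) \<partial>lborel)"
    by (rule nn_integral_reflect[where f = "\<lambda>z. ennreal (scale_deriv z) * (\<integral>\<^sup>+ w\<in>{z..}. ennreal (speed w) \<partial>lborel) * indicator {y..x} z"])
      measurable
  finally show ?thesis .
qed

end

section \<open>Hitting times of a random point\<close>

text \<open>Under the joint law of target and path, the mean is an iterated integral. The hitting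
  time is not measurable for the product \<sigma>-algebra on all functions of time, so the path is
  not replaced by its law there. Instead \<open>\<omega>\<close> is kept, with its continuous path,
  and \<open>M\<close> is restricted to the \<sigma>-algebra \<open>G\<close> generated by the
  process.\<close>

lemma expected_random_hitting_time_eq:
  assumes M: "prob_space M"
    and X: "\<And>s. 0 \<le> s \<Longrightarrow> X s \<in> borel_measurable M"
    and cont: "\<And>\<omega>. \<omega> \<in> space M \<Longrightarrow> continuous_on {0..} (\<lambda>t. X t \<omega>)"
    and indep: "independent_of_process M Z X"
    and distr: "distributed M lborel Z (\<lambda>y. ennreal (\<mu> y))"
  shows "expected_random_hitting_time M X Z =
    (\<integral>\<^sup>+ y. expected_hitting_time M X y * ennreal (\<mu> y) \<partial>lborel)"
proof -
  interpret prob_space M by fact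
  let ?P = "\<Pi>\<^sub>M t\<in>{0::real..}. (borel :: real measure)"
  let ?path = "\<lambda>\<omega>. \<lambda>t\<in>{0..}. X t \<omega>"
  define G where "G = vimage_algebra (space M) ?path ?P"
  define V where "V = vimage_algebra (space M) Z (borel :: real measure)"
  have ind: "indep_set (sets V) (sets G)"
    using indep by (simp add: independent_of_process_def G_def V_def)
  have GM: "sets G \<subseteq> sets M" by (rule indep_setD_ev2[OF ind])
  have sub: "subalgebra M G" using GM by (simp add: subalgebra_def G_def)
  have spG: "space G = space M" by (simp add: G_def)
  have Xg: "X s \<in> borel_measurable G" if s: "0 \<le> s" for s
  proof -
    have "?path \<in> G \<rightarrow>\<^sub>M ?P"
      unfolding G_def by (rule measurable_vimage_algebra1) (auto simp: space_PiM)
    from measurable_compose[OF this measurable_component_singleton[of s]] show ?thesis using s by simp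
  qed
  define MG where "MG = restr_to_subalg M G"
  have sets_MG: "sets MG = sets G" unfolding MG_def by (rule sets_restr_to_subalg[OF sub])
  have space_MG: "space MG = space M" by (simp add: MG_def space_restr_to_subalg)
  have em: "emeasure MG A = emeasure M A" if "A \<in> sets G" for A
    unfolding MG_def by (rule emeasure_restr_to_subalg[OF sub that])
  have "finite_measure MG"
    using em[OF sets.top] by (intro finite_measureI) (simp add: space_MG spG emeasure_space_1)
  interpret MG: finite_measure MG by fact
  have Xmg: "X s \<in> borel_measurable MG" if "0 \<le> s" for s
    using Xg[OF that] measurable_cong_sets[OF sets_MG refl] by blast
  have Zm: "Z \<in> borel_measurable M" using distributed_measurable[OF distr] by simp
  have \<mu>m: "(\<lambda>y. ennreal (\<mu> y)) \<in> borel_measurable lborel"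
    by (rule distributed_borel_measurable[OF distr])
  define D where "D = density lborel (\<lambda>y. ennreal (\<mu> y))"
  have D: "distr M lborel Z = D" unfolding D_def by (rule distributed_distr_eq_density[OF distr])
  have "prob_space D" unfolding D[symmetric] by (rule prob_space_distr) (use Zm in simp)
  interpret D: prob_space D by fact
  define H where "H = (\<lambda>(y, \<omega>). hitting_time X y \<omega>)"
  have Hm: "H \<in> borel_measurable (D \<Otimes>\<^sub>M MG)"
  proof -
    \<comment> \<open>On the product space the target is the first coordinate and the process
      depends on the second, so this is a hitting time of a random target.\<close>
    have "(\<lambda>z. hitting_time (\<lambda>s z. X s (snd z)) (fst z) z) \<in> borel_measurable (D \<Otimes>\<^sub>M MG)"
    proof (rule hitting_time_measurable)
      show "(\<lambda>z. X s (snd z)) \<in> borel_measurable (D \<Otimes>\<^sub>M MG)" if "0 \<le> s" for s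
        by (rule measurable_compose[OF measurable_snd Xmg[OF that]])
      show "fst \<in> borel_measurable (D \<Otimes>\<^sub>M MG)"
        using measurable_fst[of D MG] by (simp add: D_def measurable_def space_pair_measure)
      show "continuous_on {0..} (\<lambda>t. X t (snd z))" if "z \<in> space (D \<Otimes>\<^sub>M MG)" for z
        using that by (intro cont) (auto simp: space_pair_measure space_MG)
    qed
    moreover have "hitting_time (\<lambda>s z. X s (snd z)) (fst z) z = H z" for z
      by (simp add: H_def hitting_time_def split_beta)
    ultimately show ?thesis by simp
  qed
  have pair[measurable]: "(\<lambda>\<omega>. (Z \<omega>, \<omega>)) \<in> M \<rightarrow>\<^sub>M D \<Otimes>\<^sub>M MG"
  proof (rule measurable_Pair)
    show "Z \<in> M \<rightarrow>\<^sub>M D" using Zm by (simp add: D_def cong: measurable_cong_sets)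
    show "(\<lambda>\<omega>. \<omega>) \<in> M \<rightarrow>\<^sub>M MG"
      using GM sets.sets_into_space[of _ G] by (intro measurableI) (auto simp: space_MG sets_MG spG Int_absorb2)
  qed
  \<comment> \<open>A product of these measures is determined by rectangles, and on rectangles the
    equation is the independence of \<open>Z\<close> and \<open>G\<close>.\<close>
  have joint: "D \<Otimes>\<^sub>M MG = distr M (D \<Otimes>\<^sub>M MG) (\<lambda>\<omega>. (Z \<omega>, \<omega>))"
  proof (rule pair_measure_eqI)
    show "sigma_finite_measure D" "sigma_finite_measure MG" by unfold_locales
    show "sets (D \<Otimes>\<^sub>M MG) = sets (distr M (D \<Otimes>\<^sub>M MG) (\<lambda>\<omega>. (Z \<omega>, \<omega>)))" by simp
    fix A A' assume A: "A \<in> sets D" and A': "A' \<in> sets MG"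
    have Ab: "A \<in> sets borel" using A by (simp add: D_def)
    have AG: "A' \<in> sets G" using A' by (simp add: sets_MG)
    have V: "Z -` A \<inter> space M \<in> sets V" unfolding V_def by (rule in_vimage_algebra[OF Ab])
    have "emeasure D A = emeasure M (Z -` A \<inter> space M)"
      unfolding D[symmetric] using Zm Ab by (subst emeasure_distr) auto
    then have "emeasure D A * emeasure MG A' = ennreal (prob (Z -` A \<inter> space M) * prob A')"
      by (simp add: em[OF AG] emeasure_eq_measure ennreal_mult)
    also have "prob (Z -` A \<inter> space M) * prob A' = prob ((Z -` A \<inter> space M) \<inter> A')"
      by (rule indep_setD[OF ind V AG, symmetric])
    also have "(Z -` A \<inter> space M) \<inter> A' = (\<lambda>\<omega>. (Z \<omega>, \<omega>)) -` (A \<times> A') \<inter> space M" by auto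
    also have "ennreal (prob ((\<lambda>\<omega>. (Z \<omega>, \<omega>)) -` (A \<times> A') \<inter> space M))
      = emeasure (distr M (D \<Otimes>\<^sub>M MG) (\<lambda>\<omega>. (Z \<omega>, \<omega>))) (A \<times> A')"
      using A A' by (subst emeasure_distr) (auto simp: emeasure_eq_measure)
    finally show "emeasure D A * emeasure MG A' = emeasure (distr M (D \<Otimes>\<^sub>M MG) (\<lambda>\<omega>. (Z \<omega>, \<omega>))) (A \<times> A')" .
  qed
  \<comment> \<open>For a fixed target the hitting time is \<open>G\<close>-measurable, so the
    restricted measure gives it the same mean as \<open>M\<close>.\<close>
  have slice: "(\<integral>\<^sup>+ \<omega>. H (y, \<omega>) \<partial>MG) = expected_hitting_time M X y" for y
  proof -
    have "(\<lambda>\<omega>. hitting_time X y \<omega>) \<in> borel_measurable G"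
      by (rule hitting_time_measurable[where Y = "\<lambda>_. y"]) (use Xg cont spG in auto)
    then show ?thesis
      unfolding MG_def expected_hitting_time_def H_def using nn_integral_subalgebra2[OF sub] by simp
  qed
  have Em: "(\<lambda>y. expected_hitting_time M X y) \<in> borel_measurable lborel"
    using MG.borel_measurable_nn_integral_fst[OF Hm] unfolding slice by (simp add: D_def cong: measurable_cong_sets)
  have "expected_random_hitting_time M X Z = (\<integral>\<^sup>+ \<omega>. H (Z \<omega>, \<omega>) \<partial>M)"
    by (simp add: expected_random_hitting_time_def H_def)
  also have "\<dots> = (\<integral>\<^sup>+ z. H z \<partial>distr M (D \<Otimes>\<^sub>M MG) (\<lambda>\<omega>. (Z \<omega>, \<omega>)))"
    by (rule nn_integral_distr[OF pair, symmetric]) (use Hm in simp)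
  also have "\<dots> = (\<integral>\<^sup>+ z. H z \<partial>(D \<Otimes>\<^sub>M MG))" by (simp only: joint[symmetric])
  also have "\<dots> = (\<integral>\<^sup>+ y. \<integral>\<^sup>+ \<omega>. H (y, \<omega>) \<partial>MG \<partial>D)"
    by (rule MG.nn_integral_fst[OF Hm, symmetric])
  also have "\<dots> = (\<integral>\<^sup>+ y. expected_hitting_time M X y * ennreal (\<mu> y) \<partial>lborel)"
    unfolding slice D_def by (subst nn_integral_density[OF \<mu>m Em]) (simp add: mult.commute)
  finally show ?thesis .
qed

section \<open>Tonelli's theorem on half planes and the common value\<close>

lemma nn_integral_swap_triangle:
  fixes f g :: "real \<Rightarrow> ennreal"
  assumes [measurable]: "f \<in> borel_measurable borel" "g \<in> borel_measurable borel"
  shows "(\<integral>\<^sup>+ y. f y * (\<integral>\<^sup>+ z\<in>{y..}. g z \<partial>lborel) \<partial>lborel) = (\<integral>\<^sup>+ z. g z * (\<integral>\<^sup>+ y\<in>{..z}. f y \<partial>lborel) \<partial>lborel)"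
    and "(\<integral>\<^sup>+ y. f y * (\<integral>\<^sup>+ z\<in>{..y}. g z \<partial>lborel) \<partial>lborel) = (\<integral>\<^sup>+ z. g z * (\<integral>\<^sup>+ y\<in>{z..}. f y \<partial>lborel) \<partial>lborel)"
proof -
  \<comment> \<open>Stated for all \<open>f\<close> and \<open>g\<close>, since the second identity
    is the first one read backwards with the two functions exchanged.\<close>
  have A: "(\<integral>\<^sup>+ y. f y * (\<integral>\<^sup>+ z\<in>{y..}. g z \<partial>lborel) \<partial>lborel) = (\<integral>\<^sup>+ z. g z * (\<integral>\<^sup>+ y\<in>{..z}. f y \<partial>lborel) \<partial>lborel)"
    if [measurable]: "f \<in> borel_measurable borel" "g \<in> borel_measurable borel" for f g :: "real \<Rightarrow> ennreal"
  proof -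
    have "(\<integral>\<^sup>+ y. f y * (\<integral>\<^sup>+ z\<in>{y..}. g z \<partial>lborel) \<partial>lborel)
      = (\<integral>\<^sup>+ y. \<integral>\<^sup>+ z. f y * g z * (if y \<le> z then 1 else 0) \<partial>lborel \<partial>lborel)"
      by (subst nn_integral_cmult[symmetric]) (auto intro!: nn_integral_cong simp: indicator_def ac_simps)
    also have "\<dots> = (\<integral>\<^sup>+ z. \<integral>\<^sup>+ y. f y * g z * (if y \<le> z then 1 else 0) \<partial>lborel \<partial>lborel)"
      by (rule lborel_pair.Fubini') measurable
    also have "\<dots> = (\<integral>\<^sup>+ z. g z * (\<integral>\<^sup>+ y\<in>{..z}. f y \<partial>lborel) \<partial>lborel)"
      by (subst nn_integral_cmult[symmetric]) (auto intro!: nn_integral_cong simp: indicator_def ac_simps)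
    finally show ?thesis .
  qed
  show "(\<integral>\<^sup>+ y. f y * (\<integral>\<^sup>+ z\<in>{y..}. g z \<partial>lborel) \<partial>lborel) = (\<integral>\<^sup>+ z. g z * (\<integral>\<^sup>+ y\<in>{..z}. f y \<partial>lborel) \<partial>lborel)"
    by (rule A) fact+
  show "(\<integral>\<^sup>+ y. f y * (\<integral>\<^sup>+ z\<in>{..y}. g z \<partial>lborel) \<partial>lborel) = (\<integral>\<^sup>+ z. g z * (\<integral>\<^sup>+ y\<in>{z..}. f y \<partial>lborel) \<partial>lborel)"
    by (rule A[symmetric]) fact+
qed

context diffusion_coefficients
begin

definition "mass_below z = (\<integral>\<^sup>+ w\<in>{..z}. ennreal (speed w) \<partial>lborel)"
definition "mass_above z = (\<integral>\<^sup>+ w\<in>{z..}. ennreal (speed w) \<partial>lborel)"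

lemma speed_measurable[measurable]: "speed \<in> borel_measurable borel"
  by (rule borel_measurable_continuous_onI[OF continuous_speed])

lemma scale_deriv_measurable[measurable]: "scale_deriv \<in> borel_measurable borel"
  by (rule borel_measurable_continuous_onI[OF continuous_scale_deriv])

lemma mass_measurable[measurable]: "mass_below \<in> borel_measurable borel" "mass_above \<in> borel_measurable borel"
  unfolding mass_below_def[abs_def] mass_above_def[abs_def]
  by (rule borel_measurable_nn_integral_tail; measurable)+

text \<open>Up to the factor \<open>2 c\<^sub>0\<close>, the common value of all expressions in the theorem.\<close>

definition "balance = (\<integral>\<^sup>+ z. ennreal (scale_deriv z) * mass_below z * mass_above z \<partial>lborel)"

lemma nn_integral_speed_swap:
  fixes g :: "real \<Rightarrow> ennreal"
  assumes [measurable]: "g \<in> borel_measurable borel"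
  shows "(\<integral>\<^sup>+ y. ennreal (speed y) * (\<integral>\<^sup>+ z\<in>{y..}. g z \<partial>lborel) \<partial>lborel) = (\<integral>\<^sup>+ z. g z * mass_below z \<partial>lborel)"
    and "(\<integral>\<^sup>+ y. ennreal (speed y) * (\<integral>\<^sup>+ z\<in>{..y}. g z \<partial>lborel) \<partial>lborel) = (\<integral>\<^sup>+ z. g z * mass_above z \<partial>lborel)"
  unfolding mass_below_def mass_above_def by (rule nn_integral_swap_triangle; measurable)+

lemma balance_eq_above:
  "(\<integral>\<^sup>+ y. ennreal (speed y) * (\<integral>\<^sup>+ z\<in>{y..}. ennreal (scale_deriv z) * mass_above z \<partial>lborel) \<partial>lborel) = balance"
  by (subst nn_integral_speed_swap(1)) (auto simp: balance_def ac_simps)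

lemma balance_eq_below:
  "(\<integral>\<^sup>+ y. ennreal (speed y) * (\<integral>\<^sup>+ z\<in>{..y}. ennreal (scale_deriv z) * mass_below z \<partial>lborel) \<partial>lborel) = balance"
  by (subst nn_integral_speed_swap(2)) (auto simp: balance_def ac_simps)

text \<open>The reason why \<open>x\<close> disappears: a point \<open>z > x\<close> enters the mean
  hitting time of \<open>y\<close> when \<open>y \<ge> z\<close>, with weight
  \<open>scale_deriv z * mass_below z\<close>, and the targets beyond \<open>z\<close> have speed
  mass \<open>mass_above z\<close>. For \<open>z < x\<close> the two masses exchange roles, so the
  product is the same on either side of \<open>x\<close>.\<close>

lemma nn_integral_expected_hitting_time:
  assumes sol: "solves_martingale_problem a b x M X"
    and fin: "(\<integral>\<^sup>+ z. ennreal (speed z) \<partial>lborel) < \<infinity>"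
  shows "(\<integral>\<^sup>+ y. expected_hitting_time M X y * (c * ennreal (speed y)) \<partial>lborel) = 2 * (c * balance)"
proof -
  let ?g1 = "\<lambda>z. ennreal (scale_deriv z) * mass_below z * indicator {x..} z"
  let ?g2 = "\<lambda>z. ennreal (scale_deriv z) * mass_above z * indicator {..x} z"
  let ?I1 = "\<lambda>y. \<integral>\<^sup>+ z\<in>{..y}. ?g1 z \<partial>lborel" and ?I2 = "\<lambda>y. \<integral>\<^sup>+ z\<in>{y..}. ?g2 z \<partial>lborel"
  have [measurable]: "?I1 \<in> borel_measurable borel" "?I2 \<in> borel_measurable borel"
    by (rule borel_measurable_nn_integral_tail; measurable)+
  \<comment> \<open>\<open>?I1\<close> covers the targets right of \<open>x\<close> and
    \<open>?I2\<close> those left of it; the other integral is then 0, so the sum treats both sides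
    at once.\<close>
  have E: "expected_hitting_time M X y = 2 * (?I1 y + ?I2 y)" if "y \<noteq> x" for y
  proof (cases "x < y")
    case True
    have "?I1 y = (\<integral>\<^sup>+ z\<in>{x..y}. ennreal (scale_deriv z) * mass_below z \<partial>lborel)"
      by (intro nn_integral_cong) (auto simp: indicator_def)
    moreover have "?I2 y = (\<integral>\<^sup>+ z. 0 \<partial>(lborel :: real measure))"
      using True by (intro nn_integral_cong) (auto simp: indicator_def)
    ultimately show ?thesis
      using expected_hitting_time_right[OF sol True fin] by (simp add: mass_below_def)
  next
    case False
    with that have less: "y < x" by simp
    have "?I2 y = (\<integral>\<^sup>+ z\<in>{y..x}. ennreal (scale_deriv z) * mass_above z \<partial>lborel)"
      by (intro nn_integral_cong) (auto simp: indicator_def)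
    moreover have "?I1 y = (\<integral>\<^sup>+ z. 0 \<partial>(lborel :: real measure))"
      using less by (intro nn_integral_cong) (auto simp: indicator_def)
    ultimately show ?thesis
      using expected_hitting_time_left[OF sol less fin] by (simp add: mass_above_def)
  qed
  have ae: "AE y in lborel. y \<noteq> x" by (rule AE_lborel_singleton)
  have "(\<integral>\<^sup>+ y. expected_hitting_time M X y * (c * ennreal (speed y)) \<partial>lborel)
    = (\<integral>\<^sup>+ y. 2 * c * (ennreal (speed y) * ?I1 y + ennreal (speed y) * ?I2 y) \<partial>lborel)"
    by (rule nn_integral_cong_AE, use ae in eventually_elim) (simp add: E distrib_left ac_simps)
  also have "\<dots> = 2 * c * ((\<integral>\<^sup>+ y. ennreal (speed y) * ?I1 y \<partial>lborel) + (\<integral>\<^sup>+ y. ennreal (speed y) * ?I2 y \<partial>lborel))"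
    by (simp add: nn_integral_cmult nn_integral_add)
  also have "\<dots> = 2 * c * ((\<integral>\<^sup>+ z. ?g1 z * mass_above z \<partial>lborel) + (\<integral>\<^sup>+ z. ?g2 z * mass_below z \<partial>lborel))"
    by (subst nn_integral_speed_swap(1), measurable, subst nn_integral_speed_swap(2), measurable)
  also have "(\<integral>\<^sup>+ z. ?g1 z * mass_above z \<partial>lborel) + (\<integral>\<^sup>+ z. ?g2 z * mass_below z \<partial>lborel)
    = (\<integral>\<^sup>+ z. ?g1 z * mass_above z + ?g2 z * mass_below z \<partial>lborel)"
    by (rule nn_integral_add[symmetric]) measurable
  \<comment> \<open>Away from \<open>z = x\<close> exactly one of the two indicators is 1, and the
    single point \<open>x\<close> is a null set.\<close>
  also have "\<dots> = balance"
    unfolding balance_def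
    by (rule nn_integral_cong_AE, use ae in eventually_elim) (auto simp: indicator_def ac_simps)
  finally show ?thesis by (simp add: mult.assoc)
qed

section \<open>The entrance conditions as finiteness of the common value\<close>

lemma mass_le:
  "mass_below z \<le> (\<integral>\<^sup>+ w. ennreal (speed w) \<partial>lborel)" "mass_above z \<le> (\<integral>\<^sup>+ w. ennreal (speed w) \<partial>lborel)"
  unfolding mass_below_def mass_above_def by (auto intro!: nn_integral_mono simp: indicator_def)

lemma mass_mono:
  "y \<le> z \<Longrightarrow> mass_below y \<le> mass_below z" "y \<le> z \<Longrightarrow> mass_above z \<le> mass_above y"
  unfolding mass_below_def mass_above_def by (auto intro!: nn_integral_mono simp: indicator_def)

text \<open>Positive masses at 0 are what allows the entrance integrals to be bounded by
  \<open>balance\<close>.\<close>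

lemma mass_pos: "0 < mass_below z" "0 < mass_above z"
proof -
  have *: "0 < (\<integral>\<^sup>+ w\<in>S. ennreal (speed w) \<partial>lborel)" if "{u..u + 1} \<subseteq> S" for S and u
  proof -
    have "0 < primitive u speed (u + 1)"
    proof -
      have "primitive u speed u < primitive u speed (u + 1)"
        by (rule DERIV_pos_imp_increasing) (use DERIV_primitive[OF continuous_speed] speed_pos in auto)
      then show ?thesis by simp
    qed
    then have "0 < (\<integral>\<^sup>+ w\<in>{u..u + 1}. ennreal (speed w) \<partial>lborel)"
      using speed_pos less_imp_le by (subst nn_integral_primitive[OF continuous_speed]) auto
    also have "\<dots> \<le> (\<integral>\<^sup>+ w\<in>S. ennreal (speed w) \<partial>lborel)"
      using that by (intro nn_integral_mono) (auto simp: indicator_def)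
    finally show ?thesis .
  qed
  show "0 < mass_below z" unfolding mass_below_def by (rule *[of "z - 1"]) auto
  show "0 < mass_above z" unfolding mass_above_def by (rule *[of z]) auto
qed

text \<open>Interchanging the two integrals brings the classical condition to the form of
  \<open>balance\<close>: a point \<open>y \<ge> 0\<close> is counted once for all
  \<open>x \<ge> y\<close>, that is, with weight \<open>mass_above y\<close>.\<close>

lemma entrance_boundary_at_top_iff:
  "entrance_boundary_at_top a b \<longleftrightarrow> (\<integral>\<^sup>+ z\<in>{0..}. ennreal (scale_deriv z) * mass_above z \<partial>lborel) < \<infinity>"
proof -
  have "(\<integral>\<^sup>+ x\<in>{0..}. ennreal (1 / a x * exp (B x)) * (\<integral>\<^sup>+ y\<in>{0..x}. ennreal (exp (- B y)) \<partial>lborel) \<partial>lborel)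
    = (\<integral>\<^sup>+ x. ennreal (speed x) * (\<integral>\<^sup>+ y\<in>{..x}. ennreal (scale_deriv y) * indicator {0..} y \<partial>lborel) \<partial>lborel)"
  proof (intro nn_integral_cong)
    fix x
    have "(\<integral>\<^sup>+ y\<in>{..x}. ennreal (scale_deriv y) * indicator {0..} y \<partial>lborel) = (\<integral>\<^sup>+ y\<in>{0..x}. ennreal (exp (- B y)) \<partial>lborel)"
      by (intro nn_integral_cong) (auto simp: indicator_def scale_deriv_def)
    \<comment> \<open>For negative \<open>x\<close> the inner range is empty, so dropping the outer
      restriction to \<open>[0, \<infinity>)\<close> adds nothing.\<close>
    moreover have "(\<integral>\<^sup>+ y\<in>{0..x}. ennreal (exp (- B y)) \<partial>lborel) = 0" if "x < 0" using that by simp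
    ultimately show "ennreal (1 / a x * exp (B x)) * (\<integral>\<^sup>+ y\<in>{0..x}. ennreal (exp (- B y)) \<partial>lborel) * indicator {0..} x
      = ennreal (speed x) * (\<integral>\<^sup>+ y\<in>{..x}. ennreal (scale_deriv y) * indicator {0..} y \<partial>lborel)"
      by (cases "0 \<le> x") (auto simp: speed_def)
  qed
  also have "\<dots> = (\<integral>\<^sup>+ z\<in>{0..}. ennreal (scale_deriv z) * mass_above z \<partial>lborel)"
    by (subst nn_integral_speed_swap(2)) (auto simp: ac_simps)
  finally show ?thesis by (simp only: entrance_boundary_at_top_def)
qed

lemma entrance_boundary_at_bot_iff:
  "entrance_boundary_at_bot a b \<longleftrightarrow> (\<integral>\<^sup>+ z\<in>{..0}. ennreal (scale_deriv z) * mass_below z \<partial>lborel) < \<infinity>"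
proof -
  have "(\<integral>\<^sup>+ x\<in>{..0}. ennreal (1 / a x * exp (B x)) * (\<integral>\<^sup>+ y\<in>{x..0}. ennreal (exp (- B y)) \<partial>lborel) \<partial>lborel)
    = (\<integral>\<^sup>+ x. ennreal (speed x) * (\<integral>\<^sup>+ y\<in>{x..}. ennreal (scale_deriv y) * indicator {..0} y \<partial>lborel) \<partial>lborel)"
  proof (intro nn_integral_cong)
    fix x
    have "(\<integral>\<^sup>+ y\<in>{x..}. ennreal (scale_deriv y) * indicator {..0} y \<partial>lborel) = (\<integral>\<^sup>+ y\<in>{x..0}. ennreal (exp (- B y)) \<partial>lborel)"
      by (intro nn_integral_cong) (auto simp: indicator_def scale_deriv_def)
    moreover have "(\<integral>\<^sup>+ y\<in>{x..0}. ennreal (exp (- B y)) \<partial>lborel) = 0" if "0 < x" using that by simp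
    ultimately show "ennreal (1 / a x * exp (B x)) * (\<integral>\<^sup>+ y\<in>{x..0}. ennreal (exp (- B y)) \<partial>lborel) * indicator {..0} x
      = ennreal (speed x) * (\<integral>\<^sup>+ y\<in>{x..}. ennreal (scale_deriv y) * indicator {..0} y \<partial>lborel)"
      by (cases "x \<le> 0") (auto simp: speed_def)
  qed
  also have "\<dots> = (\<integral>\<^sup>+ z\<in>{..0}. ennreal (scale_deriv z) * mass_below z \<partial>lborel)"
    by (subst nn_integral_speed_swap(1)) (auto simp: ac_simps)
  finally show ?thesis by (simp only: entrance_boundary_at_bot_def)
qed

text \<open>Right of 0, \<open>mass_below\<close> lies between the positive number
  \<open>mass_below 0\<close> and the finite total mass, so that half of \<open>balance\<close> is
  finite exactly when the condition at the top holds. Left of 0 the same is true of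
  \<open>mass_above\<close> and the condition at the bottom.\<close>

lemma balance_finite_iff:
  assumes fin: "(\<integral>\<^sup>+ z. ennreal (speed z) \<partial>lborel) < \<infinity>"
  shows "balance < \<infinity> \<longleftrightarrow> entrance_boundary_at_top a b \<and> entrance_boundary_at_bot a b"
proof -
  let ?m = "\<integral>\<^sup>+ z. ennreal (speed z) \<partial>lborel"
  let ?T = "\<integral>\<^sup>+ z\<in>{0..}. ennreal (scale_deriv z) * mass_above z \<partial>lborel"
  let ?L = "\<integral>\<^sup>+ z\<in>{..0}. ennreal (scale_deriv z) * mass_below z \<partial>lborel"
  have upper: "balance \<le> ?T * ?m + ?L * ?m"
  proof -
    have "balance \<le> (\<integral>\<^sup>+ z. ennreal (scale_deriv z) * mass_above z * indicator {0..} z * ?m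
        + ennreal (scale_deriv z) * mass_below z * indicator {..0} z * ?m \<partial>lborel)"
      unfolding balance_def
    proof (rule nn_integral_mono)
      fix z :: real
      show "ennreal (scale_deriv z) * mass_below z * mass_above z
        \<le> ennreal (scale_deriv z) * mass_above z * indicator {0..} z * ?m
        + ennreal (scale_deriv z) * mass_below z * indicator {..0} z * ?m"
      proof (cases "0 \<le> z")
        case True
        have "ennreal (scale_deriv z) * mass_below z * mass_above z = ennreal (scale_deriv z) * mass_above z * mass_below z"
          by (simp add: ac_simps)
        also have "\<dots> \<le> ennreal (scale_deriv z) * mass_above z * ?m" by (intro mult_left_mono mass_le) simp
        finally show ?thesis using True by (simp add: add_increasing2)
      next
        case False
        have "ennreal (scale_deriv z) * mass_below z * mass_above z \<le> ennreal (scale_deriv z) * mass_below z * ?m"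
          by (intro mult_left_mono mass_le) simp
        then show ?thesis using False by simp
      qed
    qed
    also have "\<dots> = ?T * ?m + ?L * ?m"
      by (subst nn_integral_add, measurable, subst (1 2) nn_integral_multc) auto
    finally show ?thesis .
  qed
  have lowerT: "?T * mass_below 0 \<le> balance"
  proof -
    have "?T * mass_below 0 = (\<integral>\<^sup>+ z. ennreal (scale_deriv z) * mass_above z * indicator {0..} z * mass_below 0 \<partial>lborel)"
      by (rule nn_integral_multc[symmetric]) measurable
    also have "\<dots> \<le> balance"
      unfolding balance_def
    proof (rule nn_integral_mono)
      fix z :: real
      show "ennreal (scale_deriv z) * mass_above z * indicator {0..} z * mass_below 0
        \<le> ennreal (scale_deriv z) * mass_below z * mass_above z"
        using mult_left_mono[OF mass_mono(1)[of 0 z], of "ennreal (scale_deriv z) * mass_above z"]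
        by (cases "0 \<le> z") (auto simp: ac_simps)
    qed
    finally show ?thesis .
  qed
  have lowerL: "?L * mass_above 0 \<le> balance"
  proof -
    have "?L * mass_above 0 = (\<integral>\<^sup>+ z. ennreal (scale_deriv z) * mass_below z * indicator {..0} z * mass_above 0 \<partial>lborel)"
      by (rule nn_integral_multc[symmetric]) measurable
    also have "\<dots> \<le> balance"
      unfolding balance_def
    proof (rule nn_integral_mono)
      fix z :: real
      show "ennreal (scale_deriv z) * mass_below z * indicator {..0} z * mass_above 0
        \<le> ennreal (scale_deriv z) * mass_below z * mass_above z"
        using mult_left_mono[OF mass_mono(2)[of z 0], of "ennreal (scale_deriv z) * mass_below z"]
        by (cases "z \<le> 0") (auto simp: ac_simps)
    qed
    finally show ?thesis .
  qed
  show ?thesis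
    unfolding entrance_boundary_at_top_iff entrance_boundary_at_bot_iff
  proof
    assume "balance < \<infinity>"
    then have "?T * mass_below 0 < \<infinity>" "?L * mass_above 0 < \<infinity>"
      using lowerT lowerL by (auto intro: le_less_trans)
    then show "?T < \<infinity> \<and> ?L < \<infinity>"
      using mass_pos(1)[of 0] mass_pos(2)[of 0] by (auto simp: ennreal_mult_less_top)
  next
    assume "?T < \<infinity> \<and> ?L < \<infinity>"
    then have "?T * ?m + ?L * ?m < \<infinity>" using fin by (auto simp: ennreal_mult_less_top)
    then show "balance < \<infinity>" using upper by (rule le_less_trans[rotated])
  qed
qed

text \<open>The normalizing constant cancels: the tail of \<open>\<mu>\<close> is \<open>c0\<close>
  times a speed mass, and \<open>\<mu> z * a z\<close> is \<open>c0 * exp (B z)\<close>.\<close>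

lemma tail_mass_ratio:
  assumes c0: "0 < c0" and \<mu>: "\<And>x. \<mu> x = c0 / a x * exp (B x)"
  shows "emeasure (density lborel (\<lambda>x. ennreal (\<mu> x))) {z..} / ennreal (\<mu> z * a z) = ennreal (scale_deriv z) * mass_above z"
    and "emeasure (density lborel (\<lambda>x. ennreal (\<mu> x))) {..z} / ennreal (\<mu> z * a z) = ennreal (scale_deriv z) * mass_below z"
proof -
  have \<mu>_speed: "ennreal (\<mu> w) = ennreal c0 * ennreal (speed w)" for w
    using c0 speed_pos[of w] by (simp add: \<mu> speed_def ennreal_mult[symmetric])
  have "(\<lambda>x. ennreal (\<mu> x)) \<in> borel_measurable lborel" unfolding \<mu>_speed by measurable
  then have em: "emeasure (density lborel (\<lambda>x. ennreal (\<mu> x))) S = ennreal c0 * (\<integral>\<^sup>+ w\<in>S. ennreal (speed w) \<partial>lborel)"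
    if S: "S \<in> sets borel" for S
    using S by (subst emeasure_density) (auto simp: \<mu>_speed mult.assoc nn_integral_cmult)
  have ratio: "ennreal c0 * m / ennreal (\<mu> z * a z) = ennreal (scale_deriv z) * m" for m
  proof -
    have eq: "\<mu> z * a z = c0 * exp (B z)" using a_pos[of z] by (simp add: \<mu>)
    have "ennreal c0 * m / ennreal (\<mu> z * a z) = m * (ennreal c0 / ennreal (\<mu> z * a z))"
      by (simp add: ennreal_times_divide mult.commute)
    also have "ennreal c0 / ennreal (\<mu> z * a z) = ennreal (scale_deriv z)"
      unfolding eq using c0 by (subst divide_ennreal) (auto simp: scale_deriv_def exp_minus field_simps)
    finally show ?thesis by (simp add: mult.commute)
  qed
  show "emeasure (density lborel (\<lambda>x. ennreal (\<mu> x))) {z..} / ennreal (\<mu> z * a z) = ennreal (scale_deriv z) * mass_above z"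
    using em[of "{z..}"] ratio by (simp add: mass_above_def)
  show "emeasure (density lborel (\<lambda>x. ennreal (\<mu> x))) {..z} / ennreal (\<mu> z * a z) = ennreal (scale_deriv z) * mass_below z"
    using em[of "{..z}"] ratio by (simp add: mass_below_def)
qed

end

theorem theorem1:
  fixes a b \<mu> :: "real \<Rightarrow> real" and c0 :: real
    and P :: "real \<Rightarrow> 'w measure" and X :: "real \<Rightarrow> 'w \<Rightarrow> real" and Z :: "'w \<Rightarrow> real"
  assumes a_cont: "continuous_on UNIV a"
    and a_pos: "\<And>x. 0 < a x"
    and b_meas: "b \<in> borel_measurable borel"
    and b_locally_bounded: "\<And>K. compact K \<Longrightarrow> bounded (b ` K)"
    and diffusion: "diffusion a b P X"
    and pos_rec: "positive_recurrent a b"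
    and c0_pos: "0 < c0"
    and \<mu>_def: "\<And>x. \<mu> x = c0 / a x * exp (drift_exponent a b x)"
    and \<mu>_normalized: "(\<integral>\<^sup>+ x. ennreal (\<mu> x) \<partial>lborel) = 1"
    and Z_indep: "\<And>x. independent_of_process (P x) Z X"
    and Z_distr: "\<And>x. distributed (P x) lborel Z (\<lambda>y. ennreal (\<mu> y))"
  shows "(entrance_boundary_at_top a b \<and> entrance_boundary_at_bot a b \<longrightarrow>
           (\<exists>C::ennreal. C < \<infinity> \<and>
              (\<forall>x. expected_random_hitting_time (P x) X Z =
                  (\<integral>\<^sup>+ y. expected_hitting_time (P x) X y * ennreal (\<mu> y) \<partial>lborel) \<and>
                expected_random_hitting_time (P x) X Z = C) \<and>
              C = 2 * (\<integral>\<^sup>+ y. ennreal (\<mu> y) *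
                    (\<integral>\<^sup>+ z\<in>{y..}. emeasure (density lborel (\<lambda>x. ennreal (\<mu> x))) {z..} /
                      ennreal (\<mu> z * a z) \<partial>lborel) \<partial>lborel) \<and>
              C = 2 * (\<integral>\<^sup>+ y. ennreal (\<mu> y) *
                    (\<integral>\<^sup>+ z\<in>{..y}. emeasure (density lborel (\<lambda>x. ennreal (\<mu> x))) {..z} /
                      ennreal (\<mu> z * a z) \<partial>lborel) \<partial>lborel))) \<and>
         (\<not> entrance_boundary_at_top a b \<or> \<not> entrance_boundary_at_bot a b \<longrightarrow>
           (\<forall>x. expected_random_hitting_time (P x) X Z =
                  (\<integral>\<^sup>+ y. expected_hitting_time (P x) X y * ennreal (\<mu> y) \<partial>lborel) \<and>
                expected_random_hitting_time (P x) X Z = \<infinity>))"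
proof -
  interpret diffusion_coefficients a b by unfold_locales (fact a_cont a_pos b_meas b_locally_bounded)+
  have sol: "solves_martingale_problem a b x (P x) X" for x using diffusion by (simp add: diffusion_def)
  have speed_eq: "speed x = 1 / a x * exp (drift_exponent a b x)" for x by (simp add: speed_def)
  have fin: "(\<integral>\<^sup>+ z. ennreal (speed z) \<partial>lborel) < \<infinity>"
    using pos_rec unfolding positive_recurrent_def speed_eq .
  have \<mu>_speed: "ennreal (\<mu> y) = ennreal c0 * ennreal (speed y)" for y
    using c0_pos speed_pos[of y] by (simp add: \<mu>_def speed_def ennreal_mult[symmetric])
  let ?C = "2 * (ennreal c0 * balance)"
  have random: "expected_random_hitting_time (P x) X Z
      = (\<integral>\<^sup>+ y. expected_hitting_time (P x) X y * ennreal (\<mu> y) \<partial>lborel)" for x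
    using sol[of x] Z_indep Z_distr
    by (intro expected_random_hitting_time_eq) (auto simp: solves_martingale_problem_def)
  \<comment> \<open>The starting point occurs on the left only, which is the independence of
    \<open>x\<close> claimed in part (1).\<close>
  have value_mean: "(\<integral>\<^sup>+ y. expected_hitting_time (P x) X y * ennreal (\<mu> y) \<partial>lborel) = ?C" for x
    unfolding \<mu>_speed by (rule nn_integral_expected_hitting_time[OF sol fin])
  have [measurable]:
    "(\<lambda>y. \<integral>\<^sup>+ z\<in>{y..}. ennreal (scale_deriv z) * mass_above z \<partial>lborel) \<in> borel_measurable borel"
    "(\<lambda>y. \<integral>\<^sup>+ z\<in>{..y}. ennreal (scale_deriv z) * mass_below z \<partial>lborel) \<in> borel_measurable borel"
    by (rule borel_measurable_nn_integral_tail; measurable)+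
  \<comment> \<open>The ratio contributes one of the two masses in \<open>balance\<close>; the
    interchange of the integrals in \<open>y\<close> and \<open>z\<close> contributes the
    other.\<close>
  have above: "2 * (\<integral>\<^sup>+ y. ennreal (\<mu> y) * (\<integral>\<^sup>+ z\<in>{y..}.
      emeasure (density lborel (\<lambda>x. ennreal (\<mu> x))) {z..} / ennreal (\<mu> z * a z) \<partial>lborel) \<partial>lborel) = ?C"
    unfolding tail_mass_ratio(1)[OF c0_pos \<mu>_def]
    unfolding \<mu>_speed balance_eq_above[symmetric] mult.assoc[of "ennreal c0"]
    by (subst nn_integral_cmult) simp_all
  have below: "2 * (\<integral>\<^sup>+ y. ennreal (\<mu> y) * (\<integral>\<^sup>+ z\<in>{..y}.
      emeasure (density lborel (\<lambda>x. ennreal (\<mu> x))) {..z} / ennreal (\<mu> z * a z) \<partial>lborel) \<partial>lborel) = ?C"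
    unfolding tail_mass_ratio(2)[OF c0_pos \<mu>_def]
    unfolding \<mu>_speed balance_eq_below[symmetric] mult.assoc[of "ennreal c0"]
    by (subst nn_integral_cmult) simp_all
  have C_fin: "?C < \<infinity> \<longleftrightarrow> entrance_boundary_at_top a b \<and> entrance_boundary_at_bot a b"
    using balance_finite_iff[OF fin] c0_pos by (auto simp: ennreal_mult_less_top)
  show ?thesis
  proof (intro conjI impI allI)
    assume "entrance_boundary_at_top a b \<and> entrance_boundary_at_bot a b"
    then show "\<exists>C::ennreal. C < \<infinity> \<and>
        (\<forall>x. expected_random_hitting_time (P x) X Z =
            (\<integral>\<^sup>+ y. expected_hitting_time (P x) X y * ennreal (\<mu> y) \<partial>lborel) \<and>
          expected_random_hitting_time (P x) X Z = C) \<and>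
        C = 2 * (\<integral>\<^sup>+ y. ennreal (\<mu> y) * (\<integral>\<^sup>+ z\<in>{y..}.
          emeasure (density lborel (\<lambda>x. ennreal (\<mu> x))) {z..} / ennreal (\<mu> z * a z) \<partial>lborel) \<partial>lborel) \<and>
        C = 2 * (\<integral>\<^sup>+ y. ennreal (\<mu> y) * (\<integral>\<^sup>+ z\<in>{..y}.
          emeasure (density lborel (\<lambda>x. ennreal (\<mu> x))) {..z} / ennreal (\<mu> z * a z) \<partial>lborel) \<partial>lborel)"
      unfolding above below using C_fin random value_mean by (intro exI[of _ ?C]) simp
  next
    fix x
    show "expected_random_hitting_time (P x) X Z
      = (\<integral>\<^sup>+ y. expected_hitting_time (P x) X y * ennreal (\<mu> y) \<partial>lborel)" by (rule random)
    assume "\<not> entrance_boundary_at_top a b \<or> \<not> entrance_boundary_at_bot a b"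
    then have "?C = \<infinity>" using C_fin by (auto simp: less_top[symmetric])
    then show "expected_random_hitting_time (P x) X Z = \<infinity>" unfolding random value_mean .
  qed
qed

end
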